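(* Let $T>0$, $a,b>0$, $p>1$ and $\alpha\in(1/p,1]$ be constants, let $f\in C([0,T]\times\mathbb{R},\mathbb{R})$, and set $F(t,x)=\int_0^x f(t,s)\,ds$. Suppose that: (i) there exist two constants $\mu>p^2$ and $R>0$ such that $0<\mu F(t,x)\le x f(t,x)$ for all $t\in[0,T]$ and all $x\in\mathbb{R}$ with $|x|\ge R$; (ii) $f(t,x)=o(|x|^{p-1})$ as $|x|\to 0$, uniformly for $t\in[0,T]$. Then the Kirchhoff-type fractional $p$-Laplacian Dirichlet problem $$\left(a+b\int_0^T|{}_0D_t^\alpha u(t)|^p\,dt\right)^{p-1}{}_tD_T^\alpha\,\phi_p({}_0D_t^\alpha u(t))=f(t,u(t)),\quad t\in(0,T),\qquad u(0)=u(T)=0,$$ possesses at least one nontrivial weak solution, i.e. a weak solution $u\ne 0$.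
   Context: $\phi_p:\mathbb{R}\to\mathbb{R}$ is defined by $\phi_p(s)=|s|^{p-2}s$ for $s\neq 0$ and $\phi_p(0)=0$. Fractional derivatives. For $\gamma>0$ the left and right Riemann-Liouville integrals on $[0,T]$ are ${}_0I_t^\gamma u(t)=\frac1{\Gamma(\gamma)}\int_0^t(t-s)^{\gamma-1}u(s)\,ds$ and ${}_tI_T^\gamma u(t)=\frac1{\Gamma(\gamma)}\int_t^T(s-t)^{\gamma-1}u(s)\,ds$. For $0<\alpha<1$, ${}_0D_t^\alpha u=\frac{d}{dt}\,{}_0I_t^{1-\alpha}u$ and ${}_tD_T^\alpha u=-\frac{d}{dt}\,{}_tI_T^{1-\alpha}u$; for $\alpha=1$, ${}_0D_t^1u=u'$ and ${}_tD_T^1u=-u'$. Function space. $E_0^{\alpha,p}$ is the closure of $C_0^\infty([0,T],\mathbb{R})$ (smooth functions on $[0,T]$ vanishing at $0$ and $T$; using smooth functions compactly supported in $(0,T)$ gives the same space for $1/p<\alpha\le 1$) with respect to the norm $(\|u\|_{L^p}^p+\|{}_0D_t^\alpha u\|_{L^p}^p)^{1/p}$; for $u$ in the closure, ${}_0D_t^\alpha u\in L^p([0,T],\mathbb{R})$ is the $L^p$-limit of the derivatives of an approximating sequence. The space is equipped with the equivalent norm $\|u\|_{E^{\alpha,p}}=\|{}_0D_t^\alpha u\|_{L^p}$. Since $\alpha>1/p$, its elements are continuous functions on $[0,T]$ with $u(0)=u(T)=0$. Weak solutions. A weak solution of the Dirichlet problem is a critical point $u\in E_0^{\alpha,p}$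 of the $C^1$ functional $$I(u)=\frac{1}{bp^2}\left(a+b\|u\|_{E^{\alpha,p}}^p\right)^p-\int_0^TF(t,u(t))\,dt-\frac{a^p}{bp^2},\qquad u\in E_0^{\alpha,p},$$ equivalently $u\in E_0^{\alpha,p}$ such that for all $v\in E_0^{\alpha,p}$ $$(a+b\|u\|_{E^{\alpha,p}}^p)^{p-1}\int_0^T\phi_p({}_0D_t^\alpha u(t))\,{}_0D_t^\alpha v(t)\,dt=\int_0^Tf(t,u(t))v(t)\,dt.$$ *)

theory Defs
  imports "HOL-Analysis.Analysis"
begin

text \<open>Functions on the interval \<open>[0,T]\<close> are represented by total functions on the reals;
  only their values on \<open>[0,T]\<close> matter.\<close>

definition in_Lp :: "real \<Rightarrow> real \<Rightarrow> (real \<Rightarrow> real) \<Rightarrow> bool" where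
  "in_Lp p T g \<longleftrightarrow> g \<in> borel_measurable (lebesgue_on {0..T}) \<and>
     integrable (lebesgue_on {0..T}) (\<lambda>t. \<bar>g t\<bar> powr p)"

definition Lp_norm :: "real \<Rightarrow> real \<Rightarrow> (real \<Rightarrow> real) \<Rightarrow> real" where
  "Lp_norm p T g = (LINT t|lebesgue_on {0..T}. \<bar>g t\<bar> powr p) powr (1 / p)"

definition RL_integral :: "real \<Rightarrow> (real \<Rightarrow> real) \<Rightarrow> real \<Rightarrow> real" where
  "RL_integral \<gamma> u t = 1 / Gamma \<gamma> * (LINT s:{0..t}|lborel. (t - s) powr (\<gamma> - 1) * u s)"

text \<open>The pointwise left Riemann-Liouville derivative of order \<open>\<alpha> \<in> (0,1]\<close>. It is only used
  for smooth functions on \<open>[0,T]\<close> and up to null sets, so its values at the end points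
  are irrelevant.\<close>

definition RL_deriv :: "real \<Rightarrow> (real \<Rightarrow> real) \<Rightarrow> real \<Rightarrow> real" where
  "RL_deriv \<alpha> u t = (if \<alpha> = 1 then deriv u t else deriv (RL_integral (1 - \<alpha>) u) t)"

text \<open>Smooth functions on \<open>[0,T]\<close> (one-sided derivatives at the end points) that vanish
  at \<open>0\<close> and \<open>T\<close>; \<open>d k\<close> is the \<open>k\<close>-th derivative.\<close>

definition C0_infinity :: "real \<Rightarrow> (real \<Rightarrow> real) set" where
  "C0_infinity T = {u. u 0 = 0 \<and> u T = 0 \<and>
     (\<exists>d :: nat \<Rightarrow> real \<Rightarrow> real. (\<forall>t\<in>{0..T}. d 0 t = u t) \<and>
        (\<forall>k. \<forall>t\<in>{0..T}. (d k has_real_derivative d (Suc k) t) (at t within {0..T})))}"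

text \<open>\<open>u\<close> belongs to the closure of \<open>C0_infinity T\<close> for the norm
  \<open>(\<parallel>u\<parallel>\<^sup>p + \<parallel>D u\<parallel>\<^sup>p)\<close> to the power \<open>1/p\<close>, and \<open>g\<close> is the \<open>L\<^sup>p\<close>-limit of the
  derivatives of an approximating sequence.\<close>

definition has_frac_deriv :: "real \<Rightarrow> real \<Rightarrow> real \<Rightarrow> (real \<Rightarrow> real) \<Rightarrow> (real \<Rightarrow> real) \<Rightarrow> bool" where
  "has_frac_deriv \<alpha> p T u g \<longleftrightarrow> in_Lp p T u \<and> in_Lp p T g \<and>
     (\<exists>w :: nat \<Rightarrow> real \<Rightarrow> real. (\<forall>n. w n \<in> C0_infinity T) \<and>
        (\<lambda>n. (Lp_norm p T (\<lambda>t. w n t - u t) powr p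
             + Lp_norm p T (\<lambda>t. RL_deriv \<alpha> (w n) t - g t) powr p) powr (1 / p))
          \<longlonglongrightarrow> 0)"

text \<open>An element of the closure is a class of functions modulo equality almost everywhere. For
  \<open>1/p < \<alpha>\<close> each class has exactly one continuous representative on \<open>[0,T]\<close>, which is
  the one taken here. Its zero boundary values are a consequence and are not imposed.\<close>

definition E0 :: "real \<Rightarrow> real \<Rightarrow> real \<Rightarrow> (real \<Rightarrow> real) set" where
  "E0 \<alpha> p T = {u. continuous_on {0..T} u \<and> (\<exists>g. has_frac_deriv \<alpha> p T u g)}"

text \<open>The derivative on the closure is determined up to a null set.\<close>

definition frac_D :: "real \<Rightarrow> real \<Rightarrow> real \<Rightarrow> (real \<Rightarrow> real) \<Rightarrow> real \<Rightarrow> real" where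
  "frac_D \<alpha> p T u = (SOME g. has_frac_deriv \<alpha> p T u g)"

definition E_norm :: "real \<Rightarrow> real \<Rightarrow> real \<Rightarrow> (real \<Rightarrow> real) \<Rightarrow> real" where
  "E_norm \<alpha> p T u = Lp_norm p T (frac_D \<alpha> p T u)"

text \<open>The interval integral is oriented, so \<open>x < 0\<close> is covered.\<close>

definition primitive :: "(real \<Rightarrow> real \<Rightarrow> real) \<Rightarrow> real \<Rightarrow> real \<Rightarrow> real" where
  "primitive f t x = (LBINT s=0..x. f t s)"

definition energy ::
  "real \<Rightarrow> real \<Rightarrow> real \<Rightarrow> real \<Rightarrow> real \<Rightarrow> (real \<Rightarrow> real \<Rightarrow> real) \<Rightarrow> (real \<Rightarrow> real) \<Rightarrow> real" where
  "energy T a b p \<alpha> f u =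
     1 / (b * p\<^sup>2) * (a + b * E_norm \<alpha> p T u powr p) powr p
     - (LINT t|lebesgue_on {0..T}. primitive f t (u t)) - a powr p / (b * p\<^sup>2)"

text \<open>\<open>u\<close> is a critical point of \<open>J\<close> on the space \<open>X\<close> with norm \<open>N\<close>: the Frechet derivative of
  \<open>J\<close> at \<open>u\<close> exists and is zero. Written out, as \<open>X\<close> is a set and not a type.\<close>

definition critical_point ::
  "(real \<Rightarrow> real) set \<Rightarrow> ((real \<Rightarrow> real) \<Rightarrow> real) \<Rightarrow> ((real \<Rightarrow> real) \<Rightarrow> real) \<Rightarrow> (real \<Rightarrow> real) \<Rightarrow> bool" where
  "critical_point X N J u \<longleftrightarrow> u \<in> X \<and>
     (\<forall>\<epsilon>>0. \<exists>\<delta>>0. \<forall>v\<in>X. N v < \<delta> \<longrightarrow> \<bar>J (\<lambda>t. u t + v t) - J u\<bar> \<le> \<epsilon> * N v)"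

text \<open>Weak solutions of
  \<open>(a + b \<integral> |D u|\<^sup>p)\<close> to the power \<open>p - 1\<close>, times \<open>D\<^sup>* (\<phi> (D u))\<close>, equals \<open>f (t, u t)\<close>, where
  \<open>D\<close> and \<open>D\<^sup>*\<close> are the left and right derivatives of order \<open>\<alpha>\<close> and
  \<open>\<phi> s = |s| powr (p - 2) * s\<close>, with \<open>u 0 = u T = 0\<close>.\<close>

definition weak_solution ::
  "real \<Rightarrow> real \<Rightarrow> real \<Rightarrow> real \<Rightarrow> real \<Rightarrow> (real \<Rightarrow> real \<Rightarrow> real) \<Rightarrow> (real \<Rightarrow> real) \<Rightarrow> bool" where
  "weak_solution T a b p \<alpha> f u \<longleftrightarrow>
     critical_point (E0 \<alpha> p T) (E_norm \<alpha> p T) (energy T a b p \<alpha> f) u"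

end

theory Submission
  imports Defs "HOL-Complex_Analysis.Great_Picard" "HOL-Library.Function_Algebras"
begin

text \<open>The energy is written as a functional \<open>J\<close> of the fractional derivative \<open>g\<close>, with
  \<open>u = I\<^sup>\<alpha> g\<close>, on the closure \<open>G\<close> in \<open>L\<^sup>p\<close> of the fractional derivatives of test
  functions. On bounded sets \<open>J\<close> is uniformly differentiable, which makes an elementary
  deformation argument possible. At the mountain pass level there are approximate critical points
  in a fixed ball: otherwise the vertices of a polygonal path near that level could be moved
  simultaneously along descent directions, and by uniform continuity of the derivative the segments
  between the moved vertices lie strictly lower. Near the boundary of the ball the
  Ambrosetti-Rabinowitz condition makes the outward radial direction a descent direction, so the
  paths can be prevented from moving inwards there.

  Such approximate critical points converge. The operator \<open>I\<^sup>\<alpha>\<close> maps \<open>L\<^sup>p\<close> boundedly into a space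
  of Hoelder functions, so by Arzela-Ascoli the nonlinear term converges uniformly along a
  subsequence. Hence the pairings of \<open>\<phi>\<^sub>p (g\<^sub>n) - \<phi>\<^sub>p (g\<^sub>m)\<close> with
  \<open>g\<^sub>n - g\<^sub>m\<close> tend to zero, and strict monotonicity of \<open>\<phi>\<^sub>p\<close> makes the sequence Cauchy
  in \<open>L\<^sup>p\<close>; no weak compactness is needed.\<close>

section \<open>Mountain passes of uniformly differentiable functionals\<close>

text \<open>\<open>G\<close> consists of functions and not of classes, so \<open>nrm\<close> is only
  a seminorm on a linear subspace of \<open>real \<Rightarrow> real\<close>; the abstract part is
  therefore stated for a seminorm on a subspace, and no quotient is formed. A path is a finite chain
  of segments: being joined below a level becomes a reflexive transitive closure, arguments along a
  path become inductions, and neither a path space nor a locally Lipschitz vector field has to be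
  constructed. The far end of a path is not a fixed point of low energy. It only has to reach the
  sphere of radius \<open>M\<close>, and outward motion keeps it admissible, so the deformation need
  not fix it. The threshold p^2 arises because the Kirchhoff term is of order
  \<open>nrm g powr p\<^sup>2\<close>: the bound along a ray compares this with growth of order
  \<mu>, and the descent near the boundary of the ball rests on \<mu> / p^2 > 1. The critical point
  is nontrivial because its energy is the minimax level, which is positive, while
  \<open>J 0 = 0\<close>.\<close>

definition uniformly_differentiable ::
  "'a::real_vector set \<Rightarrow> ('a \<Rightarrow> real) \<Rightarrow> ('a \<Rightarrow> real) \<Rightarrow> ('a \<Rightarrow> 'a \<Rightarrow> real) \<Rightarrow> bool" where
  "uniformly_differentiable X N J D \<longleftrightarrow>
     (\<forall>M. \<forall>\<epsilon>>0. \<exists>\<delta>>0. \<forall>x\<in>X. \<forall>v\<in>X. N x \<le> M \<longrightarrow> N v \<le> \<delta> \<longrightarrow>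
        \<bar>J (x + v) - J x - D x v\<bar> \<le> \<epsilon> * N v)"

text \<open>For a form linear in \<open>v\<close> this is boundedness of the derivative on bounded
  sets. It also makes \<open>D x\<close> vanish on vectors of seminorm 0, so these never act as
  descent directions.\<close>

definition locally_bounded_form ::
  "'a::real_vector set \<Rightarrow> ('a \<Rightarrow> real) \<Rightarrow> ('a \<Rightarrow> 'a \<Rightarrow> real) \<Rightarrow> bool" where
  "locally_bounded_form X N D \<longleftrightarrow>
     (\<forall>M. \<exists>L\<ge>0. \<forall>x\<in>X. \<forall>v\<in>X. N x \<le> M \<longrightarrow> \<bar>D x v\<bar> \<le> L * N v)"

section \<open>Seminormed subspaces and polygonal chains in sublevel sets\<close>

locale seminormed_subspace =
  fixes X :: "'a::real_vector set" and N :: "'a \<Rightarrow> real"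
  assumes subspace: "subspace X"
    and N_nonneg: "\<And>x. x \<in> X \<Longrightarrow> 0 \<le> N x"
    and N_add: "\<And>x y. x \<in> X \<Longrightarrow> y \<in> X \<Longrightarrow> N (x + y) \<le> N x + N y"
    and N_scale: "\<And>c x. x \<in> X \<Longrightarrow> N (c *\<^sub>R x) = \<bar>c\<bar> * N x"
begin

lemma X_closed [simp, intro]:
  "0 \<in> X" "x \<in> X \<Longrightarrow> y \<in> X \<Longrightarrow> x + y \<in> X" "x \<in> X \<Longrightarrow> y \<in> X \<Longrightarrow> x - y \<in> X"
  "x \<in> X \<Longrightarrow> c *\<^sub>R x \<in> X" "x \<in> X \<Longrightarrow> - x \<in> X"
  using subspace by (simp_all add: subspace_0 subspace_add subspace_diff subspace_scale subspace_neg)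

lemma N_zero [simp]: "N 0 = 0"
  using N_scale[of 0 0] by simp

lemma N_minus: "x \<in> X \<Longrightarrow> N (- x) = N x"
  using N_scale[of x "-1"] by simp

lemma N_diff_commute: "x \<in> X \<Longrightarrow> y \<in> X \<Longrightarrow> N (x - y) = N (y - x)"
  using N_minus[of "x - y"] by simp

lemma N_triangle_diff: "x \<in> X \<Longrightarrow> y \<in> X \<Longrightarrow> \<bar>N x - N y\<bar> \<le> N (x - y)"
  using N_add[of "x - y" y] N_add[of "y - x" x] N_diff_commute[of x y] by auto

lemma N_convex_le:
  assumes "x \<in> X" "y \<in> X" "s \<in> {0..1}" "N x \<le> r" "N y \<le> r"
  shows "N ((1 - s) *\<^sub>R x + s *\<^sub>R y) \<le> r"
proof -
  have "N ((1 - s) *\<^sub>R x + s *\<^sub>R y) \<le> (1 - s) * N x + s * N y"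
    using N_add[of "(1 - s) *\<^sub>R x" "s *\<^sub>R y"] assms by (simp add: N_scale)
  also have "\<dots> \<le> (1 - s) * r + s * r"
    using assms by (intro add_mono mult_left_mono) auto
  finally show ?thesis by (simp add: algebra_simps)
qed

lemma N_segment_dist:
  assumes "x \<in> X" "y \<in> X"
  shows "N (((1 - s) *\<^sub>R x + s *\<^sub>R y) - ((1 - t) *\<^sub>R x + t *\<^sub>R y)) = \<bar>s - t\<bar> * N (y - x)"
proof -
  have "((1 - s) *\<^sub>R x + s *\<^sub>R y) - ((1 - t) *\<^sub>R x + t *\<^sub>R y) = (s - t) *\<^sub>R (y - x)"
    by (simp add: algebra_simps)
  then show ?thesis using assms by (simp add: N_scale)
qed

lemma continuous_on_N_segment:
  assumes "x \<in> X" "y \<in> X"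
  shows "continuous_on UNIV (\<lambda>s. N ((1 - s) *\<^sub>R x + s *\<^sub>R y))"
proof -
  have "(N (y - x))-lipschitz_on UNIV (\<lambda>s. N ((1 - s) *\<^sub>R x + s *\<^sub>R y))"
  proof (rule lipschitz_onI)
    fix s t :: real
    show "dist (N ((1 - s) *\<^sub>R x + s *\<^sub>R y)) (N ((1 - t) *\<^sub>R x + t *\<^sub>R y)) \<le> N (y - x) * dist s t"
      using N_triangle_diff[of "(1 - s) *\<^sub>R x + s *\<^sub>R y" "(1 - t) *\<^sub>R x + t *\<^sub>R y"]
        N_segment_dist[OF assms, of s t] assms
      by (simp add: dist_real_def mult.commute)
  qed (use assms N_nonneg in auto)
  then show ?thesis by (rule lipschitz_on_continuous_on)
qed

text \<open>One edge of a polygonal path; the reflexive transitive closure of this relation plays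
  the role of a path in the sublevel set of level \<open>r\<close>.\<close>

definition sub_step :: "('a \<Rightarrow> real) \<Rightarrow> real \<Rightarrow> 'a \<Rightarrow> 'a \<Rightarrow> bool" where
  "sub_step J r x y \<longleftrightarrow> x \<in> X \<and> y \<in> X \<and> (\<forall>s\<in>{0..1}. J ((1 - s) *\<^sub>R x + s *\<^sub>R y) \<le> r)"

text \<open>Only the end points are bounded: by convexity of \<open>N\<close> the whole edge then
  stays in the ball.\<close>

definition sub_step_ball :: "('a \<Rightarrow> real) \<Rightarrow> real \<Rightarrow> real \<Rightarrow> 'a \<Rightarrow> 'a \<Rightarrow> bool" where
  "sub_step_ball J r M x y \<longleftrightarrow> sub_step J r x y \<and> N x \<le> M \<and> N y \<le> M"

lemma sub_step_subsegment:
  assumes "sub_step J r x y" "s \<in> {0..1}" "t \<in> {0..1}"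
  shows "sub_step J r ((1 - s) *\<^sub>R x + s *\<^sub>R y) ((1 - t) *\<^sub>R x + t *\<^sub>R y)"
  unfolding sub_step_def
proof (intro conjI ballI)
  show "(1 - s) *\<^sub>R x + s *\<^sub>R y \<in> X" "(1 - t) *\<^sub>R x + t *\<^sub>R y \<in> X"
    using assms by (auto simp: sub_step_def)
  fix u :: real assume u: "u \<in> {0..1}"
  let ?w = "(1 - u) * s + u * t"
  have "?w \<in> {0..1}" using convexD[OF convex_real_interval(5)[of 0 1], of s t "1 - u" u] assms u by simp
  moreover have "(1 - u) *\<^sub>R ((1 - s) *\<^sub>R x + s *\<^sub>R y) + u *\<^sub>R ((1 - t) *\<^sub>R x + t *\<^sub>R y)
      = (1 - ?w) *\<^sub>R x + ?w *\<^sub>R y"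
    by (simp add: algebra_simps)
  ultimately show "J ((1 - u) *\<^sub>R ((1 - s) *\<^sub>R x + s *\<^sub>R y) + u *\<^sub>R ((1 - t) *\<^sub>R x + t *\<^sub>R y)) \<le> r"
    using assms(1) by (simp add: sub_step_def)
qed

text \<open>The path is cut at its first exit from the ball. On the edge that leaves it, the
  intermediate value theorem for \<open>N\<close> gives a point exactly on the sphere; this exact
  radius is what later determines how far the end point is pushed.\<close>

lemma chain_truncate:
  assumes "(sub_step J r)\<^sup>*\<^sup>* 0 y" "N y \<ge> M" "M > 0"
  shows "\<exists>z\<in>X. (sub_step_ball J r M)\<^sup>*\<^sup>* 0 z \<and> N z = M"
proof -
  \<comment> \<open>Induction invariant: either the cut has been made, or the whole path so far lies
    in the ball. At the end \<open>N y \<ge> M\<close> turns the second case into the first with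
    \<open>N y = M\<close>.\<close>
  have "(\<exists>z\<in>X. (sub_step_ball J r M)\<^sup>*\<^sup>* 0 z \<and> N z = M) \<or>
        (y \<in> X \<and> (sub_step_ball J r M)\<^sup>*\<^sup>* 0 y \<and> N y \<le> M)"
    using assms(1)
  proof induction
    case base
    then show ?case using assms(3) by auto
  next
    case (step y z)
    from step.IH show ?case
    proof
      assume y: "y \<in> X \<and> (sub_step_ball J r M)\<^sup>*\<^sup>* 0 y \<and> N y \<le> M"
      have z: "z \<in> X" using step.hyps by (auto simp: sub_step_def)
      show ?thesis
      proof (cases "N z \<le> M")
        case True
        then have "sub_step_ball J r M y z" using y step.hyps by (auto simp: sub_step_ball_def)
        then show ?thesis using y z True by (meson rtranclp.rtrancl_into_rtrancl)
      next
        case False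
        have "\<exists>s\<ge>0. s \<le> 1 \<and> N ((1 - s) *\<^sub>R y + s *\<^sub>R z) = M"
          using y False
          by (intro IVT') (auto intro: continuous_on_subset[OF continuous_on_N_segment] z)
        then obtain s where s: "s \<in> {0..1}" "N ((1 - s) *\<^sub>R y + s *\<^sub>R z) = M" by auto
        have "sub_step J r ((1 - 0) *\<^sub>R y + 0 *\<^sub>R z) ((1 - s) *\<^sub>R y + s *\<^sub>R z)"
          using step.hyps s by (intro sub_step_subsegment) auto
        then have "sub_step_ball J r M y ((1 - s) *\<^sub>R y + s *\<^sub>R z)"
          using y s by (simp add: sub_step_ball_def)
        then have "(sub_step_ball J r M)\<^sup>*\<^sup>* 0 ((1 - s) *\<^sub>R y + s *\<^sub>R z)"
          using y by (meson rtranclp.rtrancl_into_rtrancl)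
        then show ?thesis using s y z by (intro disjI1 bexI[of _ "(1 - s) *\<^sub>R y + s *\<^sub>R z"]) auto
      qed
    qed auto
  qed
  then show ?thesis using assms(2) by force
qed

text \<open>The linking property of the mountain pass: a path from 0 that gets outside the sphere
  has a point on it, where \<open>J\<close> is at least \<beta>. As \<rho> > 0, the truncated path
  has a last edge, and its end point bounds the level.\<close>

lemma chain_crosses_sphere:
  assumes "(sub_step J r)\<^sup>*\<^sup>* 0 y" "N y \<ge> \<rho>" "\<rho> > 0" and low: "\<And>x. x \<in> X \<Longrightarrow> N x = \<rho> \<Longrightarrow> \<beta> \<le> J x"
  shows "\<beta> \<le> r"
proof -
  obtain z where z: "z \<in> X" "(sub_step_ball J r \<rho>)\<^sup>*\<^sup>* 0 z" "N z = \<rho>"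
    using chain_truncate[OF assms(1-3)] by auto
  from z(2) have "J z \<le> r"
  proof cases
    case rtrancl_refl
    then show ?thesis using z assms by auto
  next
    case (rtrancl_into_rtrancl w)
    then have "J ((1 - 1) *\<^sub>R w + 1 *\<^sub>R z) \<le> r"
      unfolding sub_step_ball_def sub_step_def by (metis atLeastAtMost_iff order_refl zero_le_one)
    then show ?thesis by simp
  qed
  then show ?thesis using low z by force
qed

end

section \<open>The deformation argument and the minimax level\<close>

locale differentiable_functional = seminormed_subspace +
  fixes J :: "'a \<Rightarrow> real" and D :: "'a \<Rightarrow> 'a \<Rightarrow> real"
  assumes D_add: "\<And>x v w. x \<in> X \<Longrightarrow> v \<in> X \<Longrightarrow> w \<in> X \<Longrightarrow> D x (v + w) = D x v + D x w"
    and D_scale: "\<And>x v c. x \<in> X \<Longrightarrow> v \<in> X \<Longrightarrow> D x (c *\<^sub>R v) = c * D x v"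
    and D_bounded: "locally_bounded_form X N D"
    and J_diff: "uniformly_differentiable X N J D"
begin

text \<open>The value at \<open>x + w\<close> is expanded both from \<open>x\<close> and from
  \<open>y\<close>, and \<open>J x\<close> is expanded from \<open>y\<close>. In the combination of
  the three expansions all values of \<open>J\<close> cancel, and \<open>D x w - D y w\<close>
  remains up to the remainders.\<close>

lemma D_uniformly_continuous:
  assumes "\<epsilon> > 0"
  obtains \<delta> where "\<delta> > 0"
    "\<And>x y v. x \<in> X \<Longrightarrow> y \<in> X \<Longrightarrow> v \<in> X \<Longrightarrow> N x \<le> M \<Longrightarrow> N y \<le> M \<Longrightarrow> N (x - y) \<le> \<delta>
       \<Longrightarrow> \<bar>D x v - D y v\<bar> \<le> \<epsilon> * N v"
proof -
  obtain d where d: "d > 0" and ud: "\<And>x v. x \<in> X \<Longrightarrow> v \<in> X \<Longrightarrow> N x \<le> M \<Longrightarrow> N v \<le> d \<Longrightarrow>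
      \<bar>J (x + v) - J x - D x v\<bar> \<le> \<epsilon> / 4 * N v"
    using J_diff assms unfolding uniformly_differentiable_def
    by (metis divide_pos_pos zero_less_numeral)
  obtain L where L: "\<And>x v. x \<in> X \<Longrightarrow> v \<in> X \<Longrightarrow> N x \<le> M \<Longrightarrow> \<bar>D x v\<bar> \<le> L * N v"
    using D_bounded unfolding locally_bounded_form_def by metis
  show ?thesis
  proof (rule that[of "d / 2"])
    show "d / 2 > 0" using d by simp
    fix x y v assume X: "x \<in> X" "y \<in> X" "v \<in> X" and M: "N x \<le> M" "N y \<le> M" and xy: "N (x - y) \<le> d / 2"
    show "\<bar>D x v - D y v\<bar> \<le> \<epsilon> * N v"
    proof (cases "N v = 0")
      case True
      then show ?thesis using L[of x v] L[of y v] X M by simp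
    next
      case False
      \<comment> \<open>By linearity \<open>v\<close> may be rescaled to length
        \<open>d / 2\<close>, so that the remainders, of order \<epsilon> times \<open>d\<close>,
        are comparable with \<epsilon> times \<open>N w\<close>.\<close>
      define c where "c = d / 2 / N v"
      have c: "c > 0" using False N_nonneg[OF X(3)] d by (simp add: c_def)
      define w where "w = c *\<^sub>R v"
      have w: "w \<in> X" "N w = d / 2"
        using X False c d N_nonneg[OF X(3)] by (simp_all add: w_def N_scale c_def)
      have 1: "\<bar>J (y + ((x - y) + w)) - J y - D y ((x - y) + w)\<bar> \<le> \<epsilon> / 4 * d"
      proof -
        have n: "N ((x - y) + w) \<le> d" using N_add[of "x - y" w] X w xy by simp
        have "\<bar>J (y + ((x - y) + w)) - J y - D y ((x - y) + w)\<bar> \<le> \<epsilon> / 4 * N ((x - y) + w)"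
          by (rule ud) (use X w M n in auto)
        also have "\<dots> \<le> \<epsilon> / 4 * d" using n assms by (intro mult_left_mono) auto
        finally show ?thesis .
      qed
      have 2: "\<bar>J (y + (x - y)) - J y - D y (x - y)\<bar> \<le> \<epsilon> / 4 * (d / 2)"
        by (rule order_trans[OF ud]) (use X M xy d assms in \<open>auto intro!: mult_left_mono\<close>)
      have 3: "\<bar>J (x + w) - J x - D x w\<bar> \<le> \<epsilon> / 4 * (d / 2)"
        by (rule order_trans[OF ud]) (use X M w d assms in \<open>auto intro!: mult_left_mono\<close>)
      have e: "y + ((x - y) + w) = x + w" "y + (x - y) = x" by simp_all
      \<comment> \<open>The three remainders add up exactly to \<open>\<epsilon> * N w\<close>,
        because \<open>N w = d / 2\<close>.\<close>
      have eN: "\<epsilon> * N w = \<epsilon> / 4 * d + (\<epsilon> / 4 * (d / 2) + \<epsilon> / 4 * (d / 2))" using w by simp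
      have "D y ((x - y) + w) = D y (x - y) + D y w" using X w by (intro D_add) auto
      then have "\<bar>D x w - D y w\<bar> \<le> \<epsilon> * N w" using 1 2 3 eN unfolding e by linarith
      moreover have "D x w - D y w = c * (D x v - D y v)" "N w = c * N v"
        using X c by (simp_all add: w_def D_scale N_scale right_diff_distrib)
      ultimately have "c * \<bar>D x v - D y v\<bar> \<le> c * (\<epsilon> * N v)"
        using c by (simp add: abs_mult)
      then show ?thesis using c by simp
    qed
  qed
qed

text \<open>The sphere of radius \<rho> bounds the level \<open>c\<close> from below by \<beta>, and
  the ray bounds it from above by \<open>C\<close>. The second bound makes \<open>out\<close>
  available: points at level at most \<open>c + k\<close> with k \<le> 1 satisfy
  \<open>J x \<le> C + 1\<close>.\<close>

lemma mountain_pass: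
  fixes M \<rho> \<beta> C :: real
  assumes \<rho>: "\<rho> > 0" "\<rho> \<le> M" and J0: "J 0 < \<beta>"
    and low: "\<And>x. x \<in> X \<Longrightarrow> N x = \<rho> \<Longrightarrow> \<beta> \<le> J x"
    and ray: "g \<in> X" "N g > 0" "\<And>s. s \<ge> 0 \<Longrightarrow> J (s *\<^sub>R g) \<le> C"
    and M: "M > 1" and out: "\<And>x. x \<in> X \<Longrightarrow> N x \<ge> M - 1 \<Longrightarrow> J x \<le> C + 1 \<Longrightarrow> D x x \<le> - N x"
  shows "\<exists>c\<ge>\<beta>. \<forall>\<kappa>>0. \<exists>x\<in>X. N x \<le> M \<and> \<bar>J x - c\<bar> \<le> \<kappa> \<and> (\<forall>v\<in>X. \<bar>D x v\<bar> \<le> \<kappa> * N v)"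
proof -
  \<comment> \<open>The end point is free beyond radius \<open>M\<close>, so pushing it outward
    keeps the path admissible.\<close>
  define S where "S = {r. \<exists>y\<in>X. N y \<ge> M \<and> (sub_step J r)\<^sup>*\<^sup>* 0 y}"
  define c where "c = Inf S"
  have low_S: "\<beta> \<le> r" if "r \<in> S" for r
    using that chain_crosses_sphere[of J r _ \<rho> \<beta>] low \<rho> unfolding S_def by force
  have bdd: "bdd_below S" using low_S by (meson bdd_belowI)
  have CS: "C \<in> S"
  proof -
    let ?y = "(M / N g) *\<^sub>R g"
    have "sub_step J C 0 ?y"
      unfolding sub_step_def using ray M by auto
    moreover have "N ?y = M" using ray M by (simp add: N_scale)
    ultimately show ?thesis using ray unfolding S_def by (auto intro!: bexI[of _ ?y])
  qed
  have cC: "c \<le> C" using CS bdd by (simp add: c_def cInf_lower)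
  have c\<beta>: "\<beta> \<le> c" using CS low_S unfolding c_def by (metis cInf_greatest empty_iff)
  have "\<forall>\<kappa>>0. \<exists>x\<in>X. N x \<le> M \<and> \<bar>J x - c\<bar> \<le> \<kappa> \<and> (\<forall>v\<in>X. \<bar>D x v\<bar> \<le> \<kappa> * N v)"
  proof (rule ccontr)
    assume "\<not> ?thesis"
    then obtain k0 where k0: "k0 > 0" and no0: "\<And>x. x \<in> X \<Longrightarrow> N x \<le> M \<Longrightarrow> \<bar>J x - c\<bar> \<le> k0 \<Longrightarrow>
       \<exists>v\<in>X. \<not> \<bar>D x v\<bar> \<le> k0 * N v" by blast
    \<comment> \<open>The bound 1 keeps \<open>c + k \<le> C + 1\<close>; the bound
      \<open>(\<beta> - J 0) / 2\<close> puts 0 strictly below level \<open>c - k\<close>, where the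
      deformation may leave points fixed.\<close>
    define k where "k = min (min k0 1) ((\<beta> - J 0) / 2)"
    have k: "k > 0" "k \<le> 1" "k \<le> k0" "J 0 < c - k"
      using k0 J0 c\<beta> by (auto simp: k_def min_def field_simps)
    obtain L where L0: "L \<ge> 0" and L: "\<And>x v. x \<in> X \<Longrightarrow> v \<in> X \<Longrightarrow> N x \<le> M + 2 \<Longrightarrow> \<bar>D x v\<bar> \<le> L * N v"
      using D_bounded unfolding locally_bounded_form_def by metis
    have descent: "\<exists>v\<in>X. N v = 1 \<and> D x v \<le> - k" if x: "x \<in> X" "N x \<le> M" "\<bar>J x - c\<bar> \<le> k" for x
    proof -
      obtain v where v: "v \<in> X" "\<bar>D x v\<bar> > k0 * N v" using no0[of x] x k by fastforce
      have Nv: "N v > 0"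
      proof (rule ccontr)
        assume "\<not> N v > 0"
        then have "N v = 0" using N_nonneg[OF v(1)] by simp
        then show False using L[of x v] x v by simp
      qed
      \<comment> \<open>Sign and length of \<open>v\<close> are normalised so that the derivative
        along the new vector is at most \<open>- k\<close>.\<close>
      define \<sigma> where "\<sigma> = - sgn (D x v) / N v"
      have "D x v \<noteq> 0" using v Nv k0 by (metis abs_zero less_asym mult_pos_pos)
      then have "\<bar>\<sigma>\<bar> = 1 / N v" using Nv by (simp add: \<sigma>_def abs_sgn_eq)
      then have "N (\<sigma> *\<^sub>R v) = 1" using N_scale[OF v(1), of \<sigma>] Nv by simp
      moreover have "D x (\<sigma> *\<^sub>R v) = - \<bar>D x v\<bar> / N v"
        using D_scale[OF x(1) v(1), of \<sigma>] by (simp add: \<sigma>_def abs_real_def sgn_real_def)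
      moreover have "- \<bar>D x v\<bar> / N v \<le> - k"
        using v Nv k by (simp add: field_simps) (smt (verit) mult_right_mono mult.commute)
      ultimately show ?thesis using v by (intro bexI[of _ "\<sigma> *\<^sub>R v"]) auto
    qed
    \<comment> \<open>The descent direction is chosen pointwise, without any continuity in \<open>x\<close>: only its values
      at the vertices of a chain are used, and \<open>\<Phi>\<close> is interpolated linearly between them.\<close>
    define W where "W x = (if N x \<ge> M - 1 then (1 / N x) *\<^sub>R x
        else if J x \<ge> c - k then (SOME v. v \<in> X \<and> N v = 1 \<and> D x v \<le> - k) else 0)" for x
    have W: "W x \<in> X" "N (W x) \<le> 1" "D x (W x) \<le> - k \<or> J x < c - k"
      if x: "x \<in> X" "N x \<le> M" "J x \<le> c + k" for x
    proof -
      have "W x \<in> X \<and> N (W x) \<le> 1 \<and> (D x (W x) \<le> - k \<or> J x < c - k)"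
      proof (cases "N x \<ge> M - 1")
        case True
        then have Nx: "N x > 0" using M by simp
        have "J x \<le> C + 1" using x cC k by simp
        then have "D x x \<le> - N x" using out True x by blast
        then have "1 / N x * D x x \<le> 1 / N x * (- N x)" using Nx by (intro mult_left_mono) auto
        then have "D x ((1 / N x) *\<^sub>R x) \<le> - 1" using x Nx D_scale[of x x "1 / N x"] by simp
        moreover have "N ((1 / N x) *\<^sub>R x) = 1" using x Nx by (simp add: N_scale)
        ultimately show ?thesis using True x k unfolding W_def by auto
      next
        case False
        show ?thesis
        proof (cases "J x \<ge> c - k")
          case True
          then have "\<exists>v. v \<in> X \<and> N v = 1 \<and> D x v \<le> - k" using descent[of x] x by (auto simp: abs_le_iff)
          from someI_ex[OF this] show ?thesis using False True by (simp add: W_def)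
        qed (use False in \<open>simp add: W_def\<close>)
      qed
      then show "W x \<in> X" "N (W x) \<le> 1" "D x (W x) \<le> - k \<or> J x < c - k" by auto
    qed
    obtain d1 where d1: "d1 > 0" and uc: "\<And>x y v. x \<in> X \<Longrightarrow> y \<in> X \<Longrightarrow> v \<in> X \<Longrightarrow> N x \<le> M + 2 \<Longrightarrow>
        N y \<le> M + 2 \<Longrightarrow> N (x - y) \<le> d1 \<Longrightarrow> \<bar>D x v - D y v\<bar> \<le> k / 8 * N v"
      using D_uniformly_continuous[of "k / 8" "M + 2"] k by (metis divide_pos_pos zero_less_numeral)
    obtain d2 where d2: "d2 > 0" and ud: "\<And>x v. x \<in> X \<Longrightarrow> v \<in> X \<Longrightarrow> N x \<le> M + 2 \<Longrightarrow> N v \<le> d2 \<Longrightarrow>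
        \<bar>J (x + v) - J x - D x v\<bar> \<le> k / 8 * N v"
      using J_diff k(1) unfolding uniformly_differentiable_def by (metis divide_pos_pos zero_less_numeral)
    \<comment> \<open>Displacements up to \<open>h\<close> are covered by the uniform continuity of
      \<open>D\<close> (\<open>d1\<close>), and those up to \<open>2 * h\<close> by the expansion of
      \<open>J\<close> (\<open>d2\<close>). Over the latter, \<open>J\<close> rises by at most
      \<open>k / 2\<close> because of the bound \<open>L\<close>.\<close>
    define h where "h = min (min 1 d1) (min (d2 / 2) (k / (4 * (L + 1))))"
    have h: "0 < h" "h \<le> 1" "h \<le> d1" "2 * h \<le> d2" and hk: "h \<le> k / (4 * (L + 1))"
      using d1 d2 k L0 by (auto simp: h_def)
    from hk have hL: "(L + 1) * (2 * h) \<le> k / 2" using L0 by (simp add: field_simps)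
    define \<Phi> where "\<Phi> x = x + h *\<^sub>R W x" for x
    \<comment> \<open>The starting level exceeds \<open>c\<close> by \<open>h * k / 4\<close>. A
      descent of \<open>h * k\<close>, less two errors of \<open>h * k / 8\<close>, therefore ends
      at \<open>c - h * k / 2\<close>.\<close>
    define r where "r = c + h * k / 4"
    have hk1: "h * k \<le> k" using h k by simp
    have rk: "r \<le> c + k" using hk1 k by (simp add: r_def)
    \<comment> \<open>At a vertex already below \<open>c - k\<close> the vector \<open>W\<close>
      need not be a descent direction. There every point within \<open>2 * h\<close> is low simply
      because \<open>J\<close> cannot rise by more than \<open>k / 2\<close>.\<close>
    have near: "J z \<le> c - h * k / 2"
      if x: "x \<in> X" "N x \<le> M" "J x < c - k" and z: "z \<in> X" "N (z - x) \<le> 2 * h" for x z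
    proof -
      have "\<bar>J (x + (z - x)) - J x - D x (z - x)\<bar> \<le> k / 8 * N (z - x)"
        by (rule ud) (use x z h in auto)
      then have "J z - J x - D x (z - x) \<le> k / 8 * N (z - x)"
        using abs_le_D1 by (metis add.commute diff_add_cancel)
      moreover have "D x (z - x) \<le> L * N (z - x)" using L[of x "z - x"] x z by auto
      ultimately have "J z \<le> J x + (L + k / 8) * N (z - x)" unfolding distrib_right by linarith
      also have "\<dots> \<le> J x + (L + 1) * (2 * h)"
        using z x k L0 N_nonneg[of "z - x"] by (intro add_left_mono mult_mono) auto
      also have "\<dots> \<le> c - k + k / 2" using hL x by simp
      finally show ?thesis using hk1 by simp
    qed
    \<comment> \<open>The directions at the two vertices are compared at a point \<open>w\<close>
      between them: uniform continuity of \<open>D\<close> makes each of them a descent direction at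
      \<open>w\<close>, and by linearity so is their convex combination \<open>V\<close>.\<close>
    have small: "sub_step J (c - h * k / 2) (\<Phi> x) (\<Phi> y)"
      if st: "sub_step_ball J r M x y" and xy: "N (y - x) \<le> h" for x y
    proof -
      have X: "x \<in> X" "y \<in> X" "N x \<le> M" "N y \<le> M"
        and seg: "\<And>s. s \<in> {0..1} \<Longrightarrow> J ((1 - s) *\<^sub>R x + s *\<^sub>R y) \<le> r"
        using st by (auto simp: sub_step_ball_def sub_step_def)
      have Jx: "J x \<le> c + k" using seg[of 0] rk by simp
      have Jy: "J y \<le> c + k" using seg[of 1] rk by simp
      note Wx = W[OF X(1,3) Jx] and Wy = W[OF X(2,4) Jy]
      show ?thesis unfolding sub_step_def
      proof (intro conjI ballI)
        show "\<Phi> x \<in> X" "\<Phi> y \<in> X" using X Wx Wy by (auto simp: \<Phi>_def)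
        fix s :: real assume s: "s \<in> {0..1}"
        define w where "w = (1 - s) *\<^sub>R x + s *\<^sub>R y"
        define V where "V = (1 - s) *\<^sub>R W x + s *\<^sub>R W y"
        \<comment> \<open>\<open>z\<close> interpolates between the moved vertices and is in general
          not \<open>\<Phi>\<close> of the interpolated point; it still equals \<open>w\<close>
          displaced by \<open>h\<close> times \<open>V\<close>.\<close>
        define z where "z = (1 - s) *\<^sub>R \<Phi> x + s *\<^sub>R \<Phi> y"
        have zw: "z = w + h *\<^sub>R V" by (simp add: z_def w_def V_def \<Phi>_def algebra_simps)
        have wX: "w \<in> X" and VX: "V \<in> X" using X Wx Wy by (auto simp: w_def V_def)
        have zX: "z \<in> X" using wX VX zw by auto
        have NV: "N V \<le> 1" unfolding V_def using Wx Wy s by (intro N_convex_le) auto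
        have Nw: "N w \<le> M" unfolding w_def using X s by (intro N_convex_le) auto
        have wx: "N (w - x) \<le> h" and wy: "N (w - y) \<le> h"
        proof -
          have "N (w - x) = s * N (y - x)" "N (w - y) = (1 - s) * N (y - x)"
            using N_segment_dist[OF X(1,2), of s 0] N_segment_dist[OF X(1,2), of s 1] s by (simp_all add: w_def)
          moreover have "s * N (y - x) \<le> 1 * N (y - x)" "(1 - s) * N (y - x) \<le> 1 * N (y - x)"
            using s N_nonneg[of "y - x"] X by (intro mult_right_mono; auto)+
          ultimately show "N (w - x) \<le> h" "N (w - y) \<le> h" using xy by simp_all
        qed
        have NhV: "N (h *\<^sub>R V) \<le> h" using NV VX h by (simp add: N_scale)
        have zx: "N (z - x) \<le> 2 * h" using N_add[of "w - x" "h *\<^sub>R V"] wx NhV wX VX X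
          by (simp add: zw algebra_simps)
        have zy: "N (z - y) \<le> 2 * h" using N_add[of "w - y" "h *\<^sub>R V"] wy NhV wX VX X
          by (simp add: zw algebra_simps)
        have "J z \<le> c - h * k / 2"
        proof (cases "J x < c - k \<or> J y < c - k")
          case True
          then show ?thesis using near X zX zx zy by blast
        next
          case False
          then have dx: "D x (W x) \<le> - k" and dy: "D y (W y) \<le> - k" using Wx Wy by auto
          have "\<bar>D w (W x) - D x (W x)\<bar> \<le> k / 8 * N (W x)"
            by (rule uc) (use wX X Wx Nw wx h in auto)
          also have "\<dots> \<le> k / 8" using Wx k by simp
          finally have "D w (W x) - D x (W x) \<le> k / 8" by (rule abs_le_D1)
          then have 1: "D w (W x) \<le> - k + k / 8" using dx by linarith
          have "\<bar>D w (W y) - D y (W y)\<bar> \<le> k / 8 * N (W y)"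
            by (rule uc) (use wX X Wy Nw wy h in auto)
          also have "\<dots> \<le> k / 8" using Wy k by simp
          finally have "D w (W y) - D y (W y) \<le> k / 8" by (rule abs_le_D1)
          then have 2: "D w (W y) \<le> - k + k / 8" using dy by linarith
          have "D w V = (1 - s) * D w (W x) + s * D w (W y)"
            unfolding V_def using wX Wx Wy by (simp add: D_add D_scale)
          also have "\<dots> \<le> (1 - s) * (- k + k / 8) + s * (- k + k / 8)"
            using 1 2 s by (intro add_mono mult_left_mono) auto
          also have "\<dots> = - k + k / 8" by (simp add: algebra_simps)
          finally have DV: "D w V \<le> - k + k / 8" .
          have "\<bar>J (w + h *\<^sub>R V) - J w - D w (h *\<^sub>R V)\<bar> \<le> k / 8 * N (h *\<^sub>R V)"
            by (rule ud) (use wX VX Nw NhV h in auto)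
          also have "\<dots> \<le> k / 8 * h" using NhV k by (intro mult_left_mono) auto
          finally have "J (w + h *\<^sub>R V) - J w - D w (h *\<^sub>R V) \<le> k / 8 * h" by (rule abs_le_D1)
          then have "J z \<le> J w + D w (h *\<^sub>R V) + k / 8 * h" unfolding zw by linarith
          also have "D w (h *\<^sub>R V) = h * D w V" using wX VX by (simp add: D_scale)
          also have "J w + h * D w V + k / 8 * h \<le> r + h * (- k + k / 8) + k / 8 * h"
            using seg[OF s] DV h by (intro add_right_mono add_mono[OF _ mult_left_mono]) (auto simp: w_def)
          also have "\<dots> = c - h * k / 2" by (simp add: r_def algebra_simps)
          finally show ?thesis .
        qed
        then show "J ((1 - s) *\<^sub>R \<Phi> x + s *\<^sub>R \<Phi> y) \<le> c - h * k / 2" by (simp add: z_def)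
      qed
    qed
    \<comment> \<open>A long edge is first divided into pieces of length at most \<open>h\<close>,
      and \<open>\<Phi>\<close> is applied to the new vertices as well.\<close>
    have step: "(sub_step J (c - h * k / 2))\<^sup>*\<^sup>* (\<Phi> x) (\<Phi> y)" if st: "sub_step_ball J r M x y" for x y
    proof -
      have X: "x \<in> X" "y \<in> X" "N x \<le> M" "N y \<le> M" "sub_step J r x y"
        using st by (auto simp: sub_step_ball_def sub_step_def)
      obtain n :: nat where n: "N (y - x) / h < real n" using reals_Archimedean2 by blast
      have n0: "n > 0" using n N_nonneg[of "y - x"] X h
        by (metis X_closed(3) divide_nonneg_pos gr0I not_less of_nat_0)
      define z where "z j = (1 - real j / real n) *\<^sub>R x + (real j / real n) *\<^sub>R y" for j
      have "(sub_step J (c - h * k / 2))\<^sup>*\<^sup>* (\<Phi> (z 0)) (\<Phi> (z j))" if "j \<le> n" for j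
        using that
      proof (induction j)
        case (Suc j)
        have j: "real j / real n \<in> {0..1}" "real (Suc j) / real n \<in> {0..1}" using Suc.prems by auto
        have "sub_step_ball J r M (z j) (z (Suc j))"
          unfolding sub_step_ball_def z_def
          using sub_step_subsegment[OF X(5) j] N_convex_le[OF X(1,2) _ X(3,4)] j by blast
        moreover have "N (z (Suc j) - z j) \<le> h"
        proof -
          have "N (z (Suc j) - z j) = \<bar>real (Suc j) / real n - real j / real n\<bar> * N (y - x)"
            unfolding z_def by (rule N_segment_dist) (use X in auto)
          also have "real (Suc j) / real n - real j / real n = 1 / real n" using n0 by (simp add: field_simps)
          finally have "N (z (Suc j) - z j) = N (y - x) / real n" by simp
          also have "\<dots> \<le> h" using n n0 h by (simp add: field_simps)
          finally show ?thesis .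
        qed
        ultimately have "sub_step J (c - h * k / 2) (\<Phi> (z j)) (\<Phi> (z (Suc j)))" by (rule small)
        then show ?case using Suc by (meson Suc_leD rtranclp.rtrancl_into_rtrancl)
      qed simp
      from this[of n] show ?thesis using n0 by (simp add: z_def)
    qed
    have "c < r" using h k by (simp add: r_def)
    then obtain r0 where r0: "r0 \<in> S" "r0 < r" using CS cInf_lessD[of S r] by (auto simp: c_def)
    then obtain y0 where y0: "N y0 \<ge> M" "(sub_step J r0)\<^sup>*\<^sup>* 0 y0" by (auto simp: S_def)
    have "sub_step J r0 \<le> sub_step J r" using r0 by (force simp: sub_step_def)
    then have "(sub_step J r)\<^sup>*\<^sup>* 0 y0" using y0 rtranclp_mono by (metis predicate2D)
    then obtain y where y: "y \<in> X" "(sub_step_ball J r M)\<^sup>*\<^sup>* 0 y" "N y = M"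
      using chain_truncate[of J r y0 M] y0 M by auto
    have "(sub_step J (c - h * k / 2))\<^sup>*\<^sup>* (\<Phi> 0) (\<Phi> y)"
      using y(2)
    proof induction
      case (step a b)
      then show ?case using \<open>\<And>x y. sub_step_ball J r M x y \<Longrightarrow> (sub_step J (c - h * k / 2))\<^sup>*\<^sup>* (\<Phi> x) (\<Phi> y)\<close>
        by (meson rtranclp_trans)
    qed simp
    \<comment> \<open>The origin stays in place because it lies inside radius \<open>M - 1\<close>
      and below level \<open>c - k\<close>.\<close>
    moreover have "\<Phi> 0 = 0" using M k by (simp add: \<Phi>_def W_def)
    \<comment> \<open>The end point lies on the sphere, where \<open>W\<close> is radial. It moves
      to radius \<open>M + h\<close>, so the lowered path still reaches radius
      \<open>M\<close>.\<close>
    moreover have "\<Phi> y = (1 + h / M) *\<^sub>R y" using y M by (simp add: \<Phi>_def W_def algebra_simps)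
    moreover have "N ((1 + h / M) *\<^sub>R y) = M + h" using y M h by (simp add: N_scale field_simps)
    ultimately have "c - h * k / 2 \<in> S" using y h unfolding S_def
      by (auto intro!: bexI[of _ "(1 + h / M) *\<^sub>R y"])
    then have "c \<le> c - h * k / 2" unfolding c_def using bdd by (meson cInf_lower)
    then show False using mult_pos_pos[OF h(1) k(1)] by simp
  qed
  then show ?thesis using c\<beta> by blast
qed

end

section \<open>The power function and its derivative\<close>

text \<open>The abstract argument lives in a type of class \<open>real_vector\<close>; functions
  receive the pointwise structure so that it applies to a set of functions.\<close>

instantiation "fun" :: (type, real_vector) real_vector
begin
definition scaleR_fun_def: "c *\<^sub>R f = (\<lambda>x. c *\<^sub>R f x)"
instance by standard (simp_all add: scaleR_fun_def fun_eq_iff scaleR_left_distrib scaleR_right_distrib)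
end

lemma mvt_segment:
  fixes f f' :: "real \<Rightarrow> real"
  assumes "\<And>z. z \<in> closed_segment x y \<Longrightarrow> (f has_real_derivative f' z) (at z)"
  shows "\<exists>z\<in>closed_segment x y. f y - f x = (y - x) * f' z"
proof -
  consider "x = y" | "x < y" | "y < x" by linarith
  then show ?thesis
  proof cases
    case 2
    then show ?thesis using MVT2[of x y f f'] assms by (force simp: closed_segment_eq_real_ivl)
  next
    case 3
    then obtain z where "y < z" "z < x" "f x - f y = (x - y) * f' z"
      using MVT2[of y x f f'] assms by (force simp: closed_segment_eq_real_ivl)
    then show ?thesis using 3
      by (intro bexI[of _ z]) (auto simp: closed_segment_eq_real_ivl algebra_simps)
  qed auto
qed

text \<open>This is \<phi>_p. The sign gives the right value at 0, and the exponent
  \<open>p - 1\<close> is positive, in contrast to \<open>p - 2\<close>.\<close>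

definition phi :: "real \<Rightarrow> real \<Rightarrow> real" where
  "phi p x = sgn x * \<bar>x\<bar> powr (p - 1)"

lemma phi_0 [simp]: "phi p 0 = 0"
  by (simp add: phi_def)

lemma abs_phi: "\<bar>phi p x\<bar> = \<bar>x\<bar> powr (p - 1)"
  by (simp add: phi_def abs_mult abs_sgn_eq)

lemma phi_mult_self: "phi p x * x = \<bar>x\<bar> powr p"
proof (cases "x = 0")
  case False
  have "phi p x * x = \<bar>x\<bar> powr (p - 1) * \<bar>x\<bar>" by (simp add: phi_def sgn_real_def)
  then show ?thesis using False powr_mult_base[of "\<bar>x\<bar>" "p - 1"] by (simp add: mult.commute)
qed simp

lemma phi_scale: "c \<ge> 0 \<Longrightarrow> phi p (c * x) = c powr (p - 1) * phi p x"
  by (cases "c = 0") (auto simp: phi_def sgn_mult abs_mult powr_mult)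

lemma continuous_on_phi:
  assumes "p > 1" shows "continuous_on A (phi p)"
proof -
  have "continuous_on ({..0} \<union> {0..}) (\<lambda>x::real. if x \<le> 0 then - ((- x) powr (p - 1)) else x powr (p - 1))"
    using assms by (intro continuous_on_cases continuous_on_powr' continuous_intros) auto
  moreover have "phi p = (\<lambda>x::real. if x \<le> 0 then - ((- x) powr (p - 1)) else x powr (p - 1))"
    by (auto simp: phi_def fun_eq_iff sgn_real_def)
  moreover have "{..0} \<union> {0..} = (UNIV :: real set)" by auto
  ultimately show ?thesis by (metis continuous_on_subset subset_UNIV)
qed

lemma borel_measurable_phi: "p > 1 \<Longrightarrow> phi p \<in> borel_measurable borel"
  using continuous_on_phi by (rule borel_measurable_continuous_onI)

text \<open>At 0 the difference quotient is \<open>phi p\<close> itself, so continuity of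
  \<open>phi\<close> yields the derivative there for every p > 1.\<close>

lemma abs_powr_has_derivative:
  assumes "p > 1" shows "((\<lambda>x. \<bar>x\<bar> powr p) has_real_derivative p * phi p x) (at x)"
proof (cases "x = 0")
  case True
  have "isCont (phi p) 0"
    using continuous_on_phi[OF assms, of UNIV] by (simp add: continuous_on_eq_continuous_at)
  then have "phi p \<midarrow>0\<rightarrow> 0" by (simp add: isCont_def)
  moreover have "(\<bar>h\<bar> powr p) / h = phi p h" if "h \<noteq> 0" for h
    using that phi_mult_self[of p h] by (simp add: field_simps)
  ultimately have "(\<lambda>h. (\<bar>h\<bar> powr p) / h) \<midarrow>0\<rightarrow> 0"
    by (subst LIM_equal[of 0 _ "phi p"]) auto
  then show ?thesis using True assms by (simp add: DERIV_def)
next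
  case False
  have "(abs has_real_derivative sgn x) (at x)"
  proof (cases "x > 0")
    case True
    then show ?thesis
      by (intro has_field_derivative_transform_within_open[of "\<lambda>x. x" _ x "{0<..}" abs]) auto
  next
    case neg: False
    have "((\<lambda>x. - x) has_real_derivative - 1) (at x)" by (auto intro!: derivative_eq_intros)
    then have "(abs has_real_derivative - 1) (at x)"
      by (rule has_field_derivative_transform_within_open[of _ _ x "{..<0}"]) (use neg False in auto)
    then show ?thesis using neg False by simp
  qed
  then have "((\<lambda>x. \<bar>x\<bar> powr p) has_real_derivative p * \<bar>x\<bar> powr (p - 1) * sgn x) (at x)"
    using DERIV_chain2[of "\<lambda>z. z powr p" "p * \<bar>x\<bar> powr (p - 1)" abs x "sgn x" UNIV]
      has_real_derivative_powr[of "\<bar>x\<bar>" p] False by simp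
  then show ?thesis by (simp add: phi_def mult_ac)
qed

lemma phi_strict_mono: 
  assumes "p > 1" "x < y" shows "phi p x < phi p y"
proof -
  consider "0 \<le> x" | "x < 0" "0 < y" | "x < 0" "y = 0" | "y < 0" by linarith
  then show ?thesis
  proof cases
    case 4
    then have "\<bar>y\<bar> powr (p - 1) < \<bar>x\<bar> powr (p - 1)" using assms by (intro powr_less_mono2) auto
    then show ?thesis using 4 assms by (simp add: phi_def)
  next
    case 1
    then have "\<bar>x\<bar> powr (p - 1) < \<bar>y\<bar> powr (p - 1)" using assms by (intro powr_less_mono2) auto
    then show ?thesis using 1 assms by (cases "x = 0") (simp_all add: phi_def)
  next
    case 2
    have "phi p x < 0" "phi p y > 0" using 2 by (auto simp: phi_def)
    then show ?thesis by linarith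
  qed (auto simp: phi_def)
qed

lemma phi_monotone:
  assumes "p > 1" shows "0 \<le> (phi p x - phi p y) * (x - y)" "x \<noteq> y \<Longrightarrow> 0 < (phi p x - phi p y) * (x - y)"
  using phi_strict_mono[OF assms, of x y] phi_strict_mono[OF assms, of y x]
  by (cases x y rule: linorder_cases; auto simp: mult_neg_neg less_imp_le)+

text \<open>By homogeneity both estimates reduce to compact sets, so the cases \<open>p \<le> 2\<close> and \<open>p \<ge> 2\<close>
  need not be separated.\<close>

lemma phi_modulus:
  assumes "p > 1" "\<epsilon> > 0"
  obtains C where "C \<ge> 0"
    "\<And>x y. \<bar>phi p x - phi p y\<bar> \<le> \<epsilon> * (\<bar>x\<bar> + \<bar>y\<bar>) powr (p - 1) + C * \<bar>x - y\<bar> powr (p - 1)"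
proof -
  have "uniformly_continuous_on {-1..1} (phi p)"
    using continuous_on_phi[OF assms(1)] by (intro compact_uniformly_continuous) auto
  then obtain d where d: "d > 0" and uc: "\<And>x y. x \<in> {-1..1} \<Longrightarrow> y \<in> {-1..1} \<Longrightarrow> \<bar>x - y\<bar> < d \<Longrightarrow>
      \<bar>phi p x - phi p y\<bar> < \<epsilon>"
    using assms(2) unfolding uniformly_continuous_on_def dist_real_def by metis
  \<comment> \<open>This constant covers pairs at distance at least \<open>d\<close>, as the left
    side never exceeds 2 on the unit square.\<close>
  define C where "C = 2 / d powr (p - 1)"
  have C: "C \<ge> 0" using d by (simp add: C_def)
  have unit: "\<bar>phi p x - phi p y\<bar> \<le> \<epsilon> + C * \<bar>x - y\<bar> powr (p - 1)" if "\<bar>x\<bar> \<le> 1" "\<bar>y\<bar> \<le> 1" for x y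
  proof (cases "\<bar>x - y\<bar> < d")
    case True
    then have "\<bar>phi p x - phi p y\<bar> < \<epsilon>" using uc[of x y] that by (simp add: abs_le_iff)
    moreover have "0 \<le> C * \<bar>x - y\<bar> powr (p - 1)" using C by simp
    ultimately show ?thesis by linarith
  next
    case False
    have "\<bar>x\<bar> powr (p - 1) \<le> 1 powr (p - 1)" "\<bar>y\<bar> powr (p - 1) \<le> 1 powr (p - 1)"
      using that assms by (intro powr_mono2; simp)+
    then have "\<bar>phi p x - phi p y\<bar> \<le> 2" using abs_phi[of p x] abs_phi[of p y] by simp
    also have "\<dots> = C * d powr (p - 1)" using d by (simp add: C_def)
    also have "\<dots> \<le> C * \<bar>x - y\<bar> powr (p - 1)"
      using C False d assms by (intro mult_left_mono powr_mono2) auto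
    finally show ?thesis using assms by simp
  qed
  show ?thesis
  proof (rule that[OF C])
    fix x y :: real
    define m where "m = \<bar>x\<bar> + \<bar>y\<bar>"
    show "\<bar>phi p x - phi p y\<bar> \<le> \<epsilon> * (\<bar>x\<bar> + \<bar>y\<bar>) powr (p - 1) + C * \<bar>x - y\<bar> powr (p - 1)"
    proof (cases "m = 0")
      case True
      then have "x = 0" "y = 0" by (auto simp: m_def)
      then show ?thesis by simp
    next
      case False
      then have m: "m > 0" by (simp add: m_def)
      have eq: "phi p x = m powr (p - 1) * phi p (x / m)" "phi p y = m powr (p - 1) * phi p (y / m)"
        using phi_scale[of m p "x / m"] phi_scale[of m p "y / m"] m by simp_all
      have xy: "\<bar>x - y\<bar> powr (p - 1) = m powr (p - 1) * \<bar>x / m - y / m\<bar> powr (p - 1)"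
        using m by (simp add: powr_mult[symmetric] diff_divide_distrib[symmetric])
      have "\<bar>phi p x - phi p y\<bar> = m powr (p - 1) * \<bar>phi p (x / m) - phi p (y / m)\<bar>"
        unfolding eq using m by (simp add: right_diff_distrib[symmetric] abs_mult)
      also have "\<dots> \<le> m powr (p - 1) * (\<epsilon> + C * \<bar>x / m - y / m\<bar> powr (p - 1))"
        using m by (intro mult_left_mono unit) (auto simp: m_def)
      finally show ?thesis unfolding xy by (simp add: m_def algebra_simps)
    qed
  qed
qed

text \<open>Normalised pairs with \<open>\<epsilon> \<le> \<bar>x - y\<bar> powr p\<close> form a
  compact set, on which the monotonicity pairing has a positive minimum \<open>m\<close>; the
  constant is \<open>1 / m\<close>. All other pairs are absorbed by the first term. The estimate
  turns small pairings into small distances.\<close>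

lemma phi_coercive:
  assumes "p > 1" "\<epsilon> > 0"
  obtains C where "C \<ge> 0"
    "\<And>x y. \<bar>x - y\<bar> powr p \<le> \<epsilon> * (\<bar>x\<bar> + \<bar>y\<bar>) powr p + C * ((phi p x - phi p y) * (x - y))"
proof -
  define S where "S = {z \<in> {-1..1} \<times> {-1..1 :: real}. \<bar>fst z\<bar> + \<bar>snd z\<bar> = 1 \<and> \<epsilon> \<le> \<bar>fst z - snd z\<bar> powr p}"
  have c: "continuous_on A (fst :: real \<times> real \<Rightarrow> real)" "continuous_on A (snd :: real \<times> real \<Rightarrow> real)" for A
    by (rule linear_continuous_on[OF bounded_linear_fst], rule linear_continuous_on[OF bounded_linear_snd])
  have "continuous_on UNIV (\<lambda>x::real. \<bar>x\<bar> powr p)"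
    using abs_powr_has_derivative[OF assms(1)] DERIV_isCont by (blast intro: continuous_at_imp_continuous_on)
  then have "continuous_on UNIV (\<lambda>z :: real \<times> real. \<bar>fst z - snd z\<bar> powr p)"
    by (rule continuous_on_compose2[OF _ continuous_on_diff[OF c] subset_UNIV])
  then have "closed {z :: real \<times> real. \<bar>fst z\<bar> + \<bar>snd z\<bar> = 1 \<and> \<epsilon> \<le> \<bar>fst z - snd z\<bar> powr p}"
    by (intro closed_Collect_conj closed_Collect_eq closed_Collect_le continuous_on_const
        continuous_on_add continuous_on_rabs c)
  moreover have "compact ({-1..1 :: real} \<times> {-1..1 :: real})" by (intro compact_Times) auto
  moreover have "S = ({-1..1} \<times> {-1..1}) \<inter>
      {z. \<bar>fst z\<bar> + \<bar>snd z\<bar> = 1 \<and> \<epsilon> \<le> \<bar>fst z - snd z\<bar> powr p}"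
    unfolding S_def by blast
  ultimately have "compact S" by (simp only: compact_Int_closed)
  have 1: "continuous_on S (\<lambda>z. phi p (fst z))"
    by (rule continuous_on_compose2[OF continuous_on_phi[OF assms(1), of UNIV] c(1) subset_UNIV])
  have 2: "continuous_on S (\<lambda>z. phi p (snd z))"
    by (rule continuous_on_compose2[OF continuous_on_phi[OF assms(1), of UNIV] c(2) subset_UNIV])
  have cont: "continuous_on S (\<lambda>z. (phi p (fst z) - phi p (snd z)) * (fst z - snd z))"
    by (rule continuous_on_mult[OF continuous_on_diff[OF 1 2] continuous_on_diff[OF c]])
  obtain m where m: "m > 0" "\<And>z. z \<in> S \<Longrightarrow> m \<le> (phi p (fst z) - phi p (snd z)) * (fst z - snd z)"
  proof (cases "S = {}")
    case True
    \<comment> \<open>For large \<epsilon> there are no such pairs, and any positive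
      \<open>m\<close> will do.\<close>
    then show ?thesis using that[of 1] by auto
  next
    case False
    then obtain w where w: "w \<in> S" and min: "\<And>z. z \<in> S \<Longrightarrow>
       (phi p (fst w) - phi p (snd w)) * (fst w - snd w) \<le> (phi p (fst z) - phi p (snd z)) * (fst z - snd z)"
      using continuous_attains_inf[OF \<open>compact S\<close> False cont] by blast
    have "fst w \<noteq> snd w" using w assms by (auto simp: S_def)
    then show ?thesis using that[OF phi_monotone(2)[OF assms(1)] min] by blast
  qed
  have unit: "\<bar>x - y\<bar> powr p \<le> \<epsilon> + (1 / m) * ((phi p x - phi p y) * (x - y))" if "\<bar>x\<bar> + \<bar>y\<bar> = 1" for x y
  proof (cases "\<epsilon> \<le> \<bar>x - y\<bar> powr p")
    case True
    moreover have "\<bar>x\<bar> \<le> 1" "\<bar>y\<bar> \<le> 1" using that by simp_all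
    ultimately have "(x, y) \<in> S" using that by (simp add: S_def abs_le_iff)
    then have "m \<le> (phi p x - phi p y) * (x - y)" using m(2) by fastforce
    then have "1 \<le> (1 / m) * ((phi p x - phi p y) * (x - y))" using m(1) by simp
    moreover have "\<bar>x - y\<bar> powr p \<le> 1 powr p" using that assms by (intro powr_mono2) auto
    ultimately show ?thesis using assms by simp
  next
    case False
    have "0 \<le> (1 / m) * ((phi p x - phi p y) * (x - y))" using m(1) phi_monotone(1)[OF assms(1)] by simp
    then show ?thesis using False by linarith
  qed
  show ?thesis
  proof (rule that)
    show "1 / m \<ge> 0" using m by simp
    fix x y :: real
    define k where "k = \<bar>x\<bar> + \<bar>y\<bar>"
    show "\<bar>x - y\<bar> powr p \<le> \<epsilon> * (\<bar>x\<bar> + \<bar>y\<bar>) powr p + (1 / m) * ((phi p x - phi p y) * (x - y))"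
    proof (cases "k = 0")
      case True
      then have "x = 0" "y = 0" by (auto simp: k_def)
      then show ?thesis by simp
    next
      case False
      then have k: "k > 0" by (simp add: k_def)
      have eq: "phi p x = k powr (p - 1) * phi p (x / k)" "phi p y = k powr (p - 1) * phi p (y / k)"
        using phi_scale[of k p "x / k"] phi_scale[of k p "y / k"] k by simp_all
      have kp: "k powr p = k powr (p - 1) * k" using k powr_mult_base[of k "p - 1"] by (simp add: mult.commute)
      have "\<bar>x / k\<bar> + \<bar>y / k\<bar> = 1" using k by (simp add: k_def add_divide_distrib[symmetric])
      note u = unit[OF this]
      have "\<bar>x - y\<bar> powr p = k powr p * \<bar>x / k - y / k\<bar> powr p"
        using k by (simp add: powr_mult[symmetric] diff_divide_distrib[symmetric])
      also have "\<dots> \<le> k powr p * (\<epsilon> + (1 / m) * ((phi p (x / k) - phi p (y / k)) * (x / k - y / k)))"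
        using k by (intro mult_left_mono u) auto
      also have "\<dots> = \<epsilon> * k powr p + (1 / m) * ((phi p x - phi p y) * (x - y))"
        unfolding eq kp right_diff_distrib[symmetric] diff_divide_distrib[symmetric]
        using k by (simp add: distrib_left mult_ac)
      finally show ?thesis by (simp add: k_def)
    qed
  qed
qed

text \<open>By the mean value theorem the remainder is \<open>p * h * (phi p z - phi p x)\<close>
  with \<open>z\<close> between \<open>x\<close> and \<open>x + h\<close>, to which
  \<open>phi_modulus\<close> applies. The first term carries the small factor \<epsilon>, and the
  second is of order p > 1 in \<open>h\<close>.\<close>

lemma abs_powr_taylor:
  assumes "p > 1" "\<epsilon> > 0"
  obtains C where "C \<ge> 0"
    "\<And>x h. \<bar>\<bar>x + h\<bar> powr p - \<bar>x\<bar> powr p - p * (phi p x * h)\<bar>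
       \<le> \<epsilon> * ((\<bar>x\<bar> + \<bar>h\<bar>) powr (p - 1) * \<bar>h\<bar>) + C * \<bar>h\<bar> powr p"
proof -
  \<comment> \<open>The denominator anticipates the factor \<open>p\<close> of the derivative and
    the factor \<open>2 powr (p - 1)\<close> that comes from \<open>\<bar>z\<bar> + \<bar>x\<bar>
    \<le> 2 * (\<bar>x\<bar> + \<bar>h\<bar>)\<close>.\<close>
  define e where "e = \<epsilon> / (p * 2 powr (p - 1))"
  have e: "e > 0" using assms by (simp add: e_def)
  obtain C where C: "C \<ge> 0" and mod: "\<And>x y. \<bar>phi p x - phi p y\<bar> \<le> e * (\<bar>x\<bar> + \<bar>y\<bar>) powr (p - 1) + C * \<bar>x - y\<bar> powr (p - 1)"
    using phi_modulus[OF assms(1) e] by blast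
  show ?thesis
  proof (rule that)
    show "p * C \<ge> 0" using C assms by simp
    fix x h :: real
    obtain z where z: "z \<in> closed_segment x (x + h)"
      and eq: "\<bar>x + h\<bar> powr p - \<bar>x\<bar> powr p = (x + h - x) * (p * phi p z)"
      using mvt_segment[of x "x + h" "\<lambda>x. \<bar>x\<bar> powr p" "\<lambda>z. p * phi p z"] abs_powr_has_derivative[OF assms(1)]
      by blast
    have zx: "\<bar>z - x\<bar> \<le> \<bar>h\<bar>" using z by (auto simp: closed_segment_eq_real_ivl split: if_splits)
    then have zm: "\<bar>z\<bar> + \<bar>x\<bar> \<le> 2 * (\<bar>x\<bar> + \<bar>h\<bar>)" using abs_triangle_ineq[of "z - x" x] by simp
    have two: "(2 * (\<bar>x\<bar> + \<bar>h\<bar>)) powr (p - 1) = 2 powr (p - 1) * (\<bar>x\<bar> + \<bar>h\<bar>) powr (p - 1)"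
      by (rule powr_mult)
    have "\<bar>phi p z - phi p x\<bar> \<le> e * (\<bar>z\<bar> + \<bar>x\<bar>) powr (p - 1) + C * \<bar>z - x\<bar> powr (p - 1)" by (rule mod)
    also have "\<dots> \<le> e * (2 * (\<bar>x\<bar> + \<bar>h\<bar>)) powr (p - 1) + C * \<bar>h\<bar> powr (p - 1)"
      using e C zx zm assms by (intro add_mono mult_left_mono powr_mono2) auto
    also have "\<dots> = (\<epsilon> / p) * (\<bar>x\<bar> + \<bar>h\<bar>) powr (p - 1) + C * \<bar>h\<bar> powr (p - 1)"
      unfolding two by (simp add: e_def)
    finally have b: "\<bar>phi p z - phi p x\<bar> \<le> (\<epsilon> / p) * (\<bar>x\<bar> + \<bar>h\<bar>) powr (p - 1) + C * \<bar>h\<bar> powr (p - 1)" .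
    have "\<bar>x + h\<bar> powr p - \<bar>x\<bar> powr p - p * (phi p x * h) = p * h * (phi p z - phi p x)"
      unfolding eq by (simp add: algebra_simps)
    then have "\<bar>\<bar>x + h\<bar> powr p - \<bar>x\<bar> powr p - p * (phi p x * h)\<bar> = p * \<bar>h\<bar> * \<bar>phi p z - phi p x\<bar>"
      using assms by (simp add: abs_mult)
    also have "\<dots> \<le> p * \<bar>h\<bar> * ((\<epsilon> / p) * (\<bar>x\<bar> + \<bar>h\<bar>) powr (p - 1) + C * \<bar>h\<bar> powr (p - 1))"
      using b assms by (intro mult_left_mono) auto
    also have "\<dots> = \<epsilon> * ((\<bar>x\<bar> + \<bar>h\<bar>) powr (p - 1) * \<bar>h\<bar>) + p * C * (\<bar>h\<bar> * \<bar>h\<bar> powr (p - 1))"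
      using assms by (simp add: algebra_simps)
    also have "\<bar>h\<bar> * \<bar>h\<bar> powr (p - 1) = \<bar>h\<bar> powr p" using powr_mult_base[of "\<bar>h\<bar>" "p - 1"] by simp
    finally show "\<bar>\<bar>x + h\<bar> powr p - \<bar>x\<bar> powr p - p * (phi p x * h)\<bar>
       \<le> \<epsilon> * ((\<bar>x\<bar> + \<bar>h\<bar>) powr (p - 1) * \<bar>h\<bar>) + p * C * \<bar>h\<bar> powr p" .
  qed
qed

section \<open>The space \<open>L\<^sup>p\<close> on an interval\<close>

lemma hoelder_inequality:
  fixes f g :: "'a \<Rightarrow> real"
  assumes pq: "p > 1" "q > 1" "1 / p + 1 / q = 1"
    and f: "f \<in> borel_measurable M" "integrable M (\<lambda>t. \<bar>f t\<bar> powr p)"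
    and g: "g \<in> borel_measurable M" "integrable M (\<lambda>t. \<bar>g t\<bar> powr q)"
  shows "integrable M (\<lambda>t. f t * g t)"
    and "(LINT t|M. \<bar>f t * g t\<bar>) \<le> (LINT t|M. \<bar>f t\<bar> powr p) powr (1 / p) * (LINT t|M. \<bar>g t\<bar> powr q) powr (1 / q)"
proof -
  note [measurable] = f(1) g(1)
  have young: "\<bar>f t * g t\<bar> \<le> \<bar>f t\<bar> powr p / p + \<bar>g t\<bar> powr q / q" for t
    using Youngs_inequality[OF pq, of "\<bar>f t\<bar>" "\<bar>g t\<bar>"] by (simp add: abs_mult)
  show int: "integrable M (\<lambda>t. f t * g t)"
    by (rule Bochner_Integration.integrable_bound[of M "\<lambda>t. \<bar>f t\<bar> powr p / p + \<bar>g t\<bar> powr q / q"])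
       (use f g young in \<open>auto intro!: order_trans[OF young]\<close>)
  define A where "A = (LINT t|M. \<bar>f t\<bar> powr p) powr (1 / p)"
  define B where "B = (LINT t|M. \<bar>g t\<bar> powr q) powr (1 / q)"
  have Ap: "A powr p = (LINT t|M. \<bar>f t\<bar> powr p)" and Bq: "B powr q = (LINT t|M. \<bar>g t\<bar> powr q)"
    using pq by (simp_all add: A_def B_def powr_powr)
  have AB: "A \<ge> 0" "B \<ge> 0" by (auto simp: A_def B_def)
  show "(LINT t|M. \<bar>f t * g t\<bar>) \<le> A * B"
  \<comment> \<open>When a norm vanishes, normalising by \<open>A * B\<close> is impossible, but
    then the product vanishes almost everywhere.\<close>
  proof (cases "A = 0 \<or> B = 0")
    case True
    then have "AE t in M. f t * g t = 0"
    proof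
      assume "A = 0"
      then have "(LINT t|M. \<bar>f t\<bar> powr p) = 0" using Ap by simp
      then have "AE t in M. \<bar>f t\<bar> powr p = 0" using f(2) by (subst (asm) integral_nonneg_eq_0_iff_AE) auto
      then show ?thesis by eventually_elim simp
    next
      assume "B = 0"
      then have "(LINT t|M. \<bar>g t\<bar> powr q) = 0" using Bq by simp
      then have "AE t in M. \<bar>g t\<bar> powr q = 0" using g(2) by (subst (asm) integral_nonneg_eq_0_iff_AE) auto
      then show ?thesis by eventually_elim simp
    qed
    then have "AE t in M. \<bar>f t * g t\<bar> = 0" by eventually_elim simp
    then have "(LINT t|M. \<bar>f t * g t\<bar>) = 0" by (rule integral_eq_zero_AE)
    then show ?thesis using AB by simp
  next
    case False
    then have pos: "A > 0" "B > 0" using AB by auto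
    have scaled: "\<bar>f t * g t\<bar> / (A * B) \<le> (1 / (p * A powr p)) * \<bar>f t\<bar> powr p + (1 / (q * B powr q)) * \<bar>g t\<bar> powr q" for t
    proof -
      have "\<bar>f t\<bar> / A * (\<bar>g t\<bar> / B) \<le> (\<bar>f t\<bar> / A) powr p / p + (\<bar>g t\<bar> / B) powr q / q"
        by (rule Youngs_inequality[OF pq]) (use pos in auto)
      also have "\<dots> = (1 / (p * A powr p)) * \<bar>f t\<bar> powr p + (1 / (q * B powr q)) * \<bar>g t\<bar> powr q"
        using pos by (simp add: powr_divide mult.commute)
      finally show ?thesis by (simp add: abs_mult)
    qed
    have "(LINT t|M. \<bar>f t * g t\<bar> / (A * B)) \<le>
        (LINT t|M. (1 / (p * A powr p)) * \<bar>f t\<bar> powr p + (1 / (q * B powr q)) * \<bar>g t\<bar> powr q)"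
      using int f g scaled
      by (intro integral_mono) (auto intro!: Bochner_Integration.integrable_add integrable_mult_right integrable_divide)
    also have "\<dots> = 1 / (p * A powr p) * A powr p + 1 / (q * B powr q) * B powr q"
      using f g by (simp add: Ap Bq)
    also have "\<dots> = 1" using pos pq by simp
    finally have "(LINT t|M. \<bar>f t * g t\<bar>) / (A * B) \<le> 1" by simp
    then show ?thesis using pos by (simp add: divide_le_eq)
  qed
qed

locale Lp_interval =
  fixes p T :: real
  assumes p: "p > 1" and T: "T > 0"
begin

abbreviation M where "M \<equiv> lebesgue_on {0..T}"
abbreviation nrm where "nrm \<equiv> Lp_norm p T"
abbreviation Lp where "Lp \<equiv> in_Lp p T"

sublocale finite_measure M
  by (rule finite_measure_lebesgue_on) (simp add: lmeasurable_interval)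

lemma measure_M: "measure M {0..T} = T"
  using T by (simp add: measure_restrict_space)

lemma borel_imp_M: "f \<in> borel_measurable borel \<Longrightarrow> f \<in> borel_measurable M"
  by (rule measurable_restrict_space1, rule measurable_completion) simp

lemma ident_measurable [measurable]: "(\<lambda>t. t) \<in> borel_measurable M"
  by (rule borel_imp_M) simp

lemma phi_measurable: "g \<in> borel_measurable M \<Longrightarrow> (\<lambda>t. phi p (g t)) \<in> borel_measurable M"
  using measurable_compose[OF _ borel_measurable_phi[OF p]] .

lemma Lp_D [dest]:
  assumes "Lp g"
  shows "g \<in> borel_measurable M" "integrable M (\<lambda>t. \<bar>g t\<bar> powr p)"
  using assms by (auto simp: in_Lp_def)

lemma nrm_nonneg [simp]: "0 \<le> nrm g"
  by (simp add: Lp_norm_def)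

lemma nrm_powr: "nrm g powr p = (LINT t|M. \<bar>g t\<bar> powr p)"
  using p by (simp add: Lp_norm_def powr_powr)

lemma nrm_le_iff: "c \<ge> 0 \<Longrightarrow> nrm g \<le> c \<longleftrightarrow> (LINT t|M. \<bar>g t\<bar> powr p) \<le> c powr p"
  using p by (metis nrm_powr nrm_nonneg powr_mono2 powr_less_mono2 not_less less_le_trans zero_less_one less_imp_le order_trans)

lemma Lp_cong_AE:
  assumes "Lp f" "g \<in> borel_measurable M" "AE t in M. f t = g t"
  shows "Lp g" "nrm g = nrm f"
proof -
  have *: "AE t in M. \<bar>g t\<bar> powr p = \<bar>f t\<bar> powr p" using assms(3) by eventually_elim simp
  note [measurable] = Lp_D(1)[OF assms(1)] assms(2)
  have "integrable M (\<lambda>t. \<bar>g t\<bar> powr p) \<longleftrightarrow> integrable M (\<lambda>t. \<bar>f t\<bar> powr p)"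
    using * by (intro integrable_cong_AE) auto
  then show "Lp g" using assms by (auto simp: in_Lp_def)
  show "nrm g = nrm f" unfolding Lp_norm_def
    by (rule arg_cong[where f="\<lambda>x. x powr (1 / p)"], rule integral_cong_AE) (use * in auto)
qed

lemma Lp_cong: "(\<And>t. t \<in> {0..T} \<Longrightarrow> f t = g t) \<Longrightarrow> Lp f \<longleftrightarrow> Lp g"
  unfolding in_Lp_def
  by (intro conj_cong measurable_cong Bochner_Integration.integrable_cong) auto

lemma Lp_scale: "Lp f \<Longrightarrow> Lp (\<lambda>t. c * f t)"
  unfolding in_Lp_def by (auto simp: abs_mult powr_mult)

lemma nrm_scale: "nrm (\<lambda>t. c * f t) = \<bar>c\<bar> * nrm f"
proof -
  have "nrm (\<lambda>t. c * f t) = (\<bar>c\<bar> powr p * (LINT t|M. \<bar>f t\<bar> powr p)) powr (1 / p)"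
    unfolding Lp_norm_def by (simp add: abs_mult powr_mult)
  also have "\<dots> = \<bar>c\<bar> * nrm f"
    using p by (simp add: powr_mult powr_powr Lp_norm_def)
  finally show ?thesis .
qed

lemma Lp_abs: "Lp f \<Longrightarrow> Lp (\<lambda>t. \<bar>f t\<bar>)" and nrm_abs: "nrm (\<lambda>t. \<bar>f t\<bar>) = nrm f"
  unfolding in_Lp_def Lp_norm_def by auto

lemma Lp_add:
  assumes "Lp f" "Lp g" shows "Lp (\<lambda>t. f t + g t)"
proof -
  note [measurable] = Lp_D(1)[OF assms(1)] Lp_D(1)[OF assms(2)]
  have b: "\<bar>f t + g t\<bar> powr p \<le> 2 powr p * (\<bar>f t\<bar> powr p + \<bar>g t\<bar> powr p)" for t
  proof -
    have "\<bar>f t + g t\<bar> powr p \<le> (2 * max \<bar>f t\<bar> \<bar>g t\<bar>) powr p"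
      using p by (intro powr_mono2) auto
    also have "\<dots> = 2 powr p * max \<bar>f t\<bar> \<bar>g t\<bar> powr p" by (rule powr_mult)
    also have "max \<bar>f t\<bar> \<bar>g t\<bar> powr p \<le> \<bar>f t\<bar> powr p + \<bar>g t\<bar> powr p" by (simp add: max_def)
    finally show ?thesis by simp
  qed
  have "integrable M (\<lambda>t. 2 powr p * (\<bar>f t\<bar> powr p + \<bar>g t\<bar> powr p))"
    using assms by (intro integrable_mult_right Bochner_Integration.integrable_add) auto
  then have "integrable M (\<lambda>t. \<bar>f t + g t\<bar> powr p)"
    by (rule Bochner_Integration.integrable_bound) (use b in \<open>auto intro!: order_trans[OF b]\<close>)
  then show ?thesis by (simp add: in_Lp_def)
qed

lemma Lp_diff: "Lp f \<Longrightarrow> Lp g \<Longrightarrow> Lp (\<lambda>t. f t - g t)"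
  using Lp_add[of f "\<lambda>t. (-1) * g t"] Lp_scale[of g "-1"] by simp

lemma Lp_bounded:
  assumes [measurable]: "g \<in> borel_measurable M" and b: "\<And>t. t \<in> {0..T} \<Longrightarrow> \<bar>g t\<bar> \<le> B"
  shows "Lp g" "nrm g \<le> T powr (1 / p) * B"
proof -
  have B: "B \<ge> 0" using b[of 0] T by (auto intro: order_trans[OF abs_ge_zero])
  have bp: "\<bar>g t\<bar> powr p \<le> B powr p" if "t \<in> {0..T}" for t
    using b[OF that] p by (intro powr_mono2) auto
  have int: "integrable M (\<lambda>t. \<bar>g t\<bar> powr p)"
    by (rule integrable_const_bound[of _ "B powr p"]) (use bp in auto)
  then show "Lp g" by (simp add: in_Lp_def)
  have "(LINT t|M. \<bar>g t\<bar> powr p) \<le> (LINT t|M. B powr p)"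
    using int bp by (intro integral_mono) auto
  also have "\<dots> = (T powr (1 / p) * B) powr p"
    using T p B by (simp add: measure_M powr_mult powr_powr)
  finally show "nrm g \<le> T powr (1 / p) * B" using B by (subst nrm_le_iff) auto
qed

text \<open>Hoelder's inequality with exponents \<open>p / (p - 1)\<close> and \<open>p\<close>, in
  the form that serves the pairings with \<open>phi\<close>, Minkowski's inequality and, with
  \<open>A = 1\<close>, the embedding into the integrable functions.\<close>

lemma holder_phi:
  assumes "Lp A" "Lp h"
  shows "integrable M (\<lambda>t. \<bar>A t\<bar> powr (p - 1) * \<bar>h t\<bar>)"
    and "(LINT t|M. \<bar>A t\<bar> powr (p - 1) * \<bar>h t\<bar>) \<le> nrm A powr (p - 1) * nrm h"
proof -
  define q where "q = p / (p - 1)"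
  have q: "q > 1" "1 / q + 1 / p = 1" using p by (simp_all add: q_def field_simps)
  note [measurable] = Lp_D(1)[OF assms(1)] Lp_D(1)[OF assms(2)]
  have e: "\<bar>\<bar>x\<bar> powr (p - 1)\<bar> powr q = \<bar>x\<bar> powr p" for x :: real
    using p by (simp add: powr_powr q_def)
  have f: "integrable M (\<lambda>t. \<bar>\<bar>A t\<bar> powr (p - 1)\<bar> powr q)"
    unfolding e using assms by auto
  have h: "integrable M (\<lambda>t. \<bar>\<bar>h t\<bar>\<bar> powr p)" using assms by auto
  show "integrable M (\<lambda>t. \<bar>A t\<bar> powr (p - 1) * \<bar>h t\<bar>)"
    by (rule hoelder_inequality(1)[OF q(1) p q(2) _ f _ h]) auto
  have "(LINT t|M. \<bar>\<bar>A t\<bar> powr (p - 1) * \<bar>h t\<bar>\<bar>) \<le>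
      (LINT t|M. \<bar>\<bar>A t\<bar> powr (p - 1)\<bar> powr q) powr (1 / q) * (LINT t|M. \<bar>\<bar>h t\<bar>\<bar> powr p) powr (1 / p)"
    by (rule hoelder_inequality(2)[OF q(1) p q(2) _ f _ h]) auto
  also have "(LINT t|M. \<bar>\<bar>A t\<bar> powr (p - 1)\<bar> powr q) powr (1 / q) = nrm A powr (p - 1)"
    unfolding e nrm_powr[symmetric] using p by (simp add: powr_powr q_def)
  finally show "(LINT t|M. \<bar>A t\<bar> powr (p - 1) * \<bar>h t\<bar>) \<le> nrm A powr (p - 1) * nrm h"
    by (simp add: abs_mult Lp_norm_def)
qed

text \<open>The power \<open>p - 1\<close> of the sum is paired with each summand by
  \<open>holder_phi\<close>, and the common factor \<open>s powr (p - 1)\<close> is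
  cancelled.\<close>

lemma minkowski:
  assumes f: "Lp f" and g: "Lp g"
  shows "nrm (\<lambda>t. f t + g t) \<le> nrm f + nrm g"
proof (cases "nrm (\<lambda>t. f t + g t) = 0")
  case False
  define s where "s = nrm (\<lambda>t. f t + g t)"
  have s: "s > 0" using False nrm_nonneg[of "\<lambda>t. f t + g t"] unfolding s_def by linarith
  note fg = Lp_add[OF f g]
  have split: "\<bar>f t + g t\<bar> powr p \<le> \<bar>f t + g t\<bar> powr (p - 1) * \<bar>f t\<bar> + \<bar>f t + g t\<bar> powr (p - 1) * \<bar>g t\<bar>" for t
  proof -
    have "\<bar>f t + g t\<bar> powr p = \<bar>f t + g t\<bar> powr (p - 1) * \<bar>f t + g t\<bar>"
      using powr_mult_base[of "\<bar>f t + g t\<bar>" "p - 1"] by (simp add: mult.commute)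
    also have "\<dots> \<le> \<bar>f t + g t\<bar> powr (p - 1) * (\<bar>f t\<bar> + \<bar>g t\<bar>)" by (intro mult_left_mono) auto
    finally show ?thesis by (simp add: distrib_left)
  qed
  have "s powr p \<le> (LINT t|M. \<bar>f t + g t\<bar> powr (p - 1) * \<bar>f t\<bar> + \<bar>f t + g t\<bar> powr (p - 1) * \<bar>g t\<bar>)"
    unfolding s_def nrm_powr
    using fg holder_phi(1)[OF fg f] holder_phi(1)[OF fg g] split
    by (intro integral_mono Bochner_Integration.integrable_add) auto
  also have "\<dots> \<le> s powr (p - 1) * nrm f + s powr (p - 1) * nrm g"
    using holder_phi[OF fg f] holder_phi[OF fg g] by (simp add: s_def)
  finally have "s powr (p - 1) * s \<le> s powr (p - 1) * (nrm f + nrm g)"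
    using powr_mult_base[of s "p - 1"] s by (simp add: distrib_left mult.commute)
  then show ?thesis using s by (simp add: s_def)
next
  case True
  then show ?thesis by (simp add: add_nonneg_nonneg)
qed

lemma nrm_triangle: "Lp f \<Longrightarrow> Lp g \<Longrightarrow> Lp h \<Longrightarrow> nrm (\<lambda>t. f t - h t) \<le> nrm (\<lambda>t. f t - g t) + nrm (\<lambda>t. g t - h t)"
  using minkowski[of "\<lambda>t. f t - g t" "\<lambda>t. g t - h t"] by (simp add: Lp_diff)

lemma nrm_minus_commute: "nrm (\<lambda>t. f t - g t) = nrm (\<lambda>t. g t - f t)"
  by (simp add: Lp_norm_def abs_minus_commute)

lemma nrm_eq_0_AE: "Lp g \<Longrightarrow> nrm g = 0 \<Longrightarrow> AE t in M. g t = 0"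
proof -
  assume g: "Lp g" "nrm g = 0"
  then have "(LINT t|M. \<bar>g t\<bar> powr p) = 0" using nrm_powr[of g] by simp
  then have "AE t in M. \<bar>g t\<bar> powr p = 0" using Lp_D(2)[OF g(1)]
    by (subst (asm) integral_nonneg_eq_0_iff_AE) auto
  then show ?thesis by eventually_elim simp
qed

lemma Lp_integrable:
  assumes "Lp h" shows "integrable M h" and "(LINT t|M. \<bar>h t\<bar>) \<le> T powr ((p - 1) / p) * nrm h"
proof -
  have 1: "Lp (\<lambda>t. 1)" by (rule Lp_bounded(1)[of _ 1]) auto
  note [measurable] = Lp_D(1)[OF assms]
  have "integrable M (\<lambda>t. \<bar>h t\<bar>)" using holder_phi(1)[OF 1 assms] by simp
  then show "integrable M h" by (simp add: integrable_abs_iff)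
  have "nrm (\<lambda>t. 1) powr (p - 1) = T powr ((p - 1) / p)"
    using T by (simp add: Lp_norm_def measure_M powr_powr)
  then show "(LINT t|M. \<bar>h t\<bar>) \<le> T powr ((p - 1) / p) * nrm h"
    using holder_phi(2)[OF 1 assms] by simp
qed

text \<open>Riesz-Fischer. On a finite interval the sequence is also Cauchy in L^1, which yields a
  subsequence converging almost everywhere; Fatou's lemma along that subsequence recovers
  convergence in \<open>nrm\<close>.\<close>

lemma Lp_complete:
  assumes s: "\<And>n. Lp (s n)"
    and cauchy: "\<And>e. e > 0 \<Longrightarrow> \<exists>N. \<forall>m\<ge>N. \<forall>n\<ge>N. nrm (\<lambda>t. s m t - s n t) < e"
  obtains g where "Lp g" "(\<lambda>n. nrm (\<lambda>t. s n t - g t)) \<longlonglongrightarrow> 0"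
proof -
  have [measurable]: "s n \<in> borel_measurable M" for n using s by auto
  have d: "Lp (\<lambda>t. s m t - s n t)" for m n using s by (intro Lp_diff)
  define K where "K = T powr ((p - 1) / p)"
  have K: "K > 0" using T by (simp add: K_def)
  have "\<exists>N. \<forall>i\<ge>N. \<forall>j\<ge>N. (LINT x|M. norm (s i x - s j x)) < e" if e: "e > 0" for e
  proof -
    obtain N where N: "\<forall>m\<ge>N. \<forall>n\<ge>N. nrm (\<lambda>t. s m t - s n t) < e / K"
      using cauchy[of "e / K"] e K by auto
    show ?thesis
    proof (intro exI[of _ N] allI impI)
      fix i j assume "N \<le> i" "N \<le> j"
      then have "K * nrm (\<lambda>t. s i t - s j t) < e" using N K by (simp add: pos_less_divide_eq mult.commute)
      then show "(LINT x|M. norm (s i x - s j x)) < e"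
        using Lp_integrable(2)[OF d, of i j] by (simp add: K_def)
    qed
  qed
  then obtain r where r: "strict_mono r" and ae: "AE x in M. Cauchy (\<lambda>i. s (r i) x)"
    using cauchy_L1_AE_cauchy_subseq[of M s] Lp_integrable(1)[OF s] by blast
  define g where "g x = lim (\<lambda>i. s (r i) x)" for x
  have [measurable]: "g \<in> borel_measurable M" unfolding g_def by measurable
  have lim: "AE x in M. (\<lambda>i. s (r i) x) \<longlonglongrightarrow> g x"
    using ae by eventually_elim (simp add: g_def convergent_LIMSEQ_iff[symmetric] Cauchy_convergent)
  \<comment> \<open>The index \<open>n\<close> stays fixed while the subsequence runs, so the Cauchy
    bound passes to the limit.\<close>
  have fatou: "(\<integral>\<^sup>+t. ennreal (\<bar>s n t - g t\<bar> powr p) \<partial>M) \<le> ennreal (e powr p)"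
    if N: "\<forall>m\<ge>N. \<forall>n\<ge>N. nrm (\<lambda>t. s m t - s n t) < e" and n: "n \<ge> N" for n N e
  proof -
    have e: "e > 0" using N nrm_nonneg[of "\<lambda>t. s N t - s N t"] by (meson le_less_trans order_refl)
    have "(\<integral>\<^sup>+t. ennreal (\<bar>s n t - g t\<bar> powr p) \<partial>M) =
        (\<integral>\<^sup>+t. liminf (\<lambda>i. ennreal (\<bar>s n t - s (r i) t\<bar> powr p)) \<partial>M)"
    proof (rule nn_integral_cong_AE)
      show "AE t in M. ennreal (\<bar>s n t - g t\<bar> powr p) = liminf (\<lambda>i. ennreal (\<bar>s n t - s (r i) t\<bar> powr p))"
        using lim
      proof eventually_elim
        case (elim t)
        then have "(\<lambda>i. \<bar>s n t - s (r i) t\<bar> powr p) \<longlonglongrightarrow> \<bar>s n t - g t\<bar> powr p"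
          using p by (intro tendsto_powr' tendsto_intros) auto
        then have "(\<lambda>i. ennreal (\<bar>s n t - s (r i) t\<bar> powr p)) \<longlonglongrightarrow> ennreal (\<bar>s n t - g t\<bar> powr p)"
          by (rule tendsto_ennrealI)
        then show ?case by (simp only: lim_imp_Liminf[OF trivial_limit_sequentially])
      qed
    qed
    also have "\<dots> \<le> liminf (\<lambda>i. \<integral>\<^sup>+t. ennreal (\<bar>s n t - s (r i) t\<bar> powr p) \<partial>M)"
      by (rule nn_integral_liminf) measurable
    also have "\<dots> \<le> ennreal (e powr p)"
    proof (rule Liminf_le)
      show "\<forall>\<^sub>F i in sequentially. (\<integral>\<^sup>+t. ennreal (\<bar>s n t - s (r i) t\<bar> powr p) \<partial>M) \<le> ennreal (e powr p)"
        using eventually_ge_at_top[of N]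
      proof eventually_elim
        case (elim i)
        then have "r i \<ge> N" using r seq_suble[OF r, of i] by linarith
        then have "nrm (\<lambda>t. s n t - s (r i) t) < e" using N n by blast
        then have "(LINT t|M. \<bar>s n t - s (r i) t\<bar> powr p) \<le> e powr p"
          using e by (subst nrm_le_iff[symmetric]) auto
        then show ?case using Lp_D(2)[OF d, of n "r i"] by (subst nn_integral_eq_integral) (auto intro: ennreal_leI)
      qed
    qed simp
    finally show ?thesis .
  qed
  have diff: "Lp (\<lambda>t. s n t - g t) \<and> nrm (\<lambda>t. s n t - g t) \<le> e"
    if N: "\<forall>m\<ge>N. \<forall>n\<ge>N. nrm (\<lambda>t. s m t - s n t) < e" and n: "n \<ge> N" for n N e
  proof -
    have e: "e > 0" using N nrm_nonneg[of "\<lambda>t. s N t - s N t"] by (meson le_less_trans order_refl)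
    note f = fatou[OF N n]
    have int: "integrable M (\<lambda>t. \<bar>s n t - g t\<bar> powr p)"
      using f by (intro integrableI_bounded) (auto simp: less_top[symmetric] top_unique)
    have "ennreal (LINT t|M. \<bar>s n t - g t\<bar> powr p) \<le> ennreal (e powr p)"
      using f int by (subst nn_integral_eq_integral[symmetric]) auto
    then have "(LINT t|M. \<bar>s n t - g t\<bar> powr p) \<le> e powr p" by (simp add: ennreal_le_iff)
    then show ?thesis using int e by (simp add: in_Lp_def nrm_le_iff)
  qed
  obtain N1 where N1: "\<forall>m\<ge>N1. \<forall>n\<ge>N1. nrm (\<lambda>t. s m t - s n t) < 1" using cauchy[of 1] by auto
  \<comment> \<open>Membership of \<open>g\<close> itself: it is the difference of one term of the
    sequence and an error already known to lie in the space.\<close>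
  have "Lp (\<lambda>t. s N1 t - (s N1 t - g t))" 
    by (rule Lp_diff[OF s]) (use diff[OF N1, of N1] in auto)
  then have g: "Lp g" by simp
  have "(\<lambda>n. nrm (\<lambda>t. s n t - g t)) \<longlonglongrightarrow> 0"
  proof (rule LIMSEQ_I)
    fix e :: real assume "e > 0"
    then obtain N where N: "\<forall>m\<ge>N. \<forall>n\<ge>N. nrm (\<lambda>t. s m t - s n t) < e / 2" using cauchy[of "e / 2"] by auto
    show "\<exists>no. \<forall>n\<ge>no. norm (nrm (\<lambda>t. s n t - g t) - 0) < e"
      using diff[OF N] \<open>e > 0\<close> by (intro exI[of _ N]) fastforce
  qed
  then show thesis using that g by blast
qed

lemma integrable_phi_mult:
  assumes "Lp g" "Lp h" 
  shows "integrable M (\<lambda>t. phi p (g t) * h t)"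
    and "\<bar>LINT t|M. phi p (g t) * h t\<bar> \<le> nrm g powr (p - 1) * nrm h"
proof -
  note [measurable] = Lp_D(1)[OF assms(2)] phi_measurable[OF Lp_D(1)[OF assms(1)]]
  have e: "\<bar>phi p (g t) * h t\<bar> = \<bar>g t\<bar> powr (p - 1) * \<bar>h t\<bar>" for t by (simp add: abs_mult abs_phi)
  have "integrable M (\<lambda>t. \<bar>phi p (g t) * h t\<bar>)" unfolding e by (rule holder_phi(1)[OF assms])
  then show int: "integrable M (\<lambda>t. phi p (g t) * h t)" by (subst (asm) integrable_abs_iff) auto
  have "\<bar>LINT t|M. phi p (g t) * h t\<bar> \<le> (LINT t|M. \<bar>phi p (g t) * h t\<bar>)" by (rule integral_abs_bound)
  also have "\<dots> \<le> nrm g powr (p - 1) * nrm h" unfolding e by (rule holder_phi(2)[OF assms])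
  finally show "\<bar>LINT t|M. phi p (g t) * h t\<bar> \<le> nrm g powr (p - 1) * nrm h" .
qed

end

section \<open>Riemann-Liouville kernels\<close>

text \<open>Extension by 0 to s \<ge> t replaces the moving domain of integration by a fixed
  interval, which suits products of kernels and Fubini's theorem.\<close>

definition rl_kernel :: "real \<Rightarrow> real \<Rightarrow> real \<Rightarrow> real" where
  "rl_kernel a t s = (if s < t then (t - s) powr (a - 1) else 0)"

lemma rl_kernel_nonneg [simp]: "0 \<le> rl_kernel a t s"
  by (simp add: rl_kernel_def)

lemma rl_kernel_1: "rl_kernel 1 t s = (if s < t then 1 else 0)"
  by (simp add: rl_kernel_def)

lemma rl_kernel_measurable_pair:
  "(\<lambda>z. rl_kernel a (fst z) (snd z)) \<in> borel_measurable (borel \<Otimes>\<^sub>M borel)"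
  unfolding rl_kernel_def by measurable

text \<open>Powers of a kernel are kernels of another order, so their integrals reduce to the same
  Beta integrals.\<close>

lemma rl_kernel_powr: "q > 0 \<Longrightarrow> rl_kernel a t s powr q = rl_kernel ((a - 1) * q + 1) t s"
  by (simp add: rl_kernel_def powr_powr)

lemma Beta_one_right: "e > 0 \<Longrightarrow> Beta e 1 = 1 / (e :: real)"
proof -
  assume e: "e > 0"
  then have "e \<notin> \<int>\<^sub>\<le>\<^sub>0" by (auto elim!: nonpos_Ints_cases)
  then have "Gamma (e + 1) = e * Gamma e" by (rule Gamma_plus1)
  then show ?thesis using Gamma_real_pos[OF e] by (simp add: Beta_def)
qed

text \<open>The substitution s = r + (t - r) u turns the convolution of two kernels into a Beta
  integral times a power of t - r.\<close>

lemma nn_integral_rl_kernel_product: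
  assumes ab: "a > 0" "b > 0" and rt: "r < t"
  shows "(\<integral>\<^sup>+s. ennreal (rl_kernel a t s * rl_kernel b s r) \<partial>lborel) = ennreal (Beta a b * rl_kernel (a + b) t r)"
proof -
  define c where "c = t - r"
  have c: "c > 0" using rt by (simp add: c_def)
  have [measurable]: "(\<lambda>s. rl_kernel a t s) \<in> borel_measurable borel" "(\<lambda>s. rl_kernel b s r) \<in> borel_measurable borel"
    unfolding rl_kernel_def by measurable
  have pw: "rl_kernel a t (r + c * u) * rl_kernel b (r + c * u) r =
      c powr (a + b - 2) * (u powr (b - 1) * (1 - u) powr (a - 1)) * indicator {0..1} u" for u
  proof (cases "0 < u \<and> u < 1")
    case True
    have 1: "t - (r + c * u) = c * (1 - u)" by (simp add: c_def algebra_simps)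
    have 2: "c * (1 - u) > 0" "c * u > 0" using c True by simp_all
    have 3: "c powr (a + b - 2) = c powr (a - 1) * c powr (b - 1)"
      by (simp add: powr_add[symmetric])
    have "r + c * u < t" using 1 2 by linarith
    then have "rl_kernel a t (r + c * u) = (c * (1 - u)) powr (a - 1)"
      "rl_kernel b (r + c * u) r = (c * u) powr (b - 1)" using 1 2 by (simp_all add: rl_kernel_def)
    then show ?thesis using True 3 by (simp add: powr_mult)
  next
    case False
    \<comment> \<open>At u = 0 and u = 1 the product is 0 even for negative exponents, because
      \<open>0 powr x = 0\<close>.\<close>
    have z: "u powr (b - 1) * (1 - u) powr (a - 1) * indicator {0..1} u = 0"
      using False by (cases "u = 0"; cases "u = 1") (auto simp: indicator_def)
    have "rl_kernel a t (r + c * u) = 0 \<or> rl_kernel b (r + c * u) r = 0"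
    proof (cases "u \<le> 0")
      case True
      then have "c * u \<le> 0" using c by (simp add: mult_nonneg_nonpos)
      then show ?thesis by (simp add: rl_kernel_def)
    next
      case False
      then have "u \<ge> 1" using \<open>\<not> (0 < u \<and> u < 1)\<close> by simp
      then have "c * 1 \<le> c * u" using c by (intro mult_left_mono) auto
      then show ?thesis by (simp add: rl_kernel_def c_def)
    qed
    then show ?thesis using z by (metis mult_zero_left mult_zero_right mult.assoc)
  qed
  have "(\<integral>\<^sup>+s. ennreal (rl_kernel a t s * rl_kernel b s r) \<partial>lborel) =
      ennreal \<bar>c\<bar> * (\<integral>\<^sup>+u. ennreal (rl_kernel a t (r + c * u) * rl_kernel b (r + c * u) r) \<partial>lborel)"
    using c by (subst nn_integral_real_affine[where c = c and t = r]) auto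
  also have "(\<integral>\<^sup>+u. ennreal (rl_kernel a t (r + c * u) * rl_kernel b (r + c * u) r) \<partial>lborel) =
      (\<integral>\<^sup>+u. ennreal (c powr (a + b - 2)) * (ennreal (u powr (b - 1) * (1 - u) powr (a - 1)) * indicator {0..1} u) \<partial>lborel)"
    unfolding pw by (intro nn_integral_cong) (auto simp: indicator_def ennreal_mult)
  also have "\<dots> = ennreal (c powr (a + b - 2)) * (\<integral>\<^sup>+u. ennreal (u powr (b - 1) * (1 - u) powr (a - 1)) * indicator {0..1} u \<partial>lborel)"
    by (rule nn_integral_cmult) measurable
  also have "(\<integral>\<^sup>+u. ennreal (u powr (b - 1) * (1 - u) powr (a - 1)) * indicator {0..1} u \<partial>lborel) = ennreal (Beta b a)"
    by (rule nn_integral_has_integral_lebesgue'[OF _ has_integral_Beta_real]) (use ab in auto)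
  also have "ennreal \<bar>c\<bar> * (ennreal (c powr (a + b - 2)) * ennreal (Beta b a)) = ennreal (c * c powr (a + b - 2) * Beta b a)"
    using c ab by (simp add: ennreal_mult'[symmetric] mult.assoc)
  also have "c * c powr (a + b - 2) = c powr (a + b - 1)"
    using powr_mult_base[of c "a + b - 2"] c by simp
  finally show ?thesis using rt by (simp add: rl_kernel_def c_def Beta_commute mult.commute)
qed

lemma rl_kernel_le:
  assumes "c \<ge> 1" "r \<ge> 0" "t \<le> T" shows "rl_kernel c t r \<le> T powr (c - 1)"
  using assms by (auto simp: rl_kernel_def intro: powr_mono2)

text \<open>Superadditivity of the power: \<open>x powr q \<le> x * A powr (q - 1)\<close> on [0, A]
  is applied to both summands of A = (A - B) + B.\<close>

lemma powr_diff_le: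
  fixes A B q :: real
  assumes "0 \<le> B" "B \<le> A" "q \<ge> 1"
  shows "(A - B) powr q \<le> A powr q - B powr q"
proof -
  have *: "x powr q \<le> x * A powr (q - 1)" if "0 \<le> x" "x \<le> A" for x
  proof -
    have "x powr q = x * x powr (q - 1)" using that powr_mult_base[of x "q - 1"] by simp
    also have "\<dots> \<le> x * A powr (q - 1)" using that assms by (intro mult_left_mono powr_mono2) auto
    finally show ?thesis .
  qed
  have "(A - B) powr q + B powr q \<le> (A - B) * A powr (q - 1) + B * A powr (q - 1)"
    using assms by (intro add_mono *) auto
  also have "\<dots> = A powr q" using assms powr_mult_base[of A "q - 1"] by (simp add: algebra_simps)
  finally show ?thesis by simp
qed

lemma rl_integrand_measurable:
  fixes g :: "real \<Rightarrow> real"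
  assumes [measurable]: "g \<in> borel_measurable borel"
  shows "(\<lambda>s. indicator {0..t} s *\<^sub>R ((t - s) powr (a - 1) * g s)) \<in> borel_measurable borel"
  by measurable

context Lp_interval
begin

lemma rl_kernel_measurable [measurable]:
  "(\<lambda>s. rl_kernel a t s) \<in> borel_measurable M" "(\<lambda>s. rl_kernel a s t) \<in> borel_measurable M"
  by (rule borel_imp_M, simp add: rl_kernel_def)+

lemma AE_M_neq: "AE s in M. s \<noteq> c"
proof -
  have "AE s in lebesgue. s \<noteq> c" by (rule AE_I'[of "{c}"]) auto
  then show ?thesis by (subst AE_restrict_space_iff) (auto intro: eventually_mono)
qed

text \<open>The product of kernels vanishes unless r < s < t, so integrating over the interval gives
  the same value as over the whole line.\<close>

lemma integral_rl_kernel_product: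
  assumes ab: "a > 0" "b > 0" and r: "r \<in> {0..T}" and t: "t \<in> {0..T}"
  shows "integrable M (\<lambda>s. rl_kernel a t s * rl_kernel b s r)"
    and "(LINT s|M. rl_kernel a t s * rl_kernel b s r) = Beta a b * rl_kernel (a + b) t r"
proof -
  have "(\<integral>\<^sup>+s. ennreal (rl_kernel a t s * rl_kernel b s r) \<partial>M) = ennreal (Beta a b * rl_kernel (a + b) t r)"
  proof (cases "r < t")
    case True
    have "(\<integral>\<^sup>+s. ennreal (rl_kernel a t s * rl_kernel b s r) \<partial>M) =
        (\<integral>\<^sup>+s. ennreal (rl_kernel a t s * rl_kernel b s r) * indicator {0..T} s \<partial>lborel)"
      by (subst nn_integral_restrict_space) (auto simp: nn_integral_completion)
    also have "\<dots> = (\<integral>\<^sup>+s. ennreal (rl_kernel a t s * rl_kernel b s r) \<partial>lborel)"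
      using r t by (intro nn_integral_cong) (auto simp: rl_kernel_def indicator_def)
    finally show ?thesis using nn_integral_rl_kernel_product[OF ab True] by simp
  next
    case False
    then have z: "rl_kernel a t s * rl_kernel b s r = 0" for s by (auto simp: rl_kernel_def)
    show ?thesis unfolding z using False by (simp add: rl_kernel_def)
  qed
  moreover have "Beta a b \<ge> 0" using ab by (simp add: Beta_def Gamma_real_nonneg)
  ultimately have nn: "(\<integral>\<^sup>+s. ennreal (rl_kernel a t s * rl_kernel b s r) \<partial>M) = ennreal (Beta a b * rl_kernel (a + b) t r)"
    "0 \<le> Beta a b * rl_kernel (a + b) t r" by auto
  show "integrable M (\<lambda>s. rl_kernel a t s * rl_kernel b s r)"
    by (rule integrableI_nn_integral_finite[OF _ _ nn(1)]) auto
  show "(LINT s|M. rl_kernel a t s * rl_kernel b s r) = Beta a b * rl_kernel (a + b) t r"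
    by (rule integral_eq_nn_integral[THEN trans]) (use nn in auto)
qed

text \<open>The kernel of order \<open>1\<close> is an indicator function, so this is the case \<open>b = 1\<close> of the Beta
  integral.\<close>

lemma integral_rl_kernel_tail:
  assumes "e > 0" "0 \<le> r" "r \<le> t" "t \<le> T"
  shows "integrable M (\<lambda>s. rl_kernel e t s * rl_kernel 1 s r)"
    and "(LINT s|M. rl_kernel e t s * rl_kernel 1 s r) = (t - r) powr e / e"
proof -
  have r: "r \<in> {0..T}" "t \<in> {0..T}" using assms by auto
  have "rl_kernel (e + 1) t r = (t - r) powr e" using assms by (cases "r = t") (simp_all add: rl_kernel_def)
  then show "integrable M (\<lambda>s. rl_kernel e t s * rl_kernel 1 s r)"
    "(LINT s|M. rl_kernel e t s * rl_kernel 1 s r) = (t - r) powr e / e"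
    using integral_rl_kernel_product[OF assms(1) zero_less_one r] assms(1) by (simp_all add: Beta_one_right)
qed

lemma integral_rl_kernel:
  assumes "e > 0" "0 \<le> t" "t \<le> T"
  shows "integrable M (\<lambda>s. rl_kernel e t s)" and "(LINT s|M. rl_kernel e t s) = t powr e / e"
proof -
  have ae: "AE s in M. rl_kernel e t s * rl_kernel 1 s 0 = rl_kernel e t s"
    using AE_M_neq[of 0] AE_space by eventually_elim (auto simp: rl_kernel_1)
  note k = integral_rl_kernel_tail[of e 0 t]
  show "integrable M (\<lambda>s. rl_kernel e t s)"
    by (rule integrable_cong_AE[THEN iffD1, OF _ _ ae]) (use k(1) assms in auto)
  have "(LINT s|M. rl_kernel e t s * rl_kernel 1 s 0) = (LINT s|M. rl_kernel e t s)"
    by (rule integral_cong_AE[OF _ _ ae]) auto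
  then show "(LINT s|M. rl_kernel e t s) = t powr e / e" using k(2) assms by simp
qed

text \<open>Left of \<open>u\<close> the kernel decreases in its first argument because a \<le> 1,
  and superadditivity of powers replaces the power of the difference by a difference of kernels of
  order \<open>e\<close>, whose integral is explicit. Between \<open>u\<close> and \<open>t\<close>
  only one kernel is left.\<close>

lemma rl_kernel_diff:
  assumes q: "q \<ge> 1" and a: "a \<le> 1" and e: "e = (a - 1) * q + 1" "e > 0"
    and t: "0 \<le> u" "u \<le> t" "t \<le> T"
  shows "integrable M (\<lambda>s. \<bar>rl_kernel a t s - rl_kernel a u s\<bar> powr q)"
    and "(LINT s|M. \<bar>rl_kernel a t s - rl_kernel a u s\<bar> powr q) \<le> 2 * ((t - u) powr e / e)"
proof -
  let ?d = "\<lambda>s. \<bar>rl_kernel a t s - rl_kernel a u s\<bar> powr q"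
  \<comment> \<open>Right of \<open>u\<close> the first bracket contributes
    \<open>- rl_kernel e t s\<close>, for which the factor 2 compensates. The point s = u is
    excluded below because \<open>rl_kernel 1 s u\<close> is 0 there.\<close>
  let ?b = "\<lambda>s. (rl_kernel e u s - rl_kernel e t s) + 2 * (rl_kernel e t s * rl_kernel 1 s u)"
  have kq: "rl_kernel a x s powr q = rl_kernel e x s" for x s using q by (simp add: rl_kernel_powr e(1))
  have le: "?d s \<le> ?b s" if s: "s \<noteq> u" for s
  proof (cases "s < u")
    case True
    have "(t - s) powr (a - 1) \<le> (u - s) powr (a - 1)" using True t a by (intro powr_mono2') auto
    then have 1: "rl_kernel a t s \<le> rl_kernel a u s" using True t by (simp add: rl_kernel_def)
    then have "?d s = (rl_kernel a u s - rl_kernel a t s) powr q" by (simp add: abs_minus_commute)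
    also have "\<dots> \<le> rl_kernel e u s - rl_kernel e t s"
      unfolding kq[symmetric] by (rule powr_diff_le) (use 1 q in auto)
    finally have "?d s \<le> rl_kernel e u s - rl_kernel e t s" .
    moreover have "0 \<le> 2 * (rl_kernel e t s * rl_kernel 1 s u)" by simp
    ultimately show ?thesis by linarith
  next
    case False
    then have "rl_kernel a u s = 0" "rl_kernel e u s = 0" "rl_kernel 1 s u = 1"
      using s by (auto simp: rl_kernel_def)
    then show ?thesis using kq[of t s] by simp
  qed
  have int: "integrable M ?b"
    using t e integral_rl_kernel(1)[of e] integral_rl_kernel_tail(1)[of e u t] by auto
  have ae: "AE s in M. ?d s \<le> ?b s" using AE_M_neq[of u] by eventually_elim (rule le)
  show d: "integrable M ?d"
    by (rule Bochner_Integration.integrable_bound[OF int]) (use ae in \<open>auto elim!: eventually_mono intro: order_trans\<close>)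
  have "(LINT s|M. ?d s) \<le> (LINT s|M. ?b s)"
    by (rule integral_mono_AE[OF d int ae])
  also have "\<dots> = (u powr e / e - t powr e / e) + 2 * ((t - u) powr e / e)"
    using t e integral_rl_kernel[of e] integral_rl_kernel_tail[of e u t] by simp
  also have "\<dots> \<le> 2 * ((t - u) powr e / e)"
    using t e powr_mono2[of e u t] by (simp add: divide_right_mono)
  finally show "(LINT s|M. ?d s) \<le> 2 * ((t - u) powr e / e)" .
qed

section \<open>The Riemann-Liouville integral as an operator\<close>

definition RL :: "real \<Rightarrow> (real \<Rightarrow> real) \<Rightarrow> real \<Rightarrow> real" where
  "RL a g t = 1 / Gamma a * (LINT s|M. rl_kernel a t s * g s)"

text \<open>Fubini's theorem and the Beta integral, whose value turns the Gamma factors into the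
  single one of order a + b. For a + b \<ge> 1 the resulting kernel is bounded on the interval, so
  the double integral converges for every integrable \<open>g\<close>.\<close>

lemma RL_semigroup:
  assumes ab: "a > 0" "b > 0" "a + b \<ge> 1" and g: "integrable M g" and t: "t \<in> {0..T}"
  shows "RL a (RL b g) t = RL (a + b) g t"
proof -
  interpret P: pair_sigma_finite M M ..
  let ?f = "\<lambda>r s. rl_kernel a t s * rl_kernel b s r * g r"
  have [measurable]: "g \<in> borel_measurable M" using g by auto
  have [measurable]: "(\<lambda>z. rl_kernel b (snd z) (fst z)) \<in> borel_measurable (M \<Otimes>\<^sub>M M)"
  proof -
    have "(\<lambda>z. (snd z, fst z)) \<in> M \<Otimes>\<^sub>M M \<rightarrow>\<^sub>M borel \<Otimes>\<^sub>M borel"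
      by (rule measurable_Pair; rule measurable_compose[OF _ ident_measurable]; measurable)
    from measurable_compose[OF this rl_kernel_measurable_pair[of b]] show ?thesis by simp
  qed
  have "(\<lambda>z. rl_kernel a t (snd z) * rl_kernel b (snd z) (fst z) * g (fst z)) \<in> borel_measurable (M \<Otimes>\<^sub>M M)"
    by (intro borel_measurable_times measurable_compose[OF measurable_snd rl_kernel_measurable(1)]
        measurable_compose[OF measurable_fst \<open>g \<in> borel_measurable M\<close>]) fact
  then have meas: "(\<lambda>(r, s). ?f r s) \<in> borel_measurable (M \<Otimes>\<^sub>M M)" by (simp add: case_prod_beta')
  note k = integral_rl_kernel_product[OF ab(1,2) _ t]
  have in_s: "(LINT s|M. ?f r s) = Beta a b * rl_kernel (a + b) t r * g r"
    and in_abs: "(LINT s|M. norm (?f r s)) = Beta a b * rl_kernel (a + b) t r * \<bar>g r\<bar>"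
    if "r \<in> space M" for r
    using k[of r] that by (simp_all add: abs_mult)
  have int_r: "integrable M (\<lambda>r. Beta a b * rl_kernel (a + b) t r * \<bar>g r\<bar>)"
  proof (rule Bochner_Integration.integrable_bound)
    show "integrable M (\<lambda>r. \<bar>Beta a b\<bar> * T powr (a + b - 1) * \<bar>g r\<bar>)" using g by simp
    show "AE r in M. norm (Beta a b * rl_kernel (a + b) t r * \<bar>g r\<bar>) \<le> norm (\<bar>Beta a b\<bar> * T powr (a + b - 1) * \<bar>g r\<bar>)"
      using ab t rl_kernel_le[of "a + b" _ t]
      by (intro AE_I2) (auto simp: abs_mult intro!: mult_mono)
  qed measurable
  have int: "integrable (M \<Otimes>\<^sub>M M) (\<lambda>(r, s). ?f r s)"
  proof (rule P.Fubini_integrable[OF meas])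
    show "integrable M (\<lambda>r. LINT s|M. norm (case (r, s) of (r, s) \<Rightarrow> ?f r s))"
      by (rule Bochner_Integration.integrable_cong[THEN iffD1, OF refl _ int_r]) (simp only: prod.case in_abs)
    show "AE r in M. integrable M (\<lambda>s. case (r, s) of (r, s) \<Rightarrow> ?f r s)"
      using k by (intro AE_I2) auto
  qed
  have "RL a (RL b g) t = 1 / Gamma a * (1 / Gamma b) * (LINT s|M. LINT r|M. ?f r s)"
    unfolding RL_def by (simp add: mult.assoc mult.left_commute flip: integral_mult_right_zero)
  also have "(LINT s|M. LINT r|M. ?f r s) = (LINT r|M. LINT s|M. ?f r s)"
    by (rule P.Fubini_integral[OF int])
  also have "\<dots> = (LINT r|M. Beta a b * (rl_kernel (a + b) t r * g r))"
    by (rule Bochner_Integration.integral_cong[OF refl], rule trans[OF in_s mult.assoc])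
  also have "\<dots> = Beta a b * (LINT r|M. rl_kernel (a + b) t r * g r)" by simp
  finally show ?thesis
    using Gamma_real_pos[OF ab(1)] Gamma_real_pos[OF ab(2)] by (simp add: RL_def Beta_def)
qed

lemma RL_at_0: "RL a g 0 = 0"
proof -
  have "(LINT s|M. rl_kernel a 0 s * g s) = (LINT s|M. 0)"
    by (rule Bochner_Integration.integral_cong) (auto simp: rl_kernel_def)
  then show ?thesis by (simp add: RL_def)
qed

lemma continuous_bounded:
  assumes "continuous_on {0..T} (f :: real \<Rightarrow> real)"
  obtains B where "B \<ge> 0" "\<And>t. t \<in> {0..T} \<Longrightarrow> \<bar>f t\<bar> \<le> B"
proof -
  have "bounded (f ` {0..T})" using compact_imp_bounded[OF compact_continuous_image[OF assms]] by simp
  then obtain B where B: "\<forall>x\<in>f ` {0..T}. norm x \<le> B" unfolding bounded_iff by blast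
  show thesis
  proof (rule that)
    show "\<bar>f t\<bar> \<le> max B 0" if "t \<in> {0..T}" for t
      using B[rule_format, OF imageI[OF that]] by simp
  qed simp
qed

lemma RL_1:
  assumes f: "continuous_on {0..T} f" and t: "t \<in> {0..T}"
  shows "RL 1 f t = integral {0..t} f"
proof -
  have m: "f \<in> borel_measurable M" using f by (intro continuous_imp_measurable_on_sets_lebesgue) auto
  have int: "integrable M (\<lambda>s. rl_kernel 1 t s * f s)"
  proof -
    obtain B where B: "B \<ge> 0" "\<And>s. s \<in> {0..T} \<Longrightarrow> \<bar>f s\<bar> \<le> B" using continuous_bounded[OF f] by blast
    show ?thesis
      by (rule integrable_const_bound[of _ B])
         (use B m in \<open>auto simp: rl_kernel_1 intro!: AE_I2\<close>)
  qed
  have "RL 1 f t = integral {0..T} (\<lambda>s. rl_kernel 1 t s * f s)"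
    unfolding RL_def using lebesgue_integral_eq_integral[OF int] by simp
  also have "\<dots> = integral {0..T} (\<lambda>s. if s \<in> {0..t} then f s else 0)"
    by (rule integral_spike[of "{t}"]) (auto simp: rl_kernel_1)
  also have "\<dots> = integral ({0..t} \<inter> {0..T}) f" by (rule integral_restrict_Int)
  also have "{0..t} \<inter> {0..T} = {0..t}" using t by auto
  finally show ?thesis .
qed

lemma continuous_imp_M: "continuous_on {0..T} f \<Longrightarrow> f \<in> borel_measurable M"
  by (intro continuous_imp_measurable_on_sets_lebesgue) auto

lemma continuous_Lp: "continuous_on {0..T} f \<Longrightarrow> Lp f"
  using continuous_imp_M continuous_bounded[of f] Lp_bounded(1) by blast

text \<open>\<open>RL\<close> integrates against the completed measure, as suits functions that are
  only Lebesgue measurable, while \<open>RL_integral\<close> uses the Borel one. For continuous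
  \<open>f\<close>, cutting off outside the interval gives a Borel function, and the two integrals
  agree.\<close>

lemma RL_integral_eq:
  assumes f: "continuous_on {0..T} f" and t: "t \<in> {0..T}"
  shows "RL_integral a f t = RL a f t"
proof -
  let ?g = "\<lambda>s. (t - s) powr (a - 1) * (indicator {0..T} s *\<^sub>R f s)"
  have "(\<lambda>s. indicator {0..T} s *\<^sub>R f s) \<in> borel_measurable borel"
    by (rule borel_measurable_continuous_on_indicator[OF _ f]) simp
  then have m: "(\<lambda>s. indicator {0..t} s *\<^sub>R ?g s) \<in> borel_measurable lborel"
    unfolding measurable_lborel2 by (rule rl_integrand_measurable)
  have "(LINT s:{0..t}|lborel. (t - s) powr (a - 1) * f s) = (LINT s|lborel. indicator {0..t} s *\<^sub>R ?g s)"
    unfolding set_lebesgue_integral_def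
    using t by (intro Bochner_Integration.integral_cong) (auto simp: indicator_def)
  also have "\<dots> = (LINT s|lebesgue. indicator {0..t} s *\<^sub>R ?g s)" by (rule integral_completion[OF m, symmetric])
  also have "\<dots> = (LINT s|lebesgue. indicator {0..T} s *\<^sub>R (rl_kernel a t s * f s))"
    using t by (intro Bochner_Integration.integral_cong) (auto simp: indicator_def rl_kernel_def)
  also have "\<dots> = (LINT s|M. rl_kernel a t s * f s)" by (rule integral_restrict_space[symmetric]) simp
  finally show ?thesis by (simp add: RL_integral_def RL_def)
qed

text \<open>Kernel differences are of order \<open>(t - u) powr a\<close> in L^1, by
  \<open>rl_kernel_diff\<close> with exponent 1; a bounded integrand passes this on as Hoelder
  continuity.\<close>

lemma RL_bounded_continuous:
  assumes a: "0 < a" "a \<le> 1" and f: "continuous_on {0..T} f"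
  shows "continuous_on {0..T} (RL a f)"
proof -
  obtain B where B: "B \<ge> 0" "\<And>t. t \<in> {0..T} \<Longrightarrow> \<bar>f t\<bar> \<le> B" using continuous_bounded[OF f] by blast
  note [measurable] = continuous_imp_M[OF f]
  define K where "K = 1 / Gamma a * (B * (2 / a))"
  have Ga: "Gamma a > 0" using a by (simp add: Gamma_real_pos)
  have K: "K \<ge> 0" using B a Ga by (simp add: K_def)
  have int: "integrable M (\<lambda>s. rl_kernel a t s * f s)" if t: "t \<in> {0..T}" for t
  proof (rule Bochner_Integration.integrable_bound)
    show "integrable M (\<lambda>s. B * rl_kernel a t s)" using integral_rl_kernel(1)[of a t] a t by simp
    show "AE s in M. norm (rl_kernel a t s * f s) \<le> norm (B * rl_kernel a t s)"
      using B by (intro AE_I2) (auto simp: abs_mult mult.commute intro!: mult_right_mono)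
  qed measurable
  have ord: "\<bar>RL a f t - RL a f u\<bar> \<le> K * (t - u) powr a" if t: "0 \<le> u" "u \<le> t" "t \<le> T" for t u
  proof -
    note d = rl_kernel_diff[of 1 a a u t]
    have "RL a f t - RL a f u = 1 / Gamma a * (LINT s|M. (rl_kernel a t s - rl_kernel a u s) * f s)"
      unfolding RL_def using int[of t] int[of u] t by (simp add: left_diff_distrib right_diff_distrib diff_divide_distrib)
    then have "\<bar>RL a f t - RL a f u\<bar> = 1 / Gamma a * \<bar>LINT s|M. (rl_kernel a t s - rl_kernel a u s) * f s\<bar>"
      using Ga by (simp add: abs_mult)
    also have "\<bar>LINT s|M. (rl_kernel a t s - rl_kernel a u s) * f s\<bar> \<le> (LINT s|M. B * (\<bar>rl_kernel a t s - rl_kernel a u s\<bar> powr 1))"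
    proof (rule order_trans[OF integral_abs_bound], rule integral_mono)
      show "integrable M (\<lambda>s. \<bar>(rl_kernel a t s - rl_kernel a u s) * f s\<bar>)"
        using int[of t] int[of u] t by (simp add: left_diff_distrib)
      show "integrable M (\<lambda>s. B * (\<bar>rl_kernel a t s - rl_kernel a u s\<bar> powr 1))" using d(1) a t by simp
    qed (use B in \<open>auto simp: abs_mult mult.commute intro!: mult_right_mono\<close>)
    also have "\<dots> = B * (LINT s|M. \<bar>rl_kernel a t s - rl_kernel a u s\<bar> powr 1)" by (rule integral_mult_right_zero)
    also have "\<dots> \<le> B * (2 * ((t - u) powr a / a))"
      by (rule mult_left_mono[OF d(2)]) (use a t B in auto)
    finally show ?thesis using Ga by (simp add: K_def mult_ac divide_right_mono)
  qed
  show ?thesis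
    unfolding continuous_on_iff
  proof (intro ballI allI impI)
    fix x e :: real assume x: "x \<in> {0..T}" and e: "e > 0"
    define d where "d = (e / (K + 1)) powr (1 / a)"
    have d: "d > 0" using e K by (simp add: d_def)
    have da: "d powr a = e / (K + 1)" using e K a by (simp add: d_def powr_powr)
    show "\<exists>d>0. \<forall>y\<in>{0..T}. dist y x < d \<longrightarrow> dist (RL a f y) (RL a f x) < e"
    proof (intro exI[of _ d] conjI ballI impI d)
      fix y assume y: "y \<in> {0..T}" "dist y x < d"
      have "dist (RL a f y) (RL a f x) \<le> K * \<bar>y - x\<bar> powr a"
        using ord[of x y] ord[of y x] x y by (cases "x \<le> y") (auto simp: dist_real_def abs_minus_commute)
      also have "\<dots> \<le> K * d powr a" using y a K by (intro mult_left_mono powr_mono2) (auto simp: dist_real_def)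
      also have "\<dots> < e" using e K by (simp add: da field_simps)
      finally show "dist (RL a f y) (RL a f x) < e" .
    qed
  qed
qed

text \<open>Since w(0) = 0, \<open>w\<close> is the integral of order 1 of w'. Let \<open>v\<close>
  be the integral of order 1 - \<alpha> of w'. Commuting orders by the semigroup law shows that the
  integral of order 1 - \<alpha> of \<open>w\<close> is the primitive of \<open>v\<close>, so
  \<open>v\<close> is the fractional derivative (its Caputo form), and that order \<alpha> applied
  to \<open>v\<close> gives back \<open>w\<close>. For \<alpha> = 1 simply \<open>v\<close> = w'.
  The derivative is claimed in the open interval only, \<open>deriv\<close> being two-sided.\<close>

lemma C0_infinity_deriv:
  assumes w: "w \<in> C0_infinity T" and \<alpha>: "0 < \<alpha>" "\<alpha> \<le> 1"
  obtains v where "continuous_on {0..T} v" "\<And>t. t \<in> {0<..<T} \<Longrightarrow> RL_deriv \<alpha> w t = v t"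
    "\<And>t. t \<in> {0..T} \<Longrightarrow> w t = RL \<alpha> v t"
proof -
  obtain d where d0: "\<And>t. t \<in> {0..T} \<Longrightarrow> d 0 t = w t"
    and dd: "\<And>k t. t \<in> {0..T} \<Longrightarrow> (d k has_real_derivative d (Suc k) t) (at t within {0..T})"
    and w0: "w 0 = 0"
    using w unfolding C0_infinity_def mem_Collect_eq by blast
  have wd: "(w has_real_derivative d 1 t) (at t within {0..T})" if t: "t \<in> {0..T}" for t
    by (rule has_field_derivative_transform_within[of "d 0" _ _ _ 1]) (use dd[OF t, of 0] d0 t in auto)
  have c1: "continuous_on {0..T} (d 1)"
    using dd[of _ 1] by (meson DERIV_continuous continuous_on_eq_continuous_within)
  have cw: "continuous_on {0..T} w"
    using wd by (meson DERIV_continuous continuous_on_eq_continuous_within)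
  have i1: "integrable M (d 1)" using Lp_integrable(1)[OF continuous_Lp[OF c1]] .
  have w_eq: "w t = RL 1 (d 1) t" if t: "t \<in> {0..T}" for t
  proof -
    have "(w has_vector_derivative d 1 x) (at x within {0..t})" if "x \<in> {0..t}" for x
      using DERIV_subset[OF wd[of x], of "{0..t}"] t that
      by (simp add: has_real_derivative_iff_has_vector_derivative)
    then have "((d 1) has_integral (w t - w 0)) {0..t}"
      using t by (intro fundamental_theorem_of_calculus) auto
    then show ?thesis using RL_1[OF c1 t] w0 by (simp add: integral_unique)
  qed
  have interior: "(f has_real_derivative D) (at t)" if "t \<in> {0<..<T}" "(f has_real_derivative D) (at t within {0..T})" for f D t
    using that by (simp add: at_within_Icc_at)
  show thesis
  proof (cases "\<alpha> = 1")
    case True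
    show thesis
    proof (rule that[OF c1])
      show "RL_deriv \<alpha> w t = d 1 t" if "t \<in> {0<..<T}" for t
        using interior[OF that wd] that True by (simp add: RL_deriv_def DERIV_imp_deriv)
      show "w t = RL \<alpha> (d 1) t" if "t \<in> {0..T}" for t using w_eq[OF that] True by simp
    qed
  next
    case False
    then have \<alpha>1: "\<alpha> < 1" using \<alpha> by simp
    define v where "v = RL (1 - \<alpha>) (d 1)"
    have cv: "continuous_on {0..T} v" unfolding v_def using \<alpha> \<alpha>1 c1 by (intro RL_bounded_continuous) auto
    have RLw: "RL_integral (1 - \<alpha>) w t = integral {0..t} v" if t: "t \<in> {0..T}" for t
    proof -
      have "RL_integral (1 - \<alpha>) w t = RL (1 - \<alpha>) w t" by (rule RL_integral_eq[OF cw t])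
      also have "\<dots> = RL (1 - \<alpha>) (RL 1 (d 1)) t"
        unfolding RL_def[of "1 - \<alpha>"]
        by (rule arg_cong[where f="\<lambda>x. 1 / Gamma (1 - \<alpha>) * x"], rule Bochner_Integration.integral_cong) (auto simp: w_eq)
      also have "\<dots> = RL (1 - \<alpha> + 1) (d 1) t" using \<alpha> \<alpha>1 i1 t by (intro RL_semigroup) auto
      also have "\<dots> = RL (1 + (1 - \<alpha>)) (d 1) t" by (simp add: add.commute)
      also have "\<dots> = RL 1 v t" unfolding v_def using \<alpha> \<alpha>1 i1 t by (intro RL_semigroup[symmetric]) auto
      also have "\<dots> = integral {0..t} v" by (rule RL_1[OF cv t])
      finally show ?thesis .
    qed
    show thesis
    proof (rule that[OF cv])
      fix t assume t: "t \<in> {0<..<T}"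
      have "((\<lambda>t. integral {0..t} v) has_real_derivative v t) (at t within {0..T})"
        using t by (intro integral_has_real_derivative cv) auto
      then have "(RL_integral (1 - \<alpha>) w has_real_derivative v t) (at t within {0..T})"
        by (rule has_field_derivative_transform_within[of _ _ _ _ 1]) (use t RLw in auto)
      then show "RL_deriv \<alpha> w t = v t"
        using interior[OF t] False by (simp add: RL_deriv_def DERIV_imp_deriv)
    next
      fix t assume t: "t \<in> {0..T}"
      have "RL \<alpha> v t = RL (\<alpha> + (1 - \<alpha>)) (d 1) t" unfolding v_def using \<alpha> \<alpha>1 i1 t by (intro RL_semigroup) auto
      then show "w t = RL \<alpha> v t" using w_eq[OF t] by simp
    qed
  qed
qed

end

section \<open>The fractional space\<close>

lemma C0_infinity_linear:
  assumes "v \<in> C0_infinity T" "w \<in> C0_infinity T"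
  shows "(\<lambda>t. c * v t + e * w t) \<in> C0_infinity T"
proof -
  obtain d1 where d1: "\<forall>t\<in>{0..T}. d1 (0::nat) t = v t"
    "\<forall>k. \<forall>t\<in>{0..T}. (d1 k has_real_derivative d1 (Suc k) t) (at t within {0..T})"
    using assms(1) unfolding C0_infinity_def mem_Collect_eq by blast
  obtain d2 where d2: "\<forall>t\<in>{0..T}. d2 (0::nat) t = w t"
    "\<forall>k. \<forall>t\<in>{0..T}. (d2 k has_real_derivative d2 (Suc k) t) (at t within {0..T})"
    using assms(2) unfolding C0_infinity_def mem_Collect_eq by blast
  have "((\<lambda>t. c * d1 k t + e * d2 k t) has_real_derivative c * d1 (Suc k) t + e * d2 (Suc k) t) (at t within {0..T})"
    if "t \<in> {0..T}" for k t
    using d1(2) d2(2) that by (intro DERIV_add DERIV_cmult) auto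
  then show ?thesis
    using assms d1(1) d2(1) unfolding C0_infinity_def mem_Collect_eq
    by (intro conjI exI[of _ "\<lambda>k t. c * d1 k t + e * d2 k t"]) auto
qed

lemma powr_sum_tendsto_0:
  fixes A B :: "nat \<Rightarrow> real" and p :: real
  assumes p: "p > 0" and "\<And>n. A n \<ge> 0" "\<And>n. B n \<ge> 0" "(\<lambda>n. (A n powr p + B n powr p) powr (1 / p)) \<longlonglongrightarrow> 0"
  shows "A \<longlonglongrightarrow> 0" "B \<longlonglongrightarrow> 0"
proof -
  have *: "x \<le> (x powr p + y powr p) powr (1 / p)" if "x \<ge> 0" for x y :: real
  proof -
    have "x = (x powr p) powr (1 / p)" using that p by (simp add: powr_powr)
    also have "\<dots> \<le> (x powr p + y powr p) powr (1 / p)" using p by (intro powr_mono2) auto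
    finally show ?thesis .
  qed
  show "A \<longlonglongrightarrow> 0" using assms *
    by (intro tendsto_sandwich[OF _ _ tendsto_const assms(4)]) auto
  show "B \<longlonglongrightarrow> 0" using assms *[of "B _" "A _"]
    by (intro tendsto_sandwich[OF _ _ tendsto_const assms(4)]) (auto simp: add.commute)
qed

context Lp_interval
begin

section \<open>Injectivity of ordinary integration\<close>

lemma RL_cong_AE:
  assumes "AE s in M. f s = g s" "f \<in> borel_measurable M" "g \<in> borel_measurable M"
  shows "RL a f t = RL a g t"
proof -
  have "(LINT s|M. rl_kernel a t s * f s) = (LINT s|M. rl_kernel a t s * g s)"
    by (rule integral_cong_AE) (use assms in \<open>auto elim!: eventually_mono\<close>)
  then show ?thesis by (simp add: RL_def)
qed

text \<open>The positive and negative parts of \<open>h\<close> are densities of finite Borel measures that agree on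
  all half-lines.\<close>

lemma AE_zero_of_RL_1:
  assumes h: "integrable M h" and z: "\<And>t. t \<in> {0..T} \<Longrightarrow> RL 1 h t = 0"
  shows "AE s in M. h s = 0"
proof -
  note [measurable] = borel_measurable_integrable[OF h]
  define hp where "hp s = max 0 (h s)" for s
  define hn where "hn s = max 0 (- h s)" for s
  have meas [measurable]: "hp \<in> borel_measurable M" "hn \<in> borel_measurable M" unfolding hp_def hn_def by measurable
  have int: "integrable M hp" "integrable M hn"
    by (rule Bochner_Integration.integrable_bound[OF h]; force simp: hp_def hn_def)+
  have below: "(LINT s|M. rl_kernel 1 t s * h s) = 0" if "t \<in> {0..T}" for t
    using z[OF that] by (simp add: RL_def)
  have ik: "integrable M (\<lambda>s. rl_kernel 1 t s * h s)" for t
    by (rule Bochner_Integration.integrable_bound[OF h]) (auto simp: rl_kernel_1)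
  have "(LINT s|M. rl_kernel 1 T s * h s) = (LINT s|M. h s)"
    by (rule integral_cong_AE) (use AE_M_neq[of T] AE_space in \<open>auto simp: rl_kernel_1\<close>)
  then have total: "(LINT s|M. h s) = 0" using below[of T] T by simp
  \<comment> \<open>The hypothesis speaks of initial segments. Subtraction from the total integral,
    which is 0 by the case t = T, gives the half-lines that determine a measure.\<close>
  have above: "(LINT s|M. indicator {x<..} s * h s) = 0" for x
  proof -
    consider "x < 0" | "x \<in> {0..T}" | "x > T" by force
    then show ?thesis
    proof cases
      case 1
      have "(LINT s|M. indicator {x<..} s * h s) = (LINT s|M. h s)"
        using 1 by (intro Bochner_Integration.integral_cong) (auto simp: indicator_def)
      then show ?thesis using total by simp
    next
      case 2
      have "(LINT s|M. indicator {x<..} s * h s) = (LINT s|M. h s - rl_kernel 1 x s * h s)"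
        by (rule integral_cong_AE) (use AE_M_neq[of x] in \<open>auto simp: rl_kernel_1 indicator_def\<close>)
      then show ?thesis using total below[OF 2] h ik by simp
    next
      case 3
      have "(LINT s|M. indicator {x<..} s * h s) = (LINT s|M. 0)"
        using 3 by (intro Bochner_Integration.integral_cong) (auto simp: indicator_def)
      then show ?thesis by simp
    qed
  qed
  define \<mu>p where "\<mu>p = distr (density M (\<lambda>s. ennreal (hp s))) borel (\<lambda>s. s)"
  define \<mu>n where "\<mu>n = distr (density M (\<lambda>s. ennreal (hn s))) borel (\<lambda>s. s)"
  have em: "emeasure \<mu>p A = ennreal (LINT s|M. indicator A s * hp s)"
           "emeasure \<mu>n A = ennreal (LINT s|M. indicator A s * hn s)"
    and ia: "integrable M (\<lambda>s. indicator A s * hp s)" "integrable M (\<lambda>s. indicator A s * hn s)"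
    if A: "A \<in> sets borel" for A
  proof -
    have AM: "A \<inter> {0..T} \<in> sets M"
      using measurable_sets[OF ident_measurable A] by simp
    have *: "emeasure (distr (density M (\<lambda>s. ennreal (f s))) borel (\<lambda>s. s)) A = ennreal (LINT s|M. indicator A s * f s)
        \<and> integrable M (\<lambda>s. indicator A s * f s)"
      if f: "integrable M f" "\<And>s. f s \<ge> 0" for f
    proof
      note [measurable] = borel_measurable_integrable[OF f(1)]
      have im: "(\<lambda>s. indicator A s :: real) \<in> borel_measurable M"
        by (rule borel_imp_M) (use A in simp)
      show ig: "integrable M (\<lambda>s. indicator A s * f s)"
        by (rule Bochner_Integration.integrable_bound[OF f(1)])
           (use im in \<open>auto simp: indicator_def\<close>)
      have "emeasure (distr (density M (\<lambda>s. ennreal (f s))) borel (\<lambda>s. s)) A =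
          emeasure (density M (\<lambda>s. ennreal (f s))) (A \<inter> {0..T})"
        using A by (subst emeasure_distr) auto
      also have "\<dots> = (\<integral>\<^sup>+s. ennreal (f s) * indicator (A \<inter> {0..T}) s \<partial>M)"
        by (rule emeasure_density) (use AM in auto)
      also have "\<dots> = (\<integral>\<^sup>+s. ennreal (indicator A s * f s) \<partial>M)"
        by (rule nn_integral_cong) (auto simp: indicator_def)
      also have "\<dots> = ennreal (LINT s|M. indicator A s * f s)"
        by (rule nn_integral_eq_integral[OF ig]) (use f in auto)
      finally show "emeasure (distr (density M (\<lambda>s. ennreal (f s))) borel (\<lambda>s. s)) A = ennreal (LINT s|M. indicator A s * f s)" .
    qed
    show "emeasure \<mu>p A = ennreal (LINT s|M. indicator A s * hp s)"
      "emeasure \<mu>n A = ennreal (LINT s|M. indicator A s * hn s)"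
      "integrable M (\<lambda>s. indicator A s * hp s)" "integrable M (\<lambda>s. indicator A s * hn s)"
      unfolding \<mu>p_def \<mu>n_def using *[OF int(1)] *[OF int(2)] by (auto simp: hp_def hn_def)
  qed
  have hdec: "h s = hp s - hn s" for s by (simp add: hp_def hn_def max_def)
  have "\<mu>p = \<mu>n"
  proof (rule measure_eqI_lessThan)
    show "sets \<mu>p = sets borel" "sets \<mu>n = sets borel" by (simp_all add: \<mu>p_def \<mu>n_def)
    fix x :: real
    show "emeasure \<mu>p {x<..} < \<infinity>" by (simp add: em)
    have "(LINT s|M. indicator {x<..} s * h s) = (LINT s|M. indicator {x<..} s * hp s) - (LINT s|M. indicator {x<..} s * hn s)"
      unfolding hdec using ia[of "{x<..}"] by (simp add: right_diff_distrib)
    then show "emeasure \<mu>p {x<..} = emeasure \<mu>n {x<..}" using above by (simp add: em)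
  qed
  then have eqA: "(LINT s|M. indicator A s * hp s) = (LINT s|M. indicator A s * hn s)" if A: "A \<in> sets borel" for A
  proof -
    have "ennreal (LINT s|M. indicator A s * hp s) = ennreal (LINT s|M. indicator A s * hn s)"
      using em[OF A] \<open>\<mu>p = \<mu>n\<close> by simp
    then show ?thesis by (subst (asm) ennreal_inj) (auto simp: hp_def hn_def intro!: integral_nonneg_AE)
  qed
  \<comment> \<open>The measures are compared on Borel sets, whereas the sets where \<open>h\<close>
    is positive or negative are merely Lebesgue measurable; a Borel version \<open>f\<close> of
    \<open>h\<close> supplies the test sets.\<close>
  have "(\<lambda>s. indicator {0..T} s * h s) \<in> borel_measurable (completion lborel)"
  proof -
    have "(\<lambda>s. indicator {0..T} s *\<^sub>R h s) \<in> borel_measurable lebesgue"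
      by (subst borel_measurable_restrict_space_iff[symmetric]) (auto)
    then show ?thesis by simp
  qed
  then obtain f where f: "f \<in> borel_measurable lborel" and fe: "AE s in lborel. indicator {0..T} s * h s = f s"
    using completion_ex_borel_measurable_real by blast
  from f have f': "f \<in> borel_measurable borel" by simp
  have "AE s in lebesgue. indicator {0..T} s * h s = f s" using fe by (rule AE_completion)
  then have fh: "AE s in M. f s = h s"
    by (subst AE_restrict_space_iff) (auto elim!: eventually_mono simp: indicator_def)
  have pos: "{s. f s > 0} \<in> sets borel" "{s. f s < 0} \<in> sets borel"
    using f'[unfolded borel_measurable_iff_greater, rule_format, of 0]
      f'[unfolded borel_measurable_iff_less, rule_format, of 0] by simp_all
  \<comment> \<open>Where \<open>f\<close> is positive the negative part vanishes, so the equality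
    of measures makes the positive part vanish there as well. The set where \<open>f\<close> is
    negative is treated in the same way.\<close>
  have "AE s in M. indicator {s. f s > 0} s * hn s = 0"
    using fh by eventually_elim (auto simp: indicator_def hn_def)
  then have "(LINT s|M. indicator {s. f s > 0} s * hn s) = 0" by (rule integral_eq_zero_AE)
  then have "(LINT s|M. indicator {s. f s > 0} s * hp s) = 0" using eqA[OF pos(1)] by simp
  then have 1: "AE s in M. indicator {s. f s > 0} s * hp s = 0"
    using ia(1)[OF pos(1)] by (subst (asm) integral_nonneg_eq_0_iff_AE) (auto simp: hp_def)
  have "AE s in M. indicator {s. f s < 0} s * hp s = 0"
    using fh by eventually_elim (auto simp: indicator_def hp_def)
  then have "(LINT s|M. indicator {s. f s < 0} s * hp s) = 0" by (rule integral_eq_zero_AE)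
  then have "(LINT s|M. indicator {s. f s < 0} s * hn s) = 0" using eqA[OF pos(2)] by simp
  then have 2: "AE s in M. indicator {s. f s < 0} s * hn s = 0"
    using ia(2)[OF pos(2)] by (subst (asm) integral_nonneg_eq_0_iff_AE) (auto simp: hn_def)
  show ?thesis using 1 2 fh
    by eventually_elim (auto simp: indicator_def hp_def hn_def max_def split: if_splits)
qed

end

section \<open>Hoelder estimates for the integral of order \<alpha>\<close>

locale frac_space = Lp_interval +
  fixes \<alpha> :: real
  assumes \<alpha>p: "1 / p < \<alpha>" and \<alpha>1: "\<alpha> \<le> 1"
begin

lemma \<alpha>_pos: "\<alpha> > 0"
  using \<alpha>p p by (meson divide_pos_pos less_trans zero_less_one)

abbreviation U where "U \<equiv> RL \<alpha>"

definition conj_exp :: real where "conj_exp = p / (p - 1)"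
text \<open>Equals \<alpha> - 1/p, in the form in which it comes out of the kernel estimate with the
  conjugate exponent. \<open>holder_const\<close> comes from the same estimate, and
  \<open>sup_const\<close> uses in addition that the integral vanishes at 0.\<close>

definition holder_exp :: real where "holder_exp = ((\<alpha> - 1) * conj_exp + 1) / conj_exp"
definition holder_const :: real where
  "holder_const = 1 / Gamma \<alpha> * (2 / ((\<alpha> - 1) * conj_exp + 1)) powr (1 / conj_exp)"
definition sup_const :: real where "sup_const = holder_const * T powr holder_exp"

text \<open>The last inequality is where \<alpha> > 1/p enters: it makes kernels of order \<alpha>
  integrable to the conjugate power.\<close>

lemma conj_exp: "conj_exp > 1" "1 / conj_exp + 1 / p = 1" "(\<alpha> - 1) * conj_exp + 1 > 0"
proof -
  show "conj_exp > 1" "1 / conj_exp + 1 / p = 1" using p by (simp_all add: conj_exp_def field_simps)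
  have "\<alpha> * p > 1" using \<alpha>p p by (simp add: field_simps)
  then have "((\<alpha> - 1) * p + (p - 1)) / (p - 1) > 0" using p by (simp add: algebra_simps)
  moreover have "((\<alpha> - 1) * p + (p - 1)) / (p - 1) = (\<alpha> - 1) * conj_exp + 1"
    using p by (simp add: conj_exp_def add_divide_distrib)
  ultimately show "(\<alpha> - 1) * conj_exp + 1 > 0" by simp
qed

lemma holder_exp_pos: "holder_exp > 0"
  using conj_exp by (simp add: holder_exp_def)

lemma holder_const_pos: "holder_const > 0"
  using conj_exp Gamma_real_pos[OF \<alpha>_pos] by (simp add: holder_const_def)

lemma sup_const_pos: "sup_const > 0"
  using holder_const_pos T by (simp add: sup_const_def)

lemma kernel_diff_bound:
  assumes g: "Lp g" and t: "0 \<le> u" "u \<le> t" "t \<le> T"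
  shows "integrable M (\<lambda>s. (rl_kernel \<alpha> t s - rl_kernel \<alpha> u s) * g s)"
    and "(LINT s|M. \<bar>(rl_kernel \<alpha> t s - rl_kernel \<alpha> u s) * g s\<bar>)
       \<le> (2 / ((\<alpha> - 1) * conj_exp + 1)) powr (1 / conj_exp) * (t - u) powr holder_exp * nrm g"
proof -
  let ?e = "(\<alpha> - 1) * conj_exp + 1"
  have q: "conj_exp \<ge> 1" using conj_exp by simp
  note d = rl_kernel_diff[OF q \<alpha>1 refl conj_exp(3) t]
  note h = hoelder_inequality[OF conj_exp(1) p conj_exp(2) _ d(1) Lp_D[OF g]]
  show "integrable M (\<lambda>s. (rl_kernel \<alpha> t s - rl_kernel \<alpha> u s) * g s)" by (rule h(1)) measurable
  have "(LINT s|M. \<bar>(rl_kernel \<alpha> t s - rl_kernel \<alpha> u s) * g s\<bar>)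
      \<le> (LINT s|M. \<bar>rl_kernel \<alpha> t s - rl_kernel \<alpha> u s\<bar> powr conj_exp) powr (1 / conj_exp) * nrm g"
    unfolding Lp_norm_def by (rule h(2)) measurable
  also have "\<dots> \<le> (2 * ((t - u) powr ?e / ?e)) powr (1 / conj_exp) * nrm g"
    by (intro mult_right_mono powr_mono2 d(2)) (use q in auto)
  also have "2 * ((t - u) powr ?e / ?e) = 2 / ?e * (t - u) powr ?e" by simp
  also have "(2 / ?e * (t - u) powr ?e) powr (1 / conj_exp) = (2 / ?e) powr (1 / conj_exp) * (t - u) powr holder_exp"
    by (subst powr_mult) (simp add: powr_powr holder_exp_def)
  finally show "(LINT s|M. \<bar>(rl_kernel \<alpha> t s - rl_kernel \<alpha> u s) * g s\<bar>)
       \<le> (2 / ?e) powr (1 / conj_exp) * (t - u) powr holder_exp * nrm g" .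
qed

lemma kernel_integrable:
  assumes g: "Lp g" and t: "t \<in> {0..T}"
  shows "integrable M (\<lambda>s. rl_kernel \<alpha> t s * g s)"
proof -
  \<comment> \<open>The kernel with first argument 0 vanishes on the interval, so a single kernel is
    a special difference.\<close>
  have "integrable M (\<lambda>s. (rl_kernel \<alpha> t s - rl_kernel \<alpha> 0 s) * g s)"
    using t by (intro kernel_diff_bound(1)[OF g]) auto
  then show ?thesis
    by (rule Bochner_Integration.integrable_cong[THEN iffD1, OF refl, rotated]) (auto simp: rl_kernel_def)
qed

lemma U_linear:
  assumes "Lp f" "Lp g" "t \<in> {0..T}"
  shows "U (\<lambda>s. c * f s + d * g s) t = c * U f t + d * U g t"
proof -
  have "(LINT s|M. rl_kernel \<alpha> t s * (c * f s + d * g s)) =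
      (LINT s|M. c * (rl_kernel \<alpha> t s * f s) + d * (rl_kernel \<alpha> t s * g s))"
    by (rule Bochner_Integration.integral_cong) (auto simp: algebra_simps)
  then show ?thesis
    using kernel_integrable[OF assms(1,3)] kernel_integrable[OF assms(2,3)]
    by (simp add: RL_def add_divide_distrib)
qed

lemma U_add: "Lp f \<Longrightarrow> Lp g \<Longrightarrow> t \<in> {0..T} \<Longrightarrow> U (\<lambda>s. f s + g s) t = U f t + U g t"
  using U_linear[of f g t 1 1] by simp

lemma U_diff: "Lp f \<Longrightarrow> Lp g \<Longrightarrow> t \<in> {0..T} \<Longrightarrow> U (\<lambda>s. f s - g s) t = U f t - U g t"
  using U_linear[of f g t 1 "-1"] by simp

lemma U_scale: "Lp f \<Longrightarrow> t \<in> {0..T} \<Longrightarrow> U (\<lambda>s. c * f s) t = c * U f t"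
  using U_linear[of f f t c 0] by simp

lemma U_holder:
  assumes g: "Lp g" and tu: "t \<in> {0..T}" "u \<in> {0..T}"
  shows "\<bar>U g t - U g u\<bar> \<le> holder_const * \<bar>t - u\<bar> powr holder_exp * nrm g"
proof -
  have *: "\<bar>U g t - U g u\<bar> \<le> holder_const * \<bar>t - u\<bar> powr holder_exp * nrm g"
    if "t \<in> {0..T}" "u \<in> {0..T}" "u \<le> t" for t u
  proof -
    have Ga: "Gamma \<alpha> > 0" by (rule Gamma_real_pos[OF \<alpha>_pos])
    have "U g t - U g u = 1 / Gamma \<alpha> * (LINT s|M. (rl_kernel \<alpha> t s - rl_kernel \<alpha> u s) * g s)"
      unfolding RL_def using kernel_integrable[OF g that(1)] kernel_integrable[OF g that(2)]
      by (simp add: left_diff_distrib diff_divide_distrib)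
    then have "\<bar>U g t - U g u\<bar> = 1 / Gamma \<alpha> * \<bar>LINT s|M. (rl_kernel \<alpha> t s - rl_kernel \<alpha> u s) * g s\<bar>"
      using Ga by (simp add: abs_mult)
    also have "\<dots> \<le> 1 / Gamma \<alpha> * ((2 / ((\<alpha> - 1) * conj_exp + 1)) powr (1 / conj_exp) * (t - u) powr holder_exp * nrm g)"
      using Ga that by (intro mult_left_mono order_trans[OF integral_abs_bound] kernel_diff_bound(2)[OF g]) auto
    finally show ?thesis using that by (simp add: holder_const_def mult.assoc)
  qed
  show ?thesis using *[of t u] *[of u t] tu by (cases "u \<le> t") (auto simp: abs_minus_commute)
qed

lemma U_0: "U g 0 = 0"
  by (rule RL_at_0)

lemma U_bound:
  assumes g: "Lp g" and t: "t \<in> {0..T}"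
  shows "\<bar>U g t\<bar> \<le> sup_const * nrm g"
proof -
  have "\<bar>U g t\<bar> \<le> holder_const * t powr holder_exp * nrm g"
    using U_holder[OF g t, of 0] T t by (simp add: U_0)
  also have "\<dots> \<le> holder_const * T powr holder_exp * nrm g"
    using t holder_exp_pos holder_const_pos by (intro mult_right_mono mult_left_mono powr_mono2) auto
  finally show ?thesis by (simp add: sup_const_def)
qed

lemma U_equicontinuous:
  assumes "B > 0" "\<epsilon> > 0"
  obtains \<delta> where "\<delta> > 0"
    "\<And>g t u. Lp g \<Longrightarrow> nrm g \<le> B \<Longrightarrow> t \<in> {0..T} \<Longrightarrow> u \<in> {0..T} \<Longrightarrow> \<bar>t - u\<bar> < \<delta> \<Longrightarrow> \<bar>U g t - U g u\<bar> < \<epsilon>"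
proof -
  define c where "c = holder_const * B"
  have c: "c > 0" using assms holder_const_pos by (simp add: c_def)
  define \<delta> where "\<delta> = (\<epsilon> / c) powr (1 / holder_exp)"
  have d: "\<delta> > 0" "\<delta> powr holder_exp = \<epsilon> / c"
    using assms c holder_exp_pos by (simp_all add: \<delta>_def powr_powr)
  show thesis
  proof (rule that[OF d(1)])
    fix g t u assume g: "Lp g" "nrm g \<le> B" "t \<in> {0..T}" "u \<in> {0..T}" "\<bar>t - u\<bar> < \<delta>"
    have "\<bar>U g t - U g u\<bar> \<le> holder_const * \<bar>t - u\<bar> powr holder_exp * nrm g" by (rule U_holder) fact+
    also have "\<dots> \<le> holder_const * \<bar>t - u\<bar> powr holder_exp * B"
      using g holder_const_pos by (intro mult_left_mono) auto
    also have "\<dots> = c * \<bar>t - u\<bar> powr holder_exp" by (simp add: c_def mult_ac)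
    also have "\<dots> < c * \<delta> powr holder_exp"
      using c g holder_exp_pos by (intro mult_strict_left_mono powr_less_mono2) auto
    finally show "\<bar>U g t - U g u\<bar> < \<epsilon>" using d c by simp
  qed
qed

lemma U_continuous:
  assumes g: "Lp g" shows "continuous_on {0..T} (U g)"
  unfolding continuous_on_iff
proof (intro ballI allI impI)
  fix x e :: real assume x: "x \<in> {0..T}" and e: "e > 0"
  obtain d where d: "d > 0" "\<And>g' t u. Lp g' \<Longrightarrow> nrm g' \<le> nrm g + 1 \<Longrightarrow> t \<in> {0..T} \<Longrightarrow> u \<in> {0..T} \<Longrightarrow>
      \<bar>t - u\<bar> < d \<Longrightarrow> \<bar>U g' t - U g' u\<bar> < e"
    using U_equicontinuous[of "nrm g + 1" e] e nrm_nonneg[of g] by (metis add_nonneg_pos zero_less_one)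
  show "\<exists>d>0. \<forall>y\<in>{0..T}. dist y x < d \<longrightarrow> dist (U g y) (U g x) < e"
    using d g x by (auto simp: dist_real_def)
qed

text \<open>Applying order 1 - \<alpha> to the vanishing integral of order \<alpha> gives, by the
  semigroup law, a vanishing integral of order 1. Injectivity is thereby reduced to that of ordinary
  integration.\<close>

lemma U_inj:
  assumes f: "Lp f" and g: "Lp g" and eq: "\<And>t. t \<in> {0..T} \<Longrightarrow> U f t = U g t"
  shows "AE s in M. f s = g s"
proof -
  define h where "h s = f s - g s" for s
  have h: "Lp h" unfolding h_def using f g by (rule Lp_diff)
  have Uh: "U h t = 0" if "t \<in> {0..T}" for t
    using U_diff[OF f g that] eq[OF that] by (simp add: h_def[abs_def])
  have "RL 1 h t = 0" if t: "t \<in> {0..T}" for t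
  proof (cases "\<alpha> = 1")
    case True
    then show ?thesis using Uh[OF t] by simp
  next
    case False
    then have "RL (1 - \<alpha>) (U h) t = RL (1 - \<alpha> + \<alpha>) h t"
      using \<alpha>_pos \<alpha>1 t Lp_integrable(1)[OF h] by (intro RL_semigroup) auto
    moreover have "(LINT s|M. rl_kernel (1 - \<alpha>) t s * U h s) = (LINT s|M. 0)"
      by (rule Bochner_Integration.integral_cong) (auto simp: Uh)
    ultimately show ?thesis by (simp add: RL_def[of "1 - \<alpha>"])
  qed
  then have "AE s in M. h s = 0" by (rule AE_zero_of_RL_1[OF Lp_integrable(1)[OF h]])
  then show ?thesis by eventually_elim (simp add: h_def)
qed

lemma test_function:
  assumes w: "w \<in> C0_infinity T"
  shows "Lp (RL_deriv \<alpha> w)" "\<And>t. t \<in> {0..T} \<Longrightarrow> w t = U (RL_deriv \<alpha> w) t" "w T = 0" "continuous_on {0..T} w"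
proof -
  obtain v where v: "continuous_on {0..T} v" "\<And>t. t \<in> {0<..<T} \<Longrightarrow> RL_deriv \<alpha> w t = v t"
    "\<And>t. t \<in> {0..T} \<Longrightarrow> w t = U v t"
    using C0_infinity_deriv[OF w \<alpha>_pos \<alpha>1] by metis
  have ae: "AE s in M. v s = RL_deriv \<alpha> w s"
    using AE_M_neq[of 0] AE_M_neq[of T] AE_space by eventually_elim (auto simp: v(2))
  have m: "RL_deriv \<alpha> w \<in> borel_measurable M"
  proof -
    \<comment> \<open>The end points are listed separately because nothing is known about
      \<open>deriv\<close> there.\<close>
    have "(\<lambda>s. if s \<in> {0<..<T} then v s else if s = 0 then RL_deriv \<alpha> w 0 else RL_deriv \<alpha> w T) \<in> borel_measurable M"
      using continuous_imp_M[OF v(1)] by measurable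
    then show ?thesis by (rule measurable_cong[THEN iffD1, rotated]) (auto simp: v(2))
  qed
  show "Lp (RL_deriv \<alpha> w)" by (rule Lp_cong_AE(1)[OF continuous_Lp[OF v(1)] m ae])
  show "w t = U (RL_deriv \<alpha> w) t" if "t \<in> {0..T}" for t
    using v(3)[OF that] RL_cong_AE[OF ae continuous_imp_M[OF v(1)] m] by simp
  show "w T = 0" using w by (simp add: C0_infinity_def)
  show "continuous_on {0..T} w"
    by (rule continuous_on_eq[OF U_continuous[OF continuous_Lp[OF v(1)]]]) (simp add: v(3))
qed

section \<open>The closure of the derivatives of test functions\<close>

definition G :: "(real \<Rightarrow> real) set" where
  "G = {g. Lp g \<and> (\<forall>e>0. \<exists>w\<in>C0_infinity T. nrm (\<lambda>t. RL_deriv \<alpha> w t - g t) < e)}"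

lemma G_Lp: "g \<in> G \<Longrightarrow> Lp g"
  by (simp add: G_def)

lemma G_closed:
  assumes g: "Lp g" and apx: "\<And>e. e > 0 \<Longrightarrow> \<exists>h\<in>G. nrm (\<lambda>t. h t - g t) < e"
  shows "g \<in> G"
  unfolding G_def
proof (intro CollectI conjI allI impI g)
  fix e :: real assume "e > 0"
  then obtain h where h: "h \<in> G" "nrm (\<lambda>t. h t - g t) < e / 2" using apx[of "e / 2"] by auto
  then obtain w where w: "w \<in> C0_infinity T" "nrm (\<lambda>t. RL_deriv \<alpha> w t - h t) < e / 2"
    using \<open>e > 0\<close> by (auto simp: G_def dest!: spec[of _ "e / 2"])
  have "nrm (\<lambda>t. RL_deriv \<alpha> w t - g t) \<le> nrm (\<lambda>t. RL_deriv \<alpha> w t - h t) + nrm (\<lambda>t. h t - g t)"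
    using test_function[OF w(1)] G_Lp[OF h(1)] g by (intro nrm_triangle)
  then show "\<exists>w\<in>C0_infinity T. nrm (\<lambda>t. RL_deriv \<alpha> w t - g t) < e" using w h by force
qed

text \<open>Both sides have the same integral of order \<alpha>, so injectivity of \<open>U\<close>
  applies and no differentiability at individual points has to be discussed.\<close>

lemma RL_deriv_linear:
  assumes v: "v \<in> C0_infinity T" and w: "w \<in> C0_infinity T"
  shows "AE s in M. RL_deriv \<alpha> (\<lambda>t. c * v t + e * w t) s = c * RL_deriv \<alpha> v s + e * RL_deriv \<alpha> w s"
proof (rule U_inj)
  note x = test_function[OF C0_infinity_linear[OF v w, of c e]]
  show "Lp (RL_deriv \<alpha> (\<lambda>t. c * v t + e * w t))" by (rule x)
  show "Lp (\<lambda>s. c * RL_deriv \<alpha> v s + e * RL_deriv \<alpha> w s)"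
    using test_function(1)[OF v] test_function(1)[OF w] by (intro Lp_add Lp_scale)
  fix t assume t: "t \<in> {0..T}"
  show "U (RL_deriv \<alpha> (\<lambda>t. c * v t + e * w t)) t = U (\<lambda>s. c * RL_deriv \<alpha> v s + e * RL_deriv \<alpha> w s) t"
    using x(2)[OF t] test_function(2)[OF v t] test_function(2)[OF w t]
      U_linear[OF test_function(1)[OF v] test_function(1)[OF w] t] by simp
qed

lemma G_linear:
  assumes f: "f \<in> G" and g: "g \<in> G"
  shows "(\<lambda>t. c * f t + d * g t) \<in> G"
  unfolding G_def
proof (intro CollectI conjI allI impI)
  show L: "Lp (\<lambda>t. c * f t + d * g t)" using G_Lp[OF f] G_Lp[OF g] by (intro Lp_add Lp_scale)
  fix e :: real assume e: "e > 0"
  \<comment> \<open>The summand 1 keeps \<open>K\<close> positive when both coefficients vanish and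
    makes the final estimate strict.\<close>
  define K where "K = \<bar>c\<bar> + \<bar>d\<bar> + 1"
  have K: "K > 0" "\<bar>c\<bar> + \<bar>d\<bar> < K" by (auto simp: K_def)
  obtain v where v: "v \<in> C0_infinity T" "nrm (\<lambda>t. RL_deriv \<alpha> v t - f t) < e / K"
    using f e K by (auto simp: G_def dest!: spec[of _ "e / K"])
  obtain w where w: "w \<in> C0_infinity T" "nrm (\<lambda>t. RL_deriv \<alpha> w t - g t) < e / K"
    using g e K by (auto simp: G_def dest!: spec[of _ "e / K"])
  let ?x = "\<lambda>t. c * v t + d * w t"
  have Lv: "Lp (\<lambda>t. RL_deriv \<alpha> v t - f t)" "Lp (\<lambda>t. RL_deriv \<alpha> w t - g t)"
    using test_function(1) v w G_Lp f g by (auto intro!: Lp_diff)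
  have Lx: "Lp (\<lambda>t. c * (RL_deriv \<alpha> v t - f t) + d * (RL_deriv \<alpha> w t - g t))"
    using Lv by (intro Lp_add Lp_scale)
  have "nrm (\<lambda>t. RL_deriv \<alpha> ?x t - (c * f t + d * g t)) =
      nrm (\<lambda>t. c * (RL_deriv \<alpha> v t - f t) + d * (RL_deriv \<alpha> w t - g t))"
  proof (rule Lp_cong_AE(2)[OF Lx])
    show "(\<lambda>t. RL_deriv \<alpha> ?x t - (c * f t + d * g t)) \<in> borel_measurable M"
      using Lp_D(1)[OF test_function(1)[OF C0_infinity_linear[OF v(1) w(1), of c d]]] Lp_D(1)[OF L]
      by (rule borel_measurable_diff)
    show "AE t in M. c * (RL_deriv \<alpha> v t - f t) + d * (RL_deriv \<alpha> w t - g t) = RL_deriv \<alpha> ?x t - (c * f t + d * g t)"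
      using RL_deriv_linear[OF v(1) w(1), of c d] by eventually_elim (simp add: algebra_simps)
  qed
  also have "\<dots> \<le> \<bar>c\<bar> * nrm (\<lambda>t. RL_deriv \<alpha> v t - f t) + \<bar>d\<bar> * nrm (\<lambda>t. RL_deriv \<alpha> w t - g t)"
    using minkowski[OF Lp_scale[OF Lv(1), of c] Lp_scale[OF Lv(2), of d]] by (simp add: nrm_scale)
  also have "\<dots> \<le> \<bar>c\<bar> * (e / K) + \<bar>d\<bar> * (e / K)"
    using v w by (intro add_mono mult_left_mono) auto
  also have "\<dots> = (\<bar>c\<bar> + \<bar>d\<bar>) * (e / K)" by (rule distrib_right[symmetric])
  also have "\<dots> < K * (e / K)" using K e by (intro mult_strict_right_mono) auto
  also have "\<dots> = e" using K by simp
  finally show "\<exists>w\<in>C0_infinity T. nrm (\<lambda>t. RL_deriv \<alpha> w t - (c * f t + d * g t)) < e"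
    using C0_infinity_linear[OF v(1) w(1)] by blast
qed

lemma test_function_G: "w \<in> C0_infinity T \<Longrightarrow> RL_deriv \<alpha> w \<in> G"
  unfolding G_def using test_function(1) by (auto intro!: bexI[of _ w] simp: Lp_norm_def)

lemma G_0: "(\<lambda>t. 0) \<in> G"
proof -
  have "(\<lambda>t. 0) \<in> C0_infinity T"
    unfolding C0_infinity_def by (auto intro!: exI[of _ "\<lambda>k t. 0"])
  then show ?thesis using G_linear[OF test_function_G test_function_G, of _ _ 0 0] by simp
qed

sublocale G: seminormed_subspace G nrm
proof
  show "subspace G"
  proof (rule subspaceI)
    show "0 \<in> G" using G_0 by (simp add: zero_fun_def)
    show "x + y \<in> G" if "x \<in> G" "y \<in> G" for x y
      using G_linear[OF that, of 1 1] by (simp add: plus_fun_def)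
    show "c *\<^sub>R x \<in> G" if "x \<in> G" for c x
      using G_linear[OF that that, of c 0] by (simp add: scaleR_fun_def)
  qed
  show "nrm (x + y) \<le> nrm x + nrm y" if "x \<in> G" "y \<in> G" for x y
    using minkowski[of x y] that G_Lp by (simp add: plus_fun_def)
  show "nrm (c *\<^sub>R x) = \<bar>c\<bar> * nrm x" for c x
    using nrm_scale[of c x] by (simp add: scaleR_fun_def)
qed simp

lemma G_complete:
  assumes s: "\<And>n. s n \<in> G"
    and cauchy: "\<And>e. e > 0 \<Longrightarrow> \<exists>N. \<forall>m\<ge>N. \<forall>n\<ge>N. nrm (s m - s n) < e"
  obtains g where "g \<in> G" "(\<lambda>n. nrm (s n - g)) \<longlonglongrightarrow> 0"
proof -
  obtain g where g: "Lp g" "(\<lambda>n. nrm (\<lambda>t. s n t - g t)) \<longlonglongrightarrow> 0"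
  proof (rule Lp_complete[of s])
    show "Lp (s n)" for n by (rule G_Lp[OF s])
    show "\<exists>N. \<forall>m\<ge>N. \<forall>n\<ge>N. nrm (\<lambda>t. s m t - s n t) < e" if "e > 0" for e
      using cauchy[OF that] by (simp only: fun_diff_def)
  qed
  have "g \<in> G"
  proof (rule G_closed[OF g(1)])
    fix e :: real assume "e > 0"
    then obtain n where "nrm (\<lambda>t. s n t - g t) < e"
      using LIMSEQ_D[OF g(2), of e] by fastforce
    then show "\<exists>h\<in>G. nrm (\<lambda>t. h t - g t) < e" using s by blast
  qed
  then show thesis using that g(2) by (simp add: fun_diff_def)
qed

text \<open>Evaluation at \<open>T\<close> is continuous for \<open>nrm\<close> by
  \<open>U_bound\<close> and vanishes on test functions. At 0 the integral vanishes for every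
  function; at \<open>T\<close> this is a property of the closure \<open>G\<close>.\<close>

lemma U_T: assumes g: "g \<in> G" shows "U g T = 0"
proof (rule ccontr)
  assume "U g T \<noteq> 0"
  then have pos: "\<bar>U g T\<bar> / sup_const > 0" using sup_const_pos by simp
  then obtain w where w: "w \<in> C0_infinity T" "nrm (\<lambda>t. RL_deriv \<alpha> w t - g t) < \<bar>U g T\<bar> / sup_const"
    using g unfolding G_def by blast
  have TT: "T \<in> {0..T}" using T by simp
  have "\<bar>U (\<lambda>t. RL_deriv \<alpha> w t - g t) T\<bar> \<le> sup_const * nrm (\<lambda>t. RL_deriv \<alpha> w t - g t)"
    using test_function(1)[OF w(1)] G_Lp[OF g] TT by (intro U_bound Lp_diff)
  also have "\<dots> < \<bar>U g T\<bar>" using w(2) sup_const_pos by (simp add: pos_less_divide_eq mult.commute)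
  finally show False
    using U_diff[OF test_function(1)[OF w(1)] G_Lp[OF g] TT] test_function(2)[OF w(1) TT] test_function(3)[OF w(1)]
    by simp
qed

section \<open>Identification with the space of the problem\<close>

lemma continuous_zero:
  assumes f: "continuous_on {0..T} f" and z: "nrm f = 0" and t: "t \<in> {0..T}"
  shows "f t = 0"
proof -
  have c: "continuous_on {0..T} (\<lambda>t. \<bar>f t\<bar>)" using f by (intro continuous_intros)
  have "AE t in M. \<bar>f t\<bar> = 0" using nrm_eq_0_AE[OF continuous_Lp[OF f] z] by eventually_elim simp
  then have "(LINT t|M. \<bar>f t\<bar>) = 0" by (rule integral_eq_zero_AE)
  then have "integral {0..T} (\<lambda>t. \<bar>f t\<bar>) = 0"
    using lebesgue_integral_eq_integral[OF Lp_integrable(1)[OF continuous_Lp[OF c]]] by simp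
  then have "((\<lambda>t. \<bar>f t\<bar>) has_integral 0) (cbox 0 T)"
    using integrable_continuous_real[OF c] by (metis box_real(2) has_integral_integral)
  then have "\<bar>f t\<bar> = 0"
    using t T by (intro has_integral_0_cbox_imp_0[of 0 T "\<lambda>t. \<bar>f t\<bar>"]) (auto simp: c)
  then show ?thesis by simp
qed

text \<open>Both \<open>u\<close> and \<open>U g\<close> are L^p-limits of the test functions
  \<open>w n\<close>: the second because each \<open>w n\<close> is the integral of its own
  derivative and \<open>U\<close> is bounded into the supremum norm. Continuous functions at
  L^p-distance 0 agree everywhere on the interval.\<close>

lemma has_frac_deriv_imp:
  assumes h: "has_frac_deriv \<alpha> p T u g" and c: "continuous_on {0..T} u"
  shows "g \<in> G" "\<And>t. t \<in> {0..T} \<Longrightarrow> u t = U g t"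
proof -
  from h obtain w where u: "Lp u" and g: "Lp g" and w: "\<And>n. w n \<in> C0_infinity T"
    and lim: "(\<lambda>n. (nrm (\<lambda>t. w n t - u t) powr p + nrm (\<lambda>t. RL_deriv \<alpha> (w n) t - g t) powr p) powr (1 / p)) \<longlonglongrightarrow> 0"
    unfolding has_frac_deriv_def by blast
  have p_pos: "p > 0" using p by simp
  note l = powr_sum_tendsto_0[OF p_pos _ _ lim, simplified]
  show "g \<in> G"
    unfolding G_def
  proof (intro CollectI conjI allI impI g)
    fix e :: real assume "e > 0"
    then obtain n where "nrm (\<lambda>t. RL_deriv \<alpha> (w n) t - g t) < e" using LIMSEQ_D[OF l(2), of e] by fastforce
    then show "\<exists>w\<in>C0_infinity T. nrm (\<lambda>t. RL_deriv \<alpha> w t - g t) < e" using w by blast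
  qed
  have wL: "Lp (w n)" for n using continuous_Lp[OF test_function(4)[OF w]] .
  have UL: "Lp (U g)" using continuous_Lp[OF U_continuous[OF g]] .
  have b: "nrm (\<lambda>t. u t - U g t) \<le> nrm (\<lambda>t. w n t - u t) + T powr (1 / p) * (sup_const * nrm (\<lambda>t. RL_deriv \<alpha> (w n) t - g t))" for n
  proof -
    note x = test_function[OF w[of n]]
    have "nrm (\<lambda>t. w n t - U g t) \<le> T powr (1 / p) * (sup_const * nrm (\<lambda>t. RL_deriv \<alpha> (w n) t - g t))"
    proof (rule Lp_bounded(2))
      show "(\<lambda>t. w n t - U g t) \<in> borel_measurable M" using wL UL by (intro borel_measurable_diff) auto
      fix t assume t: "t \<in> {0..T}"
      show "\<bar>w n t - U g t\<bar> \<le> sup_const * nrm (\<lambda>t. RL_deriv \<alpha> (w n) t - g t)"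
        using U_bound[OF Lp_diff[OF x(1) g] t] U_diff[OF x(1) g t] x(2)[OF t] by simp
    qed
    then show ?thesis
      using nrm_triangle[OF u wL[of n] UL] nrm_minus_commute[of u "w n"] by linarith
  qed
  have "(\<lambda>n. nrm (\<lambda>t. w n t - u t) + T powr (1 / p) * (sup_const * nrm (\<lambda>t. RL_deriv \<alpha> (w n) t - g t))) \<longlonglongrightarrow> 0 + T powr (1 / p) * (sup_const * 0)"
    by (intro tendsto_intros l)
  then have "nrm (\<lambda>t. u t - U g t) \<le> 0"
    using b by (intro LIMSEQ_le_const) auto
  then have "nrm (\<lambda>t. u t - U g t) = 0" using nrm_nonneg[of "\<lambda>t. u t - U g t"] by linarith
  moreover have "continuous_on {0..T} (\<lambda>t. u t - U g t)" by (intro continuous_on_diff c U_continuous g)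
  ultimately show "u t = U g t" if "t \<in> {0..T}" for t
    using continuous_zero[OF _ _ that, of "\<lambda>t. u t - U g t"] by simp
qed

lemma has_frac_derivI:
  assumes g: "g \<in> G" and u: "\<And>t. t \<in> {0..T} \<Longrightarrow> u t = U g t"
  shows "has_frac_deriv \<alpha> p T u g"
proof -
  have gL: "Lp g" by (rule G_Lp[OF g])
  have uL: "Lp u" using continuous_Lp[OF U_continuous[OF gL]] Lp_cong[of u "U g"] u by simp
  have "\<exists>w. w \<in> C0_infinity T \<and> nrm (\<lambda>t. RL_deriv \<alpha> w t - g t) < 1 / real (Suc n)" for n
  proof -
    have "1 / real (Suc n) > 0" by simp
    then show ?thesis using g unfolding G_def by blast
  qed
  then obtain w where w: "\<And>n. w n \<in> C0_infinity T" and wn: "\<And>n. nrm (\<lambda>t. RL_deriv \<alpha> (w n) t - g t) < 1 / real (Suc n)"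
    by metis
  have l2: "(\<lambda>n. nrm (\<lambda>t. RL_deriv \<alpha> (w n) t - g t)) \<longlonglongrightarrow> 0"
    by (rule tendsto_sandwich[OF _ _ tendsto_const LIMSEQ_inverse_real_of_nat])
       (use wn in \<open>auto intro!: less_imp_le always_eventually simp: inverse_eq_divide\<close>)
  have b: "nrm (\<lambda>t. w n t - u t) \<le> T powr (1 / p) * (sup_const * nrm (\<lambda>t. RL_deriv \<alpha> (w n) t - g t))" for n
  proof (rule Lp_bounded(2))
    note x = test_function[OF w[of n]]
    show "(\<lambda>t. w n t - u t) \<in> borel_measurable M" using continuous_Lp[OF x(4)] uL by (intro borel_measurable_diff) auto
    fix t assume t: "t \<in> {0..T}"
    show "\<bar>w n t - u t\<bar> \<le> sup_const * nrm (\<lambda>t. RL_deriv \<alpha> (w n) t - g t)"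
      using U_bound[OF Lp_diff[OF x(1) gL] t] U_diff[OF x(1) gL t] x(2)[OF t] u[OF t] by simp
  qed
  have l1: "(\<lambda>n. nrm (\<lambda>t. w n t - u t)) \<longlonglongrightarrow> 0"
  proof (rule tendsto_sandwich[OF _ _ tendsto_const])
    show "(\<lambda>n. T powr (1 / p) * (sup_const * nrm (\<lambda>t. RL_deriv \<alpha> (w n) t - g t))) \<longlonglongrightarrow> 0"
      using tendsto_mult_left[OF tendsto_mult_left[OF l2]] by simp
  qed (use b in auto)
  have "(\<lambda>n. (nrm (\<lambda>t. w n t - u t) powr p + nrm (\<lambda>t. RL_deriv \<alpha> (w n) t - g t) powr p) powr (1 / p))
      \<longlonglongrightarrow> (0 powr p + 0 powr p) powr (1 / p)"
    using p by (intro tendsto_powr' tendsto_add l1 l2) (auto intro!: always_eventually add_nonneg_nonneg tendsto_eq_intros)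
  then show ?thesis unfolding has_frac_deriv_def using uL gL w by auto
qed

text \<open>The dictionary that allows the energy to be studied on \<open>G\<close> and its critical
  points to be transferred back.\<close>

lemma E0_iff: "u \<in> E0 \<alpha> p T \<longleftrightarrow> (\<exists>g\<in>G. \<forall>t\<in>{0..T}. u t = U g t)"
proof
  assume "u \<in> E0 \<alpha> p T"
  then show "\<exists>g\<in>G. \<forall>t\<in>{0..T}. u t = U g t" unfolding E0_def using has_frac_deriv_imp by blast
next
  assume "\<exists>g\<in>G. \<forall>t\<in>{0..T}. u t = U g t"
  then obtain g where g: "g \<in> G" "\<And>t. t \<in> {0..T} \<Longrightarrow> u t = U g t" by blast
  have "continuous_on {0..T} u" by (rule continuous_on_eq[OF U_continuous[OF G_Lp[OF g(1)]]]) (simp add: g(2))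
  then show "u \<in> E0 \<alpha> p T" unfolding E0_def using has_frac_derivI[OF g] by blast
qed

text \<open>\<open>frac_D\<close> picks some derivative. By injectivity of \<open>U\<close> all
  choices agree almost everywhere, so the norm does not depend on the choice.\<close>

lemma E_norm_eq:
  assumes g: "g \<in> G" and u: "\<And>t. t \<in> {0..T} \<Longrightarrow> u t = U g t"
  shows "E_norm \<alpha> p T u = nrm g"
proof -
  have cont: "continuous_on {0..T} u" by (rule continuous_on_eq[OF U_continuous[OF G_Lp[OF g]]]) (simp add: u)
  have "has_frac_deriv \<alpha> p T u (frac_D \<alpha> p T u)"
    unfolding frac_D_def by (rule someI[of _ g]) (rule has_frac_derivI[OF g u])
  note d = has_frac_deriv_imp[OF this cont]
  have "AE s in M. g s = frac_D \<alpha> p T u s"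
    by (rule U_inj) (use G_Lp[OF d(1)] G_Lp[OF g] d(2) u in auto)
  then show ?thesis unfolding E_norm_def
    using Lp_cong_AE(2)[OF G_Lp[OF g]] G_Lp[OF d(1)] by auto
qed

text \<open>The parabola is positive inside the interval. It supplies the ray for the mountain pass
  and, in the compactness argument, a direction of positive norm.\<close>

lemma G_nontrivial:
  obtains g where "g \<in> G" "\<And>t. t \<in> {0..T} \<Longrightarrow> U g t = t * (T - t)"
proof -
  define d where "d k t = (if k = 0 then t * (T - t) else if k = 1 then T - 2 * t else if k = 2 then - 2 else 0)"
    for k :: nat and t :: real
  have "(d k has_real_derivative d (Suc k) t) (at t within {0..T})" for k t
  proof -
    have e: "d 0 = (\<lambda>t. t * (T - t))" "d (Suc 0) = (\<lambda>t. T - 2 * t)" "d (Suc (Suc 0)) = (\<lambda>t. - 2)"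
      "d (Suc (Suc (Suc j))) = (\<lambda>t. 0)" for j by (simp_all add: d_def fun_eq_iff)
    consider "k = 0" | "k = Suc 0" | "k = Suc (Suc 0)" | j where "k = Suc (Suc (Suc j))"
      by (metis not0_implies_Suc)
    then show ?thesis
      by cases (simp_all only: e, auto intro!: derivative_eq_intros)
  qed
  then have w: "(\<lambda>t. t * (T - t)) \<in> C0_infinity T"
    unfolding C0_infinity_def mem_Collect_eq by (intro conjI exI[of _ d]) (auto simp: d_def)
  show thesis using that[OF test_function_G[OF w]] test_function(2)[OF w] by simp
qed

end

section \<open>The energy as a functional of the fractional derivative\<close>

lemma uniformly_differentiableE:
  assumes "uniformly_differentiable X N J D" "\<epsilon> > 0"
  obtains \<delta> where "\<delta> > 0" "\<And>x v. x \<in> X \<Longrightarrow> v \<in> X \<Longrightarrow> N x \<le> M \<Longrightarrow> N v \<le> \<delta> \<Longrightarrow>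
    \<bar>J (x + v) - J x - D x v\<bar> \<le> \<epsilon> * N v"
proof -
  have "\<exists>\<delta>>0. \<forall>x\<in>X. \<forall>v\<in>X. N x \<le> M \<longrightarrow> N v \<le> \<delta> \<longrightarrow> \<bar>J (x + v) - J x - D x v\<bar> \<le> \<epsilon> * N v"
    using assms(1)[unfolded uniformly_differentiable_def, THEN spec, THEN spec, THEN mp, OF assms(2)] .
  then show thesis using that by blast
qed

lemma locally_bounded_formE:
  assumes "locally_bounded_form X N D"
  obtains L where "L \<ge> 0" "\<And>x v. x \<in> X \<Longrightarrow> v \<in> X \<Longrightarrow> N x \<le> M \<Longrightarrow> \<bar>D x v\<bar> \<le> L * N v"
proof -
  have "\<exists>L\<ge>0. \<forall>x\<in>X. \<forall>v\<in>X. N x \<le> M \<longrightarrow> \<bar>D x v\<bar> \<le> L * N v"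
    using assms[unfolded locally_bounded_form_def, THEN spec] .
  then show thesis using that by blast
qed

lemma mult_half_divide: "c > 0 \<Longrightarrow> c * (e / (2 * c)) = e / (2 :: real)"
  by simp

context seminormed_subspace
begin

lemma uniformly_differentiable_diff:
  assumes "uniformly_differentiable X N J1 D1" "uniformly_differentiable X N J2 D2"
  shows "uniformly_differentiable X N (\<lambda>x. J1 x - J2 x - c) (\<lambda>x v. D1 x v - D2 x v)"
  unfolding uniformly_differentiable_def
proof (intro allI impI)
  fix M \<epsilon> :: real assume "\<epsilon> > 0"
  then have e: "\<epsilon> / 2 > 0" by simp
  obtain d1 where d1: "d1 > 0" "\<And>x v. x \<in> X \<Longrightarrow> v \<in> X \<Longrightarrow> N x \<le> M \<Longrightarrow> N v \<le> d1 \<Longrightarrow> \<bar>J1 (x + v) - J1 x - D1 x v\<bar> \<le> \<epsilon> / 2 * N v"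
    by (fact uniformly_differentiableE[OF assms(1) e, where M = M])
  obtain d2 where d2: "d2 > 0" "\<And>x v. x \<in> X \<Longrightarrow> v \<in> X \<Longrightarrow> N x \<le> M \<Longrightarrow> N v \<le> d2 \<Longrightarrow> \<bar>J2 (x + v) - J2 x - D2 x v\<bar> \<le> \<epsilon> / 2 * N v"
    by (fact uniformly_differentiableE[OF assms(2) e, where M = M])
  show "\<exists>\<delta>>0. \<forall>x\<in>X. \<forall>v\<in>X. N x \<le> M \<longrightarrow> N v \<le> \<delta> \<longrightarrow>
      \<bar>J1 (x + v) - J2 (x + v) - c - (J1 x - J2 x - c) - (D1 x v - D2 x v)\<bar> \<le> \<epsilon> * N v"
  proof (intro exI[of _ "min d1 d2"] conjI ballI impI)
    fix x v assume x: "x \<in> X" "v \<in> X" "N x \<le> M" "N v \<le> min d1 d2"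
    have "\<bar>J1 (x + v) - J2 (x + v) - c - (J1 x - J2 x - c) - (D1 x v - D2 x v)\<bar>
        = \<bar>(J1 (x + v) - J1 x - D1 x v) - (J2 (x + v) - J2 x - D2 x v)\<bar>" by (simp add: algebra_simps)
    also have "\<dots> \<le> \<bar>J1 (x + v) - J1 x - D1 x v\<bar> + \<bar>J2 (x + v) - J2 x - D2 x v\<bar>" by (rule abs_triangle_ineq4)
    also have "\<dots> \<le> \<epsilon> / 2 * N v + \<epsilon> / 2 * N v" using x d1(2)[of x v] d2(2)[of x v] by (intro add_mono) auto
    finally show "\<bar>J1 (x + v) - J2 (x + v) - c - (J1 x - J2 x - c) - (D1 x v - D2 x v)\<bar> \<le> \<epsilon> * N v" by simp
  qed (use d1 d2 in auto)
qed

text \<open>The chain rule. The inner functional takes values in some [0, B] on each bounded set, so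
  the outer function has to be uniformly differentiable on such intervals only.\<close>

lemma uniformly_differentiable_compose:
  fixes \<theta> \<theta>' :: "real \<Rightarrow> real"
  assumes ud: "uniformly_differentiable X N J D" and lb: "locally_bounded_form X N D"
    and range: "\<And>M. \<exists>B. \<forall>x\<in>X. N x \<le> M \<longrightarrow> J x \<in> {0..B}"
    and \<theta>: "\<And>B \<epsilon>. \<epsilon> > 0 \<Longrightarrow> \<exists>\<delta>>0. \<forall>r\<in>{0..B}. \<forall>s\<in>{0..B}. \<bar>s - r\<bar> \<le> \<delta> \<longrightarrow> \<bar>\<theta> s - \<theta> r - \<theta>' r * (s - r)\<bar> \<le> \<epsilon> * \<bar>s - r\<bar>"
    and \<theta>': "\<And>B. \<exists>K. \<forall>r\<in>{0..B}. \<bar>\<theta>' r\<bar> \<le> K"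
  shows "uniformly_differentiable X N (\<lambda>x. \<theta> (J x)) (\<lambda>x v. \<theta>' (J x) * D x v)"
    and "locally_bounded_form X N (\<lambda>x v. \<theta>' (J x) * D x v)"
proof -
  show "uniformly_differentiable X N (\<lambda>x. \<theta> (J x)) (\<lambda>x v. \<theta>' (J x) * D x v)"
    unfolding uniformly_differentiable_def
  proof (intro allI impI)
    fix M \<epsilon> :: real assume e: "\<epsilon> > 0"
    obtain L where L: "L \<ge> 0" "\<And>x v. x \<in> X \<Longrightarrow> v \<in> X \<Longrightarrow> N x \<le> M \<Longrightarrow> \<bar>D x v\<bar> \<le> L * N v"
      by (fact locally_bounded_formE[OF lb, where M = M])
    \<comment> \<open>Radius \<open>M + 1\<close> also covers \<open>x + v\<close>, since the final
      radius \<open>d\<close> is at most 1.\<close>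
    obtain B where B: "\<And>x. x \<in> X \<Longrightarrow> N x \<le> M + 1 \<Longrightarrow> J x \<in> {0..B}" using range by blast
    obtain K0 where K0: "\<And>r. r \<in> {0..B} \<Longrightarrow> \<bar>\<theta>' r\<bar> \<le> K0" using \<theta>' by blast
    define K where "K = max K0 0"
    have K: "K \<ge> 0" "\<And>r. r \<in> {0..B} \<Longrightarrow> \<bar>\<theta>' r\<bar> \<le> K" using K0 by (auto simp: K_def max.coboundedI1)
    \<comment> \<open>Half of \<epsilon> is reserved for the remainder of the inner functional,
      magnified by \<open>K\<close>, and half, through \<open>e2\<close>, for that of \<theta>. The
      bound \<open>e1 \<le> 1\<close> makes the inner increment at most
      \<open>(L + 1) * N v\<close>.\<close>
    define e1 where "e1 = min 1 (\<epsilon> / (2 * (K + 1)))"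
    have e1: "e1 > 0" "e1 \<le> 1" "(K + 1) * e1 \<le> \<epsilon> / 2"
    proof -
      show "e1 > 0" "e1 \<le> 1" using e K by (auto simp: e1_def)
      have "(K + 1) * e1 \<le> (K + 1) * (\<epsilon> / (2 * (K + 1)))" using K by (intro mult_left_mono) (auto simp: e1_def)
      also have "\<dots> = \<epsilon> / 2" using K by (intro mult_half_divide) simp
      finally show "(K + 1) * e1 \<le> \<epsilon> / 2" .
    qed
    obtain d1 where d1: "d1 > 0" "\<And>x v. x \<in> X \<Longrightarrow> v \<in> X \<Longrightarrow> N x \<le> M \<Longrightarrow> N v \<le> d1 \<Longrightarrow> \<bar>J (x + v) - J x - D x v\<bar> \<le> e1 * N v"
      by (fact uniformly_differentiableE[OF ud e1(1), where M = M])
    define e2 where "e2 = \<epsilon> / (2 * (L + 1))"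
    have "(L + 1) * (\<epsilon> / (2 * (L + 1))) = \<epsilon> / 2" using L by (intro mult_half_divide) simp
    then have e2: "e2 > 0" "e2 * (L + 1) = \<epsilon> / 2" using e L by (simp_all add: e2_def mult.commute)
    obtain d2 where d2: "d2 > 0" "\<And>r s. r \<in> {0..B} \<Longrightarrow> s \<in> {0..B} \<Longrightarrow> \<bar>s - r\<bar> \<le> d2 \<Longrightarrow>
        \<bar>\<theta> s - \<theta> r - \<theta>' r * (s - r)\<bar> \<le> e2 * \<bar>s - r\<bar>" using \<theta>[OF e2(1)] by blast
    define d where "d = min (min 1 d1) (d2 / (L + 1))"
    have d: "d > 0" "d \<le> 1" "d \<le> d1" "(L + 1) * d \<le> d2"
    proof -
      show "d > 0" "d \<le> 1" "d \<le> d1" using d1 d2 L by (auto simp: d_def)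
      have "(L + 1) * d \<le> (L + 1) * (d2 / (L + 1))" using L by (intro mult_left_mono) (auto simp: d_def)
      then show "(L + 1) * d \<le> d2" using L by simp
    qed
    show "\<exists>\<delta>>0. \<forall>x\<in>X. \<forall>v\<in>X. N x \<le> M \<longrightarrow> N v \<le> \<delta> \<longrightarrow>
        \<bar>\<theta> (J (x + v)) - \<theta> (J x) - \<theta>' (J x) * D x v\<bar> \<le> \<epsilon> * N v"
    proof (intro exI[of _ d] conjI ballI impI d(1))
      fix x v assume x: "x \<in> X" "v \<in> X" "N x \<le> M" "N v \<le> d"
      have Nv: "N v \<ge> 0" using N_nonneg x by simp
      have Jx: "J x \<in> {0..B}" using B x by force
      have Jxv: "J (x + v) \<in> {0..B}" using N_add[of x v] x d by (intro B) auto
      have 1: "\<bar>J (x + v) - J x - D x v\<bar> \<le> e1 * N v" using d1(2)[of x v] x d by simp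
      have "e1 * N v \<le> 1 * N v" using e1 Nv by (intro mult_right_mono) auto
      moreover have "\<bar>J (x + v) - J x\<bar> \<le> \<bar>J (x + v) - J x - D x v\<bar> + \<bar>D x v\<bar>"
        using abs_triangle_ineq[of "J (x + v) - J x - D x v" "D x v"] by simp
      moreover have "\<bar>D x v\<bar> \<le> L * N v" using L(2) x by blast
      ultimately have 2: "\<bar>J (x + v) - J x\<bar> \<le> (L + 1) * N v" using 1 unfolding distrib_right by linarith
      also have "\<dots> \<le> (L + 1) * d" using x L by (intro mult_left_mono) auto
      finally have "\<bar>J (x + v) - J x\<bar> \<le> d2" using d by linarith
      then have "\<bar>\<theta> (J (x + v)) - \<theta> (J x) - \<theta>' (J x) * (J (x + v) - J x)\<bar> \<le> e2 * \<bar>J (x + v) - J x\<bar>"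
        using d2(2)[OF Jx Jxv] by blast
      also have "\<dots> \<le> e2 * ((L + 1) * N v)" using 2 e2 by (intro mult_left_mono) auto
      also have "\<dots> = \<epsilon> / 2 * N v" by (simp only: mult.assoc[symmetric] e2(2))
      finally have 3: "\<bar>\<theta> (J (x + v)) - \<theta> (J x) - \<theta>' (J x) * (J (x + v) - J x)\<bar> \<le> \<epsilon> / 2 * N v" .
      have "\<bar>\<theta>' (J x) * (J (x + v) - J x - D x v)\<bar> \<le> (K + 1) * (e1 * N v)"
        unfolding abs_mult using K(2)[OF Jx] K(1) 1 by (intro mult_mono) auto
      also have "\<dots> \<le> \<epsilon> / 2 * N v" using mult_right_mono[OF e1(3) Nv] by (simp only: mult.assoc)
      finally have 4: "\<bar>\<theta>' (J x) * (J (x + v) - J x - D x v)\<bar> \<le> \<epsilon> / 2 * N v" .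
      have eq: "\<theta> (J (x + v)) - \<theta> (J x) - \<theta>' (J x) * D x v =
        (\<theta> (J (x + v)) - \<theta> (J x) - \<theta>' (J x) * (J (x + v) - J x)) + \<theta>' (J x) * (J (x + v) - J x - D x v)"
        by (simp add: algebra_simps)
      have "\<bar>\<theta> (J (x + v)) - \<theta> (J x) - \<theta>' (J x) * D x v\<bar> \<le> \<epsilon> / 2 * N v + \<epsilon> / 2 * N v"
        unfolding eq by (rule order_trans[OF abs_triangle_ineq add_mono[OF 3 4]])
      then show "\<bar>\<theta> (J (x + v)) - \<theta> (J x) - \<theta>' (J x) * D x v\<bar> \<le> \<epsilon> * N v" by simp
    qed
  qed
  show "locally_bounded_form X N (\<lambda>x v. \<theta>' (J x) * D x v)"
    unfolding locally_bounded_form_def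
  proof
    fix M
    obtain L where L: "L \<ge> 0" "\<And>x v. x \<in> X \<Longrightarrow> v \<in> X \<Longrightarrow> N x \<le> M \<Longrightarrow> \<bar>D x v\<bar> \<le> L * N v"
      by (fact locally_bounded_formE[OF lb, where M = M])
    obtain B where B: "\<And>x. x \<in> X \<Longrightarrow> N x \<le> M \<Longrightarrow> J x \<in> {0..B}" using range by blast
    obtain K where K: "\<And>r. r \<in> {0..B} \<Longrightarrow> \<bar>\<theta>' r\<bar> \<le> K" using \<theta>' by blast
    show "\<exists>L\<ge>0. \<forall>x\<in>X. \<forall>v\<in>X. N x \<le> M \<longrightarrow> \<bar>\<theta>' (J x) * D x v\<bar> \<le> L * N v"
    proof (intro exI[of _ "\<bar>K\<bar> * L"] conjI ballI impI)
      fix x v assume x: "x \<in> X" "v \<in> X" "N x \<le> M"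
      have "\<bar>\<theta>' (J x)\<bar> * \<bar>D x v\<bar> \<le> \<bar>K\<bar> * (L * N v)"
        using K[OF B[OF x(1,3)]] L(2)[OF x] by (intro mult_mono) auto
      then show "\<bar>\<theta>' (J x) * D x v\<bar> \<le> \<bar>K\<bar> * L * N v" by (simp add: abs_mult mult.assoc)
    qed (use L in auto)
  qed
qed

end

lemma primitive_0 [simp]: "primitive f t 0 = 0"
  by (simp add: primitive_def zero_ereal_def)

section \<open>The Kirchhoff term\<close>

locale kirchhoff = frac_space +
  fixes a b :: real and f :: "real \<Rightarrow> real \<Rightarrow> real"
  assumes a: "a > 0" and b: "b > 0"
    and f_cont: "continuous_on ({0..T} \<times> UNIV) (\<lambda>(t, x). f t x)"
begin

definition \<Psi> where "\<Psi> g = (LINT t|M. \<bar>g t\<bar> powr p)"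
definition d\<Psi> where "d\<Psi> g h = p * (LINT t|M. phi p (g t) * h t)"
text \<open>The derivative of \<theta> is the Kirchhoff coefficient divided by p; in
  \<open>\<theta>' (\<Psi> g) * d\<Psi> g h\<close> this cancels the factor \<open>p\<close> of
  \<open>d\<Psi>\<close>.\<close>

definition \<theta> where "\<theta> r = 1 / (b * p\<^sup>2) * (a + b * r) powr p"
definition \<theta>' where "\<theta>' r = (a + b * r) powr (p - 1) / p"
definition \<F> where "\<F> g = (LINT t|M. primitive f t (U g t))"
definition d\<F> where "d\<F> g h = (LINT t|M. f t (U g t) * U h t)"
definition J where "J g = \<theta> (\<Psi> g) - \<F> g - a powr p / (b * p\<^sup>2)"
definition DJ where "DJ g h = \<theta>' (\<Psi> g) * d\<Psi> g h - d\<F> g h"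

lemma \<Psi>_nrm: "\<Psi> g = nrm g powr p"
  by (simp add: \<Psi>_def nrm_powr)

lemma \<Psi>_nonneg: "\<Psi> g \<ge> 0"
  by (simp add: \<Psi>_nrm)

lemma d\<Psi>_bound: "g \<in> G \<Longrightarrow> h \<in> G \<Longrightarrow> \<bar>d\<Psi> g h\<bar> \<le> p * nrm g powr (p - 1) * nrm h"
  using integrable_phi_mult(2)[OF G_Lp G_Lp, of g h] p by (simp add: d\<Psi>_def abs_mult mult.assoc)

lemma d\<Psi>_locally_bounded: "locally_bounded_form G nrm d\<Psi>"
  unfolding locally_bounded_form_def
proof (rule allI)
  fix B :: real
  show "\<exists>L\<ge>0. \<forall>x\<in>G. \<forall>v\<in>G. nrm x \<le> B \<longrightarrow> \<bar>d\<Psi> x v\<bar> \<le> L * nrm v"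
  proof (intro exI[of _ "p * \<bar>B\<bar> powr (p - 1)"] conjI ballI impI)
    fix x v assume x: "x \<in> G" "v \<in> G" "nrm x \<le> B"
    have "\<bar>d\<Psi> x v\<bar> \<le> p * nrm x powr (p - 1) * nrm v" by (rule d\<Psi>_bound) fact+
    also have "\<dots> \<le> p * \<bar>B\<bar> powr (p - 1) * nrm v"
      using x p by (intro mult_right_mono mult_left_mono powr_mono2) auto
    finally show "\<bar>d\<Psi> x v\<bar> \<le> p * \<bar>B\<bar> powr (p - 1) * nrm v" .
  qed (use p in auto)
qed

text \<open>The pointwise expansion is integrated, and its mixed term is estimated by
  \<open>holder_phi\<close> with \<open>\<bar>g t\<bar> + \<bar>h t\<bar>\<close> as the first
  function.\<close>

lemma \<Psi>_taylor:
  assumes "\<epsilon> > 0"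
  obtains C where "C \<ge> 0" "\<And>g h. g \<in> G \<Longrightarrow> h \<in> G \<Longrightarrow>
     \<bar>\<Psi> (g + h) - \<Psi> g - d\<Psi> g h\<bar> \<le> \<epsilon> * ((nrm g + nrm h) powr (p - 1) * nrm h) + C * nrm h powr p"
proof -
  obtain C where C: "C \<ge> 0" and tay: "\<And>x h. \<bar>\<bar>x + h\<bar> powr p - \<bar>x\<bar> powr p - p * (phi p x * h)\<bar>
       \<le> \<epsilon> * ((\<bar>x\<bar> + \<bar>h\<bar>) powr (p - 1) * \<bar>h\<bar>) + C * \<bar>h\<bar> powr p"
    using abs_powr_taylor[OF p assms] by blast
  show thesis
  proof (rule that[OF C])
    fix g h assume "g \<in> G" "h \<in> G"
    then have g: "Lp g" and h: "Lp h" by (auto simp: G_Lp)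
    have gh: "Lp (\<lambda>t. \<bar>g t\<bar> + \<bar>h t\<bar>)" using g h by (intro Lp_add Lp_abs)
    note i1 = Lp_D(2)[OF Lp_add[OF g h]] and i2 = Lp_D(2)[OF g] and i3 = integrable_phi_mult(1)[OF g h]
      and i4 = holder_phi(1)[OF gh h] and i5 = Lp_D(2)[OF h]
    have "\<Psi> (g + h) - \<Psi> g - d\<Psi> g h = (LINT t|M. \<bar>g t + h t\<bar> powr p - \<bar>g t\<bar> powr p - p * (phi p (g t) * h t))"
      using i1 i2 i3 by (simp add: \<Psi>_def d\<Psi>_def plus_fun_def)
    then have "\<bar>\<Psi> (g + h) - \<Psi> g - d\<Psi> g h\<bar> \<le> (LINT t|M. \<bar>\<bar>g t + h t\<bar> powr p - \<bar>g t\<bar> powr p - p * (phi p (g t) * h t)\<bar>)"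
      by (simp only: integral_abs_bound)
    also have "\<dots> \<le> (LINT t|M. \<epsilon> * ((\<bar>g t\<bar> + \<bar>h t\<bar>) powr (p - 1) * \<bar>h t\<bar>) + C * \<bar>h t\<bar> powr p)"
      using i1 i2 i3 i4 i5 tay by (intro integral_mono) auto
    also have "\<dots> = \<epsilon> * (LINT t|M. (\<bar>g t\<bar> + \<bar>h t\<bar>) powr (p - 1) * \<bar>h t\<bar>) + C * nrm h powr p"
      using i4 i5 by (simp add: nrm_powr)
    also have "(LINT t|M. (\<bar>g t\<bar> + \<bar>h t\<bar>) powr (p - 1) * \<bar>h t\<bar>) \<le> nrm (\<lambda>t. \<bar>g t\<bar> + \<bar>h t\<bar>) powr (p - 1) * nrm h"
      using holder_phi(2)[OF gh h] by simp
    also have "\<dots> \<le> (nrm g + nrm h) powr (p - 1) * nrm h"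
      using minkowski[OF Lp_abs[OF g] Lp_abs[OF h]] p
      by (intro mult_right_mono powr_mono2) (auto simp: nrm_abs)
    finally show "\<bar>\<Psi> (g + h) - \<Psi> g - d\<Psi> g h\<bar> \<le> \<epsilon> * ((nrm g + nrm h) powr (p - 1) * nrm h) + C * nrm h powr p"
      using assms by simp
  qed
qed

lemma \<Psi>_differentiable: "uniformly_differentiable G nrm \<Psi> d\<Psi>"
  unfolding uniformly_differentiable_def
proof (intro allI impI)
  fix B \<epsilon> :: real assume e: "\<epsilon> > 0"
  define K where "K = (\<bar>B\<bar> + 1) powr (p - 1)"
  have K: "K > 0" by (simp add: K_def)
  define e1 where "e1 = \<epsilon> / (2 * K)"
  have e1: "e1 > 0" "e1 * K = \<epsilon> / 2" using e K by (simp_all add: e1_def)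
  obtain C where C: "C \<ge> 0" and tay: "\<And>g h. g \<in> G \<Longrightarrow> h \<in> G \<Longrightarrow>
     \<bar>\<Psi> (g + h) - \<Psi> g - d\<Psi> g h\<bar> \<le> e1 * ((nrm g + nrm h) powr (p - 1) * nrm h) + C * nrm h powr p"
    using \<Psi>_taylor[OF e1(1)] by blast
  \<comment> \<open>\<open>C\<close> depends on \<open>e1\<close>, so this radius is chosen last:
    the power \<open>p - 1\<close> of a small \<open>nrm v\<close> outweighs \<open>C\<close>. The
    summand 1 avoids division by 0.\<close>
  define d0 where "d0 = (\<epsilon> / (2 * (C + 1))) powr (1 / (p - 1))"
  have d0: "d0 > 0" "d0 powr (p - 1) = \<epsilon> / (2 * (C + 1))" using e C p by (simp_all add: d0_def powr_powr)
  show "\<exists>\<delta>>0. \<forall>x\<in>G. \<forall>v\<in>G. nrm x \<le> B \<longrightarrow> nrm v \<le> \<delta> \<longrightarrow> \<bar>\<Psi> (x + v) - \<Psi> x - d\<Psi> x v\<bar> \<le> \<epsilon> * nrm v"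
  proof (intro exI[of _ "min 1 d0"] conjI ballI impI)
    fix x v assume x: "x \<in> G" "v \<in> G" "nrm x \<le> B" "nrm v \<le> min 1 d0"
    have "(nrm x + nrm v) powr (p - 1) \<le> K"
      unfolding K_def using x p by (intro powr_mono2) auto
    then have "e1 * ((nrm x + nrm v) powr (p - 1) * nrm v) \<le> e1 * (K * nrm v)"
      using e1 by (intro mult_left_mono mult_right_mono) auto
    also have "\<dots> = \<epsilon> / 2 * nrm v" using e1(2) by (simp only: mult.assoc[symmetric])
    finally have 1: "e1 * ((nrm x + nrm v) powr (p - 1) * nrm v) \<le> \<epsilon> / 2 * nrm v" .
    have "nrm v powr p = nrm v powr (p - 1) * nrm v"
      using powr_mult_base[of "nrm v" "p - 1"] by (simp add: mult.commute)
    also have "\<dots> \<le> d0 powr (p - 1) * nrm v" using x p by (intro mult_right_mono powr_mono2) auto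
    finally have "C * nrm v powr p \<le> (C + 1) * (d0 powr (p - 1) * nrm v)"
      using C by (intro mult_mono) auto
    also have "\<dots> = (C + 1) * d0 powr (p - 1) * nrm v" by (simp only: mult.assoc)
    also have "(C + 1) * d0 powr (p - 1) = \<epsilon> / 2" unfolding d0(2) using C by (intro mult_half_divide) simp
    finally have "C * nrm v powr p \<le> \<epsilon> / 2 * nrm v" .
    then show "\<bar>\<Psi> (x + v) - \<Psi> x - d\<Psi> x v\<bar> \<le> \<epsilon> * nrm v" using tay[OF x(1,2)] 1 by simp
  qed (use d0 in auto)
qed

lemma \<theta>_derivative: "r \<ge> 0 \<Longrightarrow> (\<theta> has_real_derivative \<theta>' r) (at r)"
proof -
  assume r: "r \<ge> 0"
  then have pos: "a + b * r > 0" using a b by (simp add: add_pos_nonneg)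
  have "((\<lambda>r. (a + b * r) powr p) has_real_derivative p * (a + b * r) powr (p - 1) * b) (at r)"
    using DERIV_chain2[of "\<lambda>z. z powr p" "p * (a + b * r) powr (p - 1)" "\<lambda>r. a + b * r" r b UNIV]
      has_real_derivative_powr[OF pos, of p] pos by (auto intro!: derivative_eq_intros)
  then have "(\<theta> has_real_derivative 1 / (b * p\<^sup>2) * (p * (a + b * r) powr (p - 1) * b)) (at r)"
    unfolding \<theta>_def[abs_def] by (rule DERIV_cmult)
  moreover have "1 / (b * p\<^sup>2) * (p * (a + b * r) powr (p - 1) * b) = \<theta>' r"
    using b p by (simp add: \<theta>'_def power2_eq_square)
  ultimately show ?thesis by simp
qed

lemma \<theta>'_continuous: "continuous_on {0..B} \<theta>'"
  unfolding \<theta>'_def[abs_def]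
  using a b p by (intro continuous_intros continuous_on_powr) (auto simp: add_pos_nonneg less_imp_neq[symmetric])

lemma \<theta>'_bounded: "\<exists>K. \<forall>r\<in>{0..B}. \<bar>\<theta>' r\<bar> \<le> K"
proof -
  have "bounded (\<theta>' ` {0..B})" using compact_imp_bounded[OF compact_continuous_image[OF \<theta>'_continuous]] by simp
  then show ?thesis unfolding bounded_iff by auto
qed

text \<open>The derivative is uniformly continuous on a compact interval, and the mean value theorem
  compares its value at an intermediate point with that at \<open>r\<close>.\<close>

lemma \<theta>_uniform:
  assumes "\<epsilon> > 0"
  shows "\<exists>\<delta>>0. \<forall>r\<in>{0..B}. \<forall>s\<in>{0..B}. \<bar>s - r\<bar> \<le> \<delta> \<longrightarrow> \<bar>\<theta> s - \<theta> r - \<theta>' r * (s - r)\<bar> \<le> \<epsilon> * \<bar>s - r\<bar>"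
proof -
  have "uniformly_continuous_on {0..B} \<theta>'" by (intro compact_uniformly_continuous \<theta>'_continuous) auto
  then obtain d where d: "d > 0" "\<And>r s. r \<in> {0..B} \<Longrightarrow> s \<in> {0..B} \<Longrightarrow> \<bar>s - r\<bar> < d \<Longrightarrow> \<bar>\<theta>' s - \<theta>' r\<bar> < \<epsilon>"
    using assms unfolding uniformly_continuous_on_def dist_real_def by metis
  show ?thesis
  proof (intro exI[of _ "d / 2"] conjI ballI impI)
    fix r s assume r: "r \<in> {0..B}" "s \<in> {0..B}" "\<bar>s - r\<bar> \<le> d / 2"
    have seg: "z \<in> {0..B} \<and> \<bar>z - r\<bar> \<le> \<bar>s - r\<bar>" if "z \<in> closed_segment r s" for z
      using that r by (auto simp: closed_segment_eq_real_ivl split: if_splits)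
    then obtain z where z: "z \<in> closed_segment r s" "\<theta> s - \<theta> r = (s - r) * \<theta>' z"
      using mvt_segment[of r s \<theta> \<theta>'] \<theta>_derivative by fastforce
    have "\<bar>z - r\<bar> < d" using seg[OF z(1)] r d by linarith
    then have "\<bar>\<theta>' z - \<theta>' r\<bar> < \<epsilon>" using d(2) r seg[OF z(1)] by blast
    moreover have "\<theta> s - \<theta> r - \<theta>' r * (s - r) = (\<theta>' z - \<theta>' r) * (s - r)" using z(2) by (simp add: algebra_simps)
    ultimately show "\<bar>\<theta> s - \<theta> r - \<theta>' r * (s - r)\<bar> \<le> \<epsilon> * \<bar>s - r\<bar>"
      by (simp add: abs_mult mult_right_mono less_imp_le)
  qed (use d in auto)
qed

lemma \<Psi>_range: "\<exists>B. \<forall>x\<in>G. nrm x \<le> C \<longrightarrow> \<Psi> x \<in> {0..B}"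
  using p by (intro exI[of _ "\<bar>C\<bar> powr p"]) (auto simp: \<Psi>_nrm intro!: powr_mono2)

section \<open>The nonlinear term\<close>

lemma f_cont_slice: "t \<in> {0..T} \<Longrightarrow> continuous_on A (f t)"
proof -
  assume t: "t \<in> {0..T}"
  have "continuous_on A (\<lambda>x. (t, x))" by (intro continuous_intros)
  moreover have "(\<lambda>x. (t, x)) ` A \<subseteq> {0..T} \<times> UNIV" using t by auto
  ultimately show ?thesis using continuous_on_compose2[OF f_cont, of A "\<lambda>x. (t, x)"] by simp
qed

lemma f_cont_compose:
  assumes "continuous_on S u" "continuous_on S v" "u ` S \<subseteq> {0..T}"
  shows "continuous_on S (\<lambda>s. f (u s) (v s))"
  using continuous_on_compose2[OF f_cont continuous_on_Pair[OF assms(1,2)]] assms(3) by auto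

lemma f_uniform:
  assumes "\<epsilon> > 0"
  obtains \<delta> where "\<delta> > 0"
    "\<And>t x y. t \<in> {0..T} \<Longrightarrow> \<bar>x\<bar> \<le> B \<Longrightarrow> \<bar>y\<bar> \<le> B \<Longrightarrow> \<bar>x - y\<bar> < \<delta> \<Longrightarrow> \<bar>f t x - f t y\<bar> < \<epsilon>"
proof -
  have "compact ({0..T} \<times> {-B..B})" by (intro compact_Times) auto
  then have "uniformly_continuous_on ({0..T} \<times> {-B..B}) (\<lambda>(t, x). f t x)"
    by (intro compact_uniformly_continuous continuous_on_subset[OF f_cont]) auto
  then obtain d where d: "d > 0" "\<And>z w. z \<in> {0..T} \<times> {-B..B} \<Longrightarrow> w \<in> {0..T} \<times> {-B..B} \<Longrightarrow> dist w z < d \<Longrightarrow>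
      dist (case w of (t, x) \<Rightarrow> f t x) (case z of (t, x) \<Rightarrow> f t x) < \<epsilon>"
    using assms unfolding uniformly_continuous_on_def by metis
  show thesis
  proof (rule that[OF d(1)])
    fix t x y assume "t \<in> {0..T}" "\<bar>x\<bar> \<le> B" "\<bar>y\<bar> \<le> B" "\<bar>x - y\<bar> < d"
    then show "\<bar>f t x - f t y\<bar> < \<epsilon>"
      using d(2)[of "(t, y)" "(t, x)"] by (simp add: dist_Pair_Pair dist_real_def abs_le_iff)
  qed
qed

lemma f_bounded:
  obtains K where "K \<ge> 0" "\<And>t x. t \<in> {0..T} \<Longrightarrow> \<bar>x\<bar> \<le> B \<Longrightarrow> \<bar>f t x\<bar> \<le> K"
proof -
  have "compact ({0..T} \<times> {-B..B})" by (intro compact_Times) auto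
  then have "bounded ((\<lambda>(t, x). f t x) ` ({0..T} \<times> {-B..B}))"
    by (intro compact_imp_bounded compact_continuous_image continuous_on_subset[OF f_cont]) auto
  then obtain K where K: "\<And>z. z \<in> {0..T} \<times> {-B..B} \<Longrightarrow> \<bar>case z of (t, x) \<Rightarrow> f t x\<bar> \<le> K"
    unfolding bounded_iff real_norm_def by blast
  show thesis
  proof (rule that)
    fix t x assume "t \<in> {0..T}" "\<bar>x\<bar> \<le> B"
    then show "\<bar>f t x\<bar> \<le> max K 0" using K[of "(t, x)"] by (simp add: abs_le_iff)
  qed simp
qed

lemma primitive_derivative:
  assumes t: "t \<in> {0..T}"
  shows "(primitive f t has_real_derivative f t x) (at x)"
proof -
  have "((\<lambda>u. LBINT y=ereal 0..ereal u. f t y) has_vector_derivative f t x) (at x within {-\<bar>x\<bar>-1..\<bar>x\<bar>+1})"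
    by (rule interval_integral_FTC2) (use f_cont_slice[OF t] in auto)
  then have "(primitive f t has_real_derivative f t x) (at x within {-\<bar>x\<bar>-1..\<bar>x\<bar>+1})"
    unfolding primitive_def[abs_def] by (simp add: has_real_derivative_iff_has_vector_derivative zero_ereal_def)
  moreover have "- \<bar>x\<bar> - 1 < x" "x < \<bar>x\<bar> + 1" using abs_ge_minus_self[of x] abs_ge_self[of x] by linarith+
  ultimately show ?thesis by (simp add: at_within_Icc_at)
qed

lemma primitive_mvt:
  assumes t: "t \<in> {0..T}"
  shows "\<exists>z\<in>closed_segment x y. primitive f t y - primitive f t x = (y - x) * f t z"
  using mvt_segment primitive_derivative[OF t] by blast

text \<open>The substitution \<open>F(t, x) = \<integral>\<^sub>0\<^sup>1 x f(t, s x) ds\<close> makes the domain of integration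
  independent of \<open>t\<close>.\<close>

lemma primitive_continuous:
  assumes u: "continuous_on {0..T} u"
  shows "continuous_on {0..T} (\<lambda>t. primitive f t (u t))"
proof -
  have eq: "primitive f t (u t) = integral (cbox 0 1) (\<lambda>s. u t * f t (s * u t))" if t: "t \<in> {0..T}" for t
  proof -
    have "((\<lambda>s. primitive f t (s * u t)) has_vector_derivative u t * f t (s * u t)) (at s within {0..1})" for s
    proof -
      have "((\<lambda>s. primitive f t (s * u t)) has_real_derivative f t (s * u t) * u t) (at s within {0..1})"
        by (rule DERIV_chain2[OF primitive_derivative[OF t]]) (auto intro!: derivative_eq_intros)
      then show ?thesis by (simp add: has_real_derivative_iff_has_vector_derivative mult.commute)
    qed
    then have "((\<lambda>s. u t * f t (s * u t)) has_integral primitive f t (1 * u t) - primitive f t (0 * u t)) {0..1}"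
      by (intro fundamental_theorem_of_calculus) auto
    then have "integral {0..1} (\<lambda>s. u t * f t (s * u t)) = primitive f t (1 * u t) - primitive f t (0 * u t)"
      by (rule integral_unique)
    then show ?thesis by (simp only: cbox_interval mult_1_left mult_zero_left primitive_0 diff_zero)
  qed
  have "continuous_on ({0..T} \<times> cbox 0 1) (\<lambda>(t, s). u t * f t (s * u t))"
  proof -
    have "continuous_on ({0..T} \<times> cbox 0 (1::real)) (\<lambda>z. u (fst z))"
      by (rule continuous_on_compose2[OF u continuous_on_fst[OF continuous_on_id]]) auto
    moreover from this have "continuous_on ({0..T} \<times> cbox 0 1) (\<lambda>z. f (fst z) (snd z * u (fst z)))"
      by (intro f_cont_compose continuous_on_mult continuous_on_fst continuous_on_snd continuous_on_id) auto
    ultimately show ?thesis by (simp add: case_prod_beta' continuous_on_mult)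
  qed
  then have "continuous_on {0..T} (\<lambda>t. integral (cbox 0 1) (\<lambda>s. u t * f t (s * u t)))"
    by (rule integral_continuous_on_param)
  then show ?thesis by (rule continuous_on_eq) (simp add: eq)
qed

lemma continuous_integrable: "continuous_on {0..T} u \<Longrightarrow> integrable M (u :: real \<Rightarrow> real)"
  using Lp_integrable(1)[OF continuous_Lp] .

lemma integral_abs_le:
  assumes "integrable M (u :: real \<Rightarrow> real)" and "\<And>t. t \<in> {0..T} \<Longrightarrow> \<bar>u t\<bar> \<le> B"
  shows "\<bar>LINT t|M. u t\<bar> \<le> T * B"
proof -
  have "\<bar>LINT t|M. u t\<bar> \<le> (LINT t|M. \<bar>u t\<bar>)" by (rule integral_abs_bound)
  also have "\<dots> \<le> (LINT t|M. B)" using assms by (intro integral_mono) auto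
  finally show ?thesis by (simp add: measure_M mult.commute)
qed

lemma f_U_continuous: "g \<in> G \<Longrightarrow> continuous_on {0..T} (\<lambda>t. f t (U g t))"
  by (intro f_cont_compose continuous_on_id U_continuous G_Lp) auto

lemma F_U_integrable: "g \<in> G \<Longrightarrow> integrable M (\<lambda>t. primitive f t (U g t))"
  by (intro continuous_integrable primitive_continuous U_continuous G_Lp)

lemma f_U_integrable: "g \<in> G \<Longrightarrow> h \<in> G \<Longrightarrow> integrable M (\<lambda>t. f t (U g t) * U h t)"
  by (intro continuous_integrable continuous_on_mult f_U_continuous U_continuous G_Lp)

text \<open>\<open>U_bound\<close> turns a bound on \<open>nrm\<close> into a uniform bound on the
  interval, so all values of the integrals stay in a compact set, on which \<open>f\<close> is
  uniformly continuous.\<close>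

lemma \<F>_differentiable: "uniformly_differentiable G nrm \<F> d\<F>"
  unfolding uniformly_differentiable_def
proof (intro allI impI)
  fix B \<epsilon> :: real assume e: "\<epsilon> > 0"
  define e1 where "e1 = \<epsilon> / (T * sup_const)"
  have e1: "e1 > 0" "T * (e1 * sup_const) = \<epsilon>" using e T sup_const_pos by (simp_all add: e1_def)
  obtain d where d: "d > 0" "\<And>t x y. t \<in> {0..T} \<Longrightarrow> \<bar>x\<bar> \<le> sup_const * \<bar>B\<bar> + 1 \<Longrightarrow> \<bar>y\<bar> \<le> sup_const * \<bar>B\<bar> + 1 \<Longrightarrow>
      \<bar>x - y\<bar> < d \<Longrightarrow> \<bar>f t x - f t y\<bar> < e1"
    using f_uniform[OF e1(1)] by blast
  \<comment> \<open>The bound 1 keeps the perturbed values in the range fixed before; the bound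
    \<open>d / 2\<close> brings them within reach of the modulus of continuity.\<close>
  define \<delta> where "\<delta> = min 1 (d / 2) / sup_const"
  have \<delta>: "\<delta> > 0" "sup_const * \<delta> \<le> 1" "sup_const * \<delta> \<le> d / 2" using d sup_const_pos by (auto simp: \<delta>_def)
  show "\<exists>\<delta>>0. \<forall>x\<in>G. \<forall>v\<in>G. nrm x \<le> B \<longrightarrow> nrm v \<le> \<delta> \<longrightarrow> \<bar>\<F> (x + v) - \<F> x - d\<F> x v\<bar> \<le> \<epsilon> * nrm v"
  proof (intro exI[of _ \<delta>] conjI ballI impI \<delta>(1))
    fix x v assume x: "x \<in> G" "v \<in> G" "nrm x \<le> B" "nrm v \<le> \<delta>"
    have xv: "x + v \<in> G" using x by auto
    have pw: "\<bar>primitive f t (U (x + v) t) - primitive f t (U x t) - f t (U x t) * U v t\<bar> \<le> e1 * (sup_const * nrm v)"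
      if t: "t \<in> {0..T}" for t
    proof -
      have Uxv: "U (x + v) t = U x t + U v t"
        using U_add[OF G_Lp[OF x(1)] G_Lp[OF x(2)] t] by (simp add: plus_fun_def)
      have Ux: "\<bar>U x t\<bar> \<le> sup_const * \<bar>B\<bar>"
        by (rule order_trans[OF U_bound[OF G_Lp[OF x(1)] t]]) (use x sup_const_pos in \<open>auto intro: mult_left_mono\<close>)
      have Uv: "\<bar>U v t\<bar> \<le> sup_const * nrm v" by (rule U_bound[OF G_Lp[OF x(2)] t])
      also have "\<dots> \<le> sup_const * \<delta>" using x sup_const_pos by (intro mult_left_mono) auto
      finally have Uv1: "\<bar>U v t\<bar> \<le> 1" "\<bar>U v t\<bar> \<le> d / 2" using \<delta> by linarith+
      obtain z where z: "z \<in> closed_segment (U x t) (U x t + U v t)"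
        and mv: "primitive f t (U x t + U v t) - primitive f t (U x t) = (U x t + U v t - U x t) * f t z"
        using primitive_mvt[OF t, of "U x t" "U x t + U v t"] by blast
      have zx: "\<bar>z - U x t\<bar> \<le> \<bar>U v t\<bar>" using z by (auto simp: closed_segment_eq_real_ivl split: if_splits)
      then have "\<bar>z\<bar> \<le> sup_const * \<bar>B\<bar> + 1" using Ux Uv1 abs_triangle_ineq[of "z - U x t" "U x t"] by simp
      then have "\<bar>f t z - f t (U x t)\<bar> < e1" using d(2)[OF t, of z "U x t"] Ux zx Uv1 d(1) by linarith
      then have "\<bar>(f t z - f t (U x t)) * U v t\<bar> \<le> e1 * (sup_const * nrm v)"
        unfolding abs_mult using Uv e1 by (intro mult_mono) auto
      moreover have "primitive f t (U (x + v) t) - primitive f t (U x t) - f t (U x t) * U v t = (f t z - f t (U x t)) * U v t"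
        using mv unfolding Uxv by (simp add: algebra_simps)
      ultimately show ?thesis by simp
    qed
    have eq: "\<F> (x + v) - \<F> x - d\<F> x v = (LINT t|M. primitive f t (U (x + v) t) - primitive f t (U x t) - f t (U x t) * U v t)"
      using F_U_integrable[OF x(1)] F_U_integrable[OF xv] f_U_integrable[OF x(1,2)] by (simp add: \<F>_def d\<F>_def)
    have "\<bar>\<F> (x + v) - \<F> x - d\<F> x v\<bar> \<le> T * (e1 * (sup_const * nrm v))"
      unfolding eq
      using F_U_integrable[OF x(1)] F_U_integrable[OF xv] f_U_integrable[OF x(1,2)] pw by (intro integral_abs_le) auto
    also have "\<dots> = T * (e1 * sup_const) * nrm v" by (simp only: mult.assoc)
    also have "\<dots> = \<epsilon> * nrm v" by (simp only: e1(2))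
    finally show "\<bar>\<F> (x + v) - \<F> x - d\<F> x v\<bar> \<le> \<epsilon> * nrm v" .
  qed
qed

lemma d\<F>_locally_bounded: "locally_bounded_form G nrm d\<F>"
  unfolding locally_bounded_form_def
proof (rule allI)
  fix B :: real
  obtain K where K: "K \<ge> 0" "\<And>t x. t \<in> {0..T} \<Longrightarrow> \<bar>x\<bar> \<le> sup_const * \<bar>B\<bar> \<Longrightarrow> \<bar>f t x\<bar> \<le> K"
    using f_bounded by blast
  show "\<exists>L\<ge>0. \<forall>x\<in>G. \<forall>v\<in>G. nrm x \<le> B \<longrightarrow> \<bar>d\<F> x v\<bar> \<le> L * nrm v"
  proof (intro exI[of _ "T * (K * sup_const)"] conjI ballI impI)
    fix x v assume x: "x \<in> G" "v \<in> G" "nrm x \<le> B"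
    have "\<bar>d\<F> x v\<bar> \<le> T * (K * (sup_const * nrm v))"
      unfolding d\<F>_def
    proof (rule integral_abs_le[OF f_U_integrable[OF x(1,2)]])
      fix t assume t: "t \<in> {0..T}"
      have "\<bar>U x t\<bar> \<le> sup_const * \<bar>B\<bar>"
        by (rule order_trans[OF U_bound[OF G_Lp[OF x(1)] t]]) (use x sup_const_pos in \<open>auto intro: mult_left_mono\<close>)
      then show "\<bar>f t (U x t) * U v t\<bar> \<le> K * (sup_const * nrm v)"
        unfolding abs_mult using K t U_bound[OF G_Lp[OF x(2)] t] by (intro mult_mono) auto
    qed
    then show "\<bar>d\<F> x v\<bar> \<le> T * (K * sup_const) * nrm v" by (simp only: mult.assoc)
  qed (use T K sup_const_pos in auto)
qed

lemma d\<Psi>_linear: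
  assumes "x \<in> G" "v \<in> G" "w \<in> G"
  shows "d\<Psi> x (v + w) = d\<Psi> x v + d\<Psi> x w" "d\<Psi> x (c *\<^sub>R v) = c * d\<Psi> x v"
proof -
  note i = integrable_phi_mult(1)[OF G_Lp[OF assms(1)] G_Lp[OF assms(2)]] integrable_phi_mult(1)[OF G_Lp[OF assms(1)] G_Lp[OF assms(3)]]
  show "d\<Psi> x (v + w) = d\<Psi> x v + d\<Psi> x w"
    unfolding d\<Psi>_def using i by (simp add: plus_fun_def distrib_left)
  show "d\<Psi> x (c *\<^sub>R v) = c * d\<Psi> x v"
    unfolding d\<Psi>_def by (simp add: scaleR_fun_def mult.left_commute)
qed

lemma d\<F>_linear:
  assumes "x \<in> G" "v \<in> G" "w \<in> G"
  shows "d\<F> x (v + w) = d\<F> x v + d\<F> x w" "d\<F> x (c *\<^sub>R v) = c * d\<F> x v"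
proof -
  note i = f_U_integrable[OF assms(1,2)] f_U_integrable[OF assms(1,3)]
  have "d\<F> x (v + w) = (LINT t|M. f t (U x t) * U v t + f t (U x t) * U w t)"
    unfolding d\<F>_def
    using U_add[OF G_Lp[OF assms(2)] G_Lp[OF assms(3)]]
    by (intro Bochner_Integration.integral_cong) (auto simp: plus_fun_def distrib_left)
  then show "d\<F> x (v + w) = d\<F> x v + d\<F> x w" using i by (simp add: d\<F>_def)
  have "d\<F> x (c *\<^sub>R v) = (LINT t|M. c * (f t (U x t) * U v t))"
    unfolding d\<F>_def
    using U_scale[OF G_Lp[OF assms(2)]]
    by (intro Bochner_Integration.integral_cong) (auto simp: scaleR_fun_def)
  then show "d\<F> x (c *\<^sub>R v) = c * d\<F> x v" by (simp add: d\<F>_def)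
qed

section \<open>The energy and its derivative\<close>

sublocale J: differentiable_functional G nrm J DJ
proof
  have comp: "uniformly_differentiable G nrm (\<lambda>x. \<theta> (\<Psi> x)) (\<lambda>x v. \<theta>' (\<Psi> x) * d\<Psi> x v)"
    "locally_bounded_form G nrm (\<lambda>x v. \<theta>' (\<Psi> x) * d\<Psi> x v)"
    by (rule G.uniformly_differentiable_compose[OF \<Psi>_differentiable d\<Psi>_locally_bounded \<Psi>_range _ \<theta>'_bounded],
        rule \<theta>_uniform, assumption)+
  show "uniformly_differentiable G nrm J DJ"
    unfolding J_def[abs_def] DJ_def[abs_def]
    by (rule G.uniformly_differentiable_diff[OF comp(1) \<F>_differentiable])
  show "locally_bounded_form G nrm DJ"
    unfolding locally_bounded_form_def
  proof (rule allI)
    fix B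
    obtain L1 where L1: "L1 \<ge> 0" "\<And>x v. x \<in> G \<Longrightarrow> v \<in> G \<Longrightarrow> nrm x \<le> B \<Longrightarrow> \<bar>\<theta>' (\<Psi> x) * d\<Psi> x v\<bar> \<le> L1 * nrm v"
      by (fact locally_bounded_formE[OF comp(2), where M = B])
    obtain L2 where L2: "L2 \<ge> 0" "\<And>x v. x \<in> G \<Longrightarrow> v \<in> G \<Longrightarrow> nrm x \<le> B \<Longrightarrow> \<bar>d\<F> x v\<bar> \<le> L2 * nrm v"
      by (fact locally_bounded_formE[OF d\<F>_locally_bounded, where M = B])
    show "\<exists>L\<ge>0. \<forall>x\<in>G. \<forall>v\<in>G. nrm x \<le> B \<longrightarrow> \<bar>DJ x v\<bar> \<le> L * nrm v"
    proof (intro exI[of _ "L1 + L2"] conjI ballI impI)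
      fix x v assume x: "x \<in> G" "v \<in> G" "nrm x \<le> B"
      show "\<bar>DJ x v\<bar> \<le> (L1 + L2) * nrm v"
        unfolding DJ_def distrib_right
        using abs_triangle_ineq4[of "\<theta>' (\<Psi> x) * d\<Psi> x v" "d\<F> x v"] L1(2)[OF x] L2(2)[OF x] by linarith
    qed (use L1 L2 in auto)
  qed
  show "DJ x (v + w) = DJ x v + DJ x w" if "x \<in> G" "v \<in> G" "w \<in> G" for x v w
    using d\<Psi>_linear(1)[OF that] d\<F>_linear(1)[OF that] by (simp add: DJ_def algebra_simps)
  show "DJ x (c *\<^sub>R v) = c * DJ x v" if "x \<in> G" "v \<in> G" for x v c
    using d\<Psi>_linear(2)[OF that that(2)] d\<F>_linear(2)[OF that that(2)] by (simp add: DJ_def algebra_simps)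
qed

text \<open>This is the weak form of the equation, written in terms of the fractional derivative
  \<open>g\<close> of the solution and \<open>h\<close> of the test function.\<close>

lemma DJ_eq: "DJ g h = (a + b * \<Psi> g) powr (p - 1) * (LINT t|M. phi p (g t) * h t) - d\<F> g h"
  using p by (simp add: DJ_def \<theta>'_def d\<Psi>_def)

end

section \<open>Palais-Smale sequences\<close>

context differentiable_functional
begin

text \<open>\<open>J\<close> is continuous at \<open>g\<close> by its expansion there, and
  \<open>D\<close> is uniformly continuous on a ball containing the sequence and its limit; hence
  both the level and the vanishing of the derivative pass to the limit.\<close>

lemma critical_limit:
  assumes x: "\<And>n. x n \<in> X" "\<And>n. N (x n) \<le> B" and g: "g \<in> X" and lim: "(\<lambda>n. N (x n - g)) \<longlonglongrightarrow> 0"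
    and \<kappa>: "\<kappa> \<longlonglongrightarrow> 0" and D: "\<And>n v. v \<in> X \<Longrightarrow> \<bar>D (x n) v\<bar> \<le> \<kappa> n * N v" and c: "\<And>n. \<bar>J (x n) - c\<bar> \<le> \<kappa> n"
  shows "J g = c" and "\<And>v. v \<in> X \<Longrightarrow> D g v = 0"
proof -
  define B' where "B' = max B (N g)"
  have B': "N g \<le> B'" "N (x n) \<le> B'" for n using x(2)[of n] by (auto simp: B'_def)
  obtain L where L: "L \<ge> 0" "\<And>y v. y \<in> X \<Longrightarrow> v \<in> X \<Longrightarrow> N y \<le> B' \<Longrightarrow> \<bar>D y v\<bar> \<le> L * N v"
    by (fact locally_bounded_formE[OF D_bounded, where M = B'])
  obtain d where d: "d > 0" "\<And>y v. y \<in> X \<Longrightarrow> v \<in> X \<Longrightarrow> N y \<le> B' \<Longrightarrow> N v \<le> d \<Longrightarrow> \<bar>J (y + v) - J y - D y v\<bar> \<le> 1 * N v"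
    by (fact uniformly_differentiableE[OF J_diff zero_less_one, where M = B'])
  have "(\<lambda>n. J (x n)) \<longlonglongrightarrow> J g"
  proof (rule tendstoI)
    fix e :: real assume e: "e > 0"
    define e' where "e' = min d (e / (L + 2))"
    have e': "e' > 0" using d e L by (simp add: e'_def)
    have "\<forall>\<^sub>F n in sequentially. N (x n - g) < e'"
      using order_tendstoD(2)[OF lim e'] .
    then show "\<forall>\<^sub>F n in sequentially. dist (J (x n)) (J g) < e"
    proof eventually_elim
      case (elim n)
      have X: "x n - g \<in> X" using x g by auto
      have N0: "0 \<le> N (x n - g)" using N_nonneg X by blast
      have "\<bar>J (g + (x n - g)) - J g - D g (x n - g)\<bar> \<le> 1 * N (x n - g)"
        by (rule d(2)) (use X g B' elim in \<open>auto simp: e'_def\<close>)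
      then have 1: "\<bar>J (x n) - J g - D g (x n - g)\<bar> \<le> N (x n - g)" by simp
      have 2: "\<bar>D g (x n - g)\<bar> \<le> L * N (x n - g)" using L(2)[OF g X B'(1)] .
      have "\<bar>J (x n) - J g\<bar> \<le> \<bar>J (x n) - J g - D g (x n - g)\<bar> + \<bar>D g (x n - g)\<bar>"
        using abs_triangle_ineq[of "J (x n) - J g - D g (x n - g)" "D g (x n - g)"] by simp
      also have "\<dots> \<le> N (x n - g) + L * N (x n - g)" by (rule add_mono[OF 1 2])
      also have "\<dots> \<le> (L + 2) * N (x n - g)" using N0 by (simp add: algebra_simps)
      also have "\<dots> < (L + 2) * (e / (L + 2))" using elim L by (intro mult_strict_left_mono) (auto simp: e'_def)
      also have "\<dots> = e" using L by simp
      finally show ?case by (simp add: dist_real_def)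
    qed
  qed
  moreover have "(\<lambda>n. J (x n)) \<longlonglongrightarrow> c"
  proof -
    have "(\<lambda>n. J (x n) - c) \<longlonglongrightarrow> 0"
      by (rule Lim_null_comparison[OF _ \<kappa>]) (use c in auto)
    then show ?thesis by (simp add: LIM_zero_iff)
  qed
  ultimately show "J g = c" by (rule LIMSEQ_unique)
  fix v assume v: "v \<in> X"
  have Nv: "N v \<ge> 0" using N_nonneg v by blast
  have "\<bar>D g v\<bar> \<le> e" if e: "e > 0" for e
  proof -
    define e1 where "e1 = e / (2 * (N v + 1))"
    have e1: "e1 > 0" "e1 * N v \<le> e / 2"
    proof -
      show "e1 > 0" using e Nv by (simp add: e1_def)
      then have "e1 * N v \<le> e1 * (N v + 1)" by (intro mult_left_mono) auto
      also have "\<dots> = (N v + 1) * (e / (2 * (N v + 1)))" by (simp only: e1_def mult.commute)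
      also have "\<dots> = e / 2" using Nv by (intro mult_half_divide) simp
      finally show "e1 * N v \<le> e / 2" .
    qed
    obtain \<delta> where \<delta>: "\<delta> > 0" "\<And>y z w. y \<in> X \<Longrightarrow> z \<in> X \<Longrightarrow> w \<in> X \<Longrightarrow> N y \<le> B' \<Longrightarrow> N z \<le> B' \<Longrightarrow> N (y - z) \<le> \<delta>
       \<Longrightarrow> \<bar>D y w - D z w\<bar> \<le> e1 * N w"
      by (fact D_uniformly_continuous[OF e1(1), where M = B'])
    have "\<forall>\<^sub>F n in sequentially. N (x n - g) < \<delta> \<and> \<kappa> n < e1"
      using order_tendstoD(2)[OF lim \<delta>(1)] order_tendstoD(2)[OF \<kappa> e1(1)] by eventually_elim simp
    then obtain n where n: "N (x n - g) < \<delta>" "\<kappa> n < e1" by (auto simp: eventually_sequentially)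
    have 1: "\<bar>D (x n) v - D g v\<bar> \<le> e1 * N v" using \<delta>(2)[OF x(1) g v B'(2,1)] n by simp
    have 2: "\<bar>D (x n) v\<bar> \<le> e1 * N v"
      using D[OF v, of n] mult_right_mono[OF less_imp_le[OF n(2)] Nv] by linarith
    have "\<bar>D g v\<bar> \<le> \<bar>D (x n) v\<bar> + \<bar>D (x n) v - D g v\<bar>"
      using abs_triangle_ineq4[of "D (x n) v" "D (x n) v - D g v"] by simp
    then show ?thesis using 1 2 e1(2) by linarith
  qed
  then have "\<bar>D g v\<bar> \<le> 0" by (rule field_le_epsilon[of _ 0, simplified])
  then show "D g v = 0" by simp
qed

end

context kirchhoff
begin

text \<open>The derivative carries the Kirchhoff coefficient, which varies along the sequence. It is
  at least \<open>a powr (p - 1)\<close> and converges along a subsequence, so dividing by it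
  isolates the pairing with \<open>phi\<close> and leaves a nonlinear term that still converges
  uniformly.\<close>

lemma palais_smale:
  assumes s: "\<And>n. s n \<in> G" "\<And>n. nrm (s n) \<le> B" and \<kappa>: "\<kappa> \<longlonglongrightarrow> 0"
    and D: "\<And>n v. v \<in> G \<Longrightarrow> \<bar>DJ (s n) v\<bar> \<le> \<kappa> n * nrm v"
  obtains g r where "g \<in> G" "strict_mono r" "(\<lambda>n. nrm (s (r n) - g)) \<longlonglongrightarrow> 0"
proof -
  define B0 where "B0 = max B 1"
  have B0: "B0 > 0" "nrm (s n) \<le> B0" for n using s(2)[of n] by (auto simp: B0_def)
  define S where "S = sup_const * B0"
  have S: "\<bar>U (s n) t\<bar> \<le> S" if "t \<in> {0..T}" for n t
    using order_trans[OF U_bound[OF G_Lp[OF s(1)] that] mult_left_mono[OF B0(2)]] sup_const_pos by (simp add: S_def)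
  obtain u r1 where u: "continuous_on {0..T} u" and r1: "strict_mono (r1 :: nat \<Rightarrow> nat)"
    and conv: "\<And>e. 0 < e \<Longrightarrow> \<exists>N. \<forall>n t. n \<ge> N \<and> t \<in> {0..T} \<longrightarrow> norm (U (s (r1 n)) t - u t) < e"
  proof (rule Arzela_Ascoli[of "{0..T}" "\<lambda>n. U (s n)" S])
    fix t e :: real assume t: "t \<in> {0..T}" and e: "0 < e"
    obtain d where d: "d > 0" "\<And>g t u. Lp g \<Longrightarrow> nrm g \<le> B0 \<Longrightarrow> t \<in> {0..T} \<Longrightarrow> u \<in> {0..T} \<Longrightarrow> \<bar>t - u\<bar> < d \<Longrightarrow> \<bar>U g t - U g u\<bar> < e"
      using U_equicontinuous[OF B0(1) e] by blast
    show "\<exists>d>0. \<forall>n y. y \<in> {0..T} \<and> norm (t - y) < d \<longrightarrow> norm (U (s n) t - U (s n) y) < e"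
      using d(1) d(2)[OF G_Lp[OF s(1)] B0(2) t] by auto
  qed (use S in auto)
  \<comment> \<open>A second extraction: the first subsequence controls the nonlinear term, this one
    the Kirchhoff coefficient, which depends on the sequence through \<open>\<Psi>\<close>
    only.\<close>
  have "bounded (range (\<lambda>n. \<Psi> (s (r1 n))))"
    unfolding bounded_iff
    using B0 p by (intro exI[of _ "B0 powr p"]) (auto simp: \<Psi>_nrm intro!: powr_mono2)
  then obtain l r2 where r2: "strict_mono (r2 :: nat \<Rightarrow> nat)" and l: "((\<lambda>n. \<Psi> (s (r1 n))) \<circ> r2) \<longlonglongrightarrow> l"
    using bounded_imp_convergent_subsequence by blast
  define r where "r = r1 \<circ> r2"
  have r: "strict_mono r" unfolding r_def using r1 r2 by (rule strict_mono_o)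
  define z where "z n = s (r n)" for n
  have z: "z n \<in> G" "nrm (z n) \<le> B0" for n using s B0 by (auto simp: z_def)
  define k where "k n = \<kappa> (r n)" for n
  have k: "k \<longlonglongrightarrow> 0" unfolding k_def using LIMSEQ_subseq_LIMSEQ[OF \<kappa> r] by (simp add: comp_def)
  have Dz: "\<bar>DJ (z n) v\<bar> \<le> k n * nrm v" if "v \<in> G" for n v using D[OF that] by (simp add: z_def k_def)
  have lz: "(\<lambda>n. \<Psi> (z n)) \<longlonglongrightarrow> l" using l by (simp add: z_def r_def comp_def)
  have l0: "l \<ge> 0" by (rule LIMSEQ_le_const[OF lz]) (use \<Psi>_nonneg in auto)
  define k0 where "k0 = a powr (p - 1)"
  have k0: "k0 > 0" using a by (simp add: k0_def)
  define K where "K n = (a + b * \<Psi> (z n)) powr (p - 1)" for n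
  define K' where "K' = (a + b * l) powr (p - 1)"
  have K: "K n \<ge> k0" for n unfolding K_def k0_def using a b p \<Psi>_nonneg by (intro powr_mono2) auto
  have K': "K' \<ge> k0" unfolding K'_def k0_def using a b p l0 by (intro powr_mono2) auto
  have Kpos: "K n > 0" "K' > 0" for n using K[of n] K' k0 by linarith+
  have "K \<longlonglongrightarrow> K'"
    unfolding K_def[abs_def] K'_def
    using a b l0 by (intro tendsto_powr tendsto_intros lz) (simp add: add_pos_nonneg less_imp_neq[symmetric])
  then have Kinv: "(\<lambda>n. 1 / K n) \<longlonglongrightarrow> 1 / K'"
    using Kpos(2) by (intro tendsto_divide tendsto_const) auto
  define E where "E n t = f t (U (z n) t) / K n" for n t
  define E' where "E' t = f t (u t) / K'" for t
  have E_unif: "\<exists>N. \<forall>n\<ge>N. \<forall>t\<in>{0..T}. \<bar>E n t - E' t\<bar> \<le> \<eta>" if \<eta>: "\<eta> > 0" for \<eta>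
  proof -
    obtain Kf where Kf: "Kf \<ge> 0" "\<And>t x. t \<in> {0..T} \<Longrightarrow> \<bar>x\<bar> \<le> S + 1 \<Longrightarrow> \<bar>f t x\<bar> \<le> Kf" using f_bounded by blast
    \<comment> \<open>The factor \<open>k0\<close> bounds every \<open>K n\<close> from below, so it
      offsets the division by \<open>K n\<close>.\<close>
    have "\<eta> * k0 / 2 > 0" using \<eta> k0 by simp
    then obtain \<delta> where \<delta>: "\<delta> > 0" "\<And>t x y. t \<in> {0..T} \<Longrightarrow> \<bar>x\<bar> \<le> S + 1 \<Longrightarrow> \<bar>y\<bar> \<le> S + 1 \<Longrightarrow> \<bar>x - y\<bar> < \<delta> \<Longrightarrow> \<bar>f t x - f t y\<bar> < \<eta> * k0 / 2"
      using f_uniform by blast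
    obtain N1 where N1: "\<And>n t. n \<ge> N1 \<Longrightarrow> t \<in> {0..T} \<Longrightarrow> norm (U (s (r1 n)) t - u t) < min \<delta> 1"
      using conv[of "min \<delta> 1"] \<delta>(1) by auto
    have close: "\<bar>U (z n) t - u t\<bar> < \<delta>" "\<bar>U (z n) t - u t\<bar> < 1" if "n \<ge> N1" "t \<in> {0..T}" for n t
    proof -
      have "r2 n \<ge> N1" using seq_suble[OF r2, of n] that by linarith
      then show "\<bar>U (z n) t - u t\<bar> < \<delta>" "\<bar>U (z n) t - u t\<bar> < 1" using N1[of "r2 n" t] that by (auto simp: z_def r_def)
    qed
    have "\<eta> / (2 * (Kf + 1)) > 0" using \<eta> Kf by simp
    then obtain N2 where N2: "\<And>n. n \<ge> N2 \<Longrightarrow> \<bar>1 / K n - 1 / K'\<bar> < \<eta> / (2 * (Kf + 1))"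
      using LIMSEQ_D[OF Kinv] by (metis real_norm_def)
    show ?thesis
    proof (intro exI[of _ "max N1 N2"] allI impI ballI)
      fix n t assume n: "n \<ge> max N1 N2" and t: "t \<in> {0..T}"
      have c: "\<bar>U (z n) t - u t\<bar> < \<delta>" "\<bar>U (z n) t - u t\<bar> < 1" using close[of n t] n t by auto
      have Uz: "\<bar>U (z n) t\<bar> \<le> S + 1" using S[OF t, of "r n"] by (simp add: z_def)
      have "\<bar>u t\<bar> \<le> \<bar>U (z n) t\<bar> + \<bar>U (z n) t - u t\<bar>" using abs_triangle_ineq4[of "U (z n) t" "U (z n) t - u t"] by simp
      then have ut: "\<bar>u t\<bar> \<le> S + 1" using S[OF t, of "r n"] c by (simp add: z_def)
      have 1: "\<bar>(f t (U (z n) t) - f t (u t)) / K n\<bar> \<le> \<eta> / 2"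
      proof -
        have "\<bar>f t (U (z n) t) - f t (u t)\<bar> \<le> \<eta> * k0 / 2" using \<delta>(2)[OF t Uz ut c(1)] by simp
        also have "\<dots> \<le> \<eta> / 2 * K n" using mult_left_mono[OF K[of n], of "\<eta> / 2"] \<eta> by simp
        finally show ?thesis using Kpos(1)[of n] by (simp add: abs_divide divide_le_eq)
      qed
      have 2: "\<bar>f t (u t) * (1 / K n - 1 / K')\<bar> \<le> \<eta> / 2"
      proof -
        have "\<bar>f t (u t) * (1 / K n - 1 / K')\<bar> \<le> (Kf + 1) * (\<eta> / (2 * (Kf + 1)))"
          unfolding abs_mult using Kf(2)[OF t ut] Kf(1) N2[of n] n by (intro mult_mono) auto
        also have "\<dots> = \<eta> / 2" using Kf by (intro mult_half_divide) simp
        finally show ?thesis .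
      qed
      have "E n t - E' t = (f t (U (z n) t) - f t (u t)) / K n + f t (u t) * (1 / K n - 1 / K')"
        unfolding E_def E'_def using Kpos(1)[of n] Kpos(2) by (simp add: field_simps)
      then have "\<bar>E n t - E' t\<bar> \<le> \<bar>(f t (U (z n) t) - f t (u t)) / K n\<bar> + \<bar>f t (u t) * (1 / K n - 1 / K')\<bar>"
        by (simp only: abs_triangle_ineq)
      then show "\<bar>E n t - E' t\<bar> \<le> \<eta>" using 1 2 by linarith
    qed
  qed
  define A where "A n m = (LINT t|M. (phi p (z n t) - phi p (z m t)) * (z n t - z m t))" for n m
  have zz: "z n - z m \<in> G" "nrm (z n - z m) \<le> 2 * B0" for n m
    using z G.X_closed(3)[of "z n" "z m"] G.N_add[of "z n" "- z m"] G.N_minus[of "z m"] by (auto, smt (verit))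
  have iphi: "integrable M (\<lambda>t. phi p (z i t) * (z n - z m) t)" for i n m
    using integrable_phi_mult(1)[OF G_Lp[OF z(1)] G_Lp[OF zz(1)]] .
  have A_int: "integrable M (\<lambda>t. (phi p (z n t) - phi p (z m t)) * (z n t - z m t))" for n m
    using Bochner_Integration.integrable_diff[OF iphi[of n n m] iphi[of m n m]] by (simp add: left_diff_distrib)
  \<comment> \<open>\<open>DJ_eq\<close> solved for the pairing. Below, two members of the sequence
    are tested with the same direction, their difference, each after division by its own
    coefficient.\<close>
  have pairing: "(LINT t|M. phi p (z n t) * h t) = DJ (z n) h / K n + (LINT t|M. E n t * U h t)" if h: "h \<in> G" for n h
  proof -
    have "(LINT t|M. E n t * U h t) = (LINT t|M. (f t (U (z n) t) * U h t) / K n)" by (simp add: E_def)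
    also have "\<dots> = d\<F> (z n) h / K n" unfolding d\<F>_def by (rule integral_divide_zero)
    finally show ?thesis using DJ_eq[of "z n" h] Kpos(1)[of n] by (simp add: K_def[symmetric] field_simps)
  qed
  have A_le: "A n m \<le> (k n + k m) / k0 * (2 * B0) + T * (2 * \<eta> * (sup_const * (2 * B0)))"
    if \<eta>: "\<eta> > 0" and n: "\<forall>t\<in>{0..T}. \<bar>E n t - E' t\<bar> \<le> \<eta>" and m: "\<forall>t\<in>{0..T}. \<bar>E m t - E' t\<bar> \<le> \<eta>" for n m \<eta>
  proof -
    define h where "h = z n - z m"
    have h: "h \<in> G" "nrm h \<le> 2 * B0" using zz by (auto simp: h_def)
    have "A n m = (LINT t|M. phi p (z n t) * h t - phi p (z m t) * h t)"
      unfolding A_def by (simp add: h_def left_diff_distrib)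
    also have "\<dots> = (LINT t|M. phi p (z n t) * h t) - (LINT t|M. phi p (z m t) * h t)"
      using iphi[of n n m] iphi[of m n m] unfolding h_def[symmetric] by simp
    finally have A: "A n m = DJ (z n) h / K n - DJ (z m) h / K m + ((LINT t|M. E n t * U h t) - (LINT t|M. E m t * U h t))"
      unfolding pairing[OF h(1)] by simp
    have D1: "\<bar>DJ (z i) h / K i\<bar> \<le> k i / k0 * (2 * B0)" for i
    proof -
      \<comment> \<open>The sign is not assumed: the bound on \<open>DJ\<close> in a direction of
        positive norm forces it.\<close>
      have "k i \<ge> 0"
      proof (rule ccontr)
        assume "\<not> k i \<ge> 0"
        obtain g where g: "g \<in> G" "\<And>t. t \<in> {0..T} \<Longrightarrow> U g t = t * (T - t)" using G_nontrivial by blast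
        have "nrm g \<noteq> 0"
        proof
          assume "nrm g = 0"
          then have "U g (T / 2) = 0" using U_bound[OF G_Lp[OF g(1)], of "T / 2"] T by simp
          then show False using g(2)[of "T / 2"] T by simp
        qed
        then have "nrm g > 0" using nrm_nonneg[of g] by linarith
        then have "k i * nrm g < 0" using \<open>\<not> k i \<ge> 0\<close> by (simp add: mult_neg_pos)
        then show False using Dz[OF g(1), of i] by simp
      qed
      have "\<bar>DJ (z i) h / K i\<bar> = \<bar>DJ (z i) h\<bar> / K i" using Kpos(1)[of i] by simp
      also have "\<dots> \<le> (k i * (2 * B0)) / k0"
        using Dz[OF h(1), of i] mult_left_mono[OF h(2) \<open>k i \<ge> 0\<close>] K[of i] k0 \<open>k i \<ge> 0\<close> B0
        by (intro frac_le) auto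
      finally show ?thesis by simp
    qed
    have EU: "integrable M (\<lambda>t. E i t * U h t)" for i
      unfolding E_def using integrable_divide[OF f_U_integrable[OF z(1)[of i] h(1)], of "K i"] by simp
    have "\<bar>LINT t|M. E n t * U h t - E m t * U h t\<bar> \<le> T * (2 * \<eta> * (sup_const * (2 * B0)))"
    proof (rule integral_abs_le)
      show "integrable M (\<lambda>t. E n t * U h t - E m t * U h t)" using EU by simp
      fix t assume t: "t \<in> {0..T}"
      have "\<bar>E n t - E m t\<bar> \<le> \<bar>E n t - E' t\<bar> + \<bar>E m t - E' t\<bar>"
        using abs_triangle_ineq4[of "E n t - E' t" "E m t - E' t"] by simp
      then have "\<bar>E n t - E m t\<bar> \<le> 2 * \<eta>" using n m t by force
      moreover have "\<bar>U h t\<bar> \<le> sup_const * (2 * B0)"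
        by (rule order_trans[OF U_bound[OF G_Lp[OF h(1)] t]]) (use h(2) sup_const_pos in \<open>auto intro: mult_left_mono\<close>)
      ultimately have "\<bar>(E n t - E m t) * U h t\<bar> \<le> 2 * \<eta> * (sup_const * (2 * B0))"
        unfolding abs_mult using \<eta> by (intro mult_mono) auto
      then show "\<bar>E n t * U h t - E m t * U h t\<bar> \<le> 2 * \<eta> * (sup_const * (2 * B0))" by (simp only: left_diff_distrib)
    qed
    then have "(LINT t|M. E n t * U h t) - (LINT t|M. E m t * U h t) \<le> T * (2 * \<eta> * (sup_const * (2 * B0)))"
      using EU by (simp add: abs_le_iff)
    moreover have "DJ (z n) h / K n \<le> k n / k0 * (2 * B0)" "- (DJ (z m) h / K m) \<le> k m / k0 * (2 * B0)"
      by (rule abs_le_D1[OF D1], rule abs_le_D2[OF D1])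
    ultimately show ?thesis unfolding A by (simp add: add_divide_distrib distrib_right)
  qed
  have "\<exists>N. \<forall>m\<ge>N. \<forall>n\<ge>N. nrm (z m - z n) < e" if e: "e > 0" for e
  proof -
    define X where "X = (2 * B0) powr p"
    have X: "X > 0" using B0 by (simp add: X_def)
    have ep: "e powr p > 0" using e by simp
    have "e powr p / (4 * X) > 0" using X ep by simp
    then obtain C where C: "C \<ge> 0" and co: "\<And>x y. \<bar>x - y\<bar> powr p \<le> e powr p / (4 * X) * (\<bar>x\<bar> + \<bar>y\<bar>) powr p + C * ((phi p x - phi p y) * (x - y))"
      using phi_coercive[OF p] by blast
    \<comment> \<open>Each of the two terms of \<open>phi_coercive\<close> is to contribute at most
      \<open>e powr p / 4\<close>, which leaves the total strictly below \<open>e powr p\<close>.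
      Below, \<eta> and \<open>k1\<close> are each responsible for one half of
      \<open>q\<close>.\<close>
    define q where "q = e powr p / 2 / (2 * (C + 1))"
    have q: "q > 0" "(C + 1) * q = e powr p / 2 / 2"
      using C ep mult_half_divide[of "C + 1" "e powr p / 2"] by (simp_all only: q_def) auto
    define \<eta> where "\<eta> = q / (8 * T * sup_const * B0)"
    have \<eta>: "\<eta> > 0" "T * (2 * \<eta> * (sup_const * (2 * B0))) = q / 2"
      using q T sup_const_pos B0 by (simp_all add: \<eta>_def)
    define k1 where "k1 = q * k0 / (8 * B0)"
    have k1: "k1 > 0" "(k1 + k1) / k0 * (2 * B0) = q / 2" using q k0 B0 by (simp_all add: k1_def)
    obtain N1 where N1: "\<forall>n\<ge>N1. \<forall>t\<in>{0..T}. \<bar>E n t - E' t\<bar> \<le> \<eta>" using E_unif[OF \<eta>(1)] by blast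
    obtain N2 where N2: "\<forall>n\<ge>N2. k n < k1" using order_tendstoD(2)[OF k k1(1)] unfolding eventually_sequentially by blast
    show ?thesis
    proof (intro exI[of _ "max N1 N2"] allI impI)
      fix m n assume mn: "m \<ge> max N1 N2" "n \<ge> max N1 N2"
      have "A m n \<le> (k m + k n) / k0 * (2 * B0) + T * (2 * \<eta> * (sup_const * (2 * B0)))"
        by (rule A_le[OF \<eta>(1)]) (use N1 mn in auto)
      also have "\<dots> \<le> (k1 + k1) / k0 * (2 * B0) + T * (2 * \<eta> * (sup_const * (2 * B0)))"
        using N2 mn k0 B0 by (intro add_right_mono mult_right_mono divide_right_mono add_mono) (auto intro: less_imp_le)
      finally have A: "A m n \<le> q" unfolding k1 \<eta> by simp
      have zL: "Lp (z m)" "Lp (z n)" using z G_Lp by auto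
      have sL: "Lp (\<lambda>t. \<bar>z m t\<bar> + \<bar>z n t\<bar>)" using zL by (intro Lp_add Lp_abs)
      have sX: "(LINT t|M. (\<bar>z m t\<bar> + \<bar>z n t\<bar>) powr p) \<le> X"
      proof -
        have "nrm (\<lambda>t. \<bar>z m t\<bar> + \<bar>z n t\<bar>) \<le> 2 * B0"
          using minkowski[OF Lp_abs[OF zL(1)] Lp_abs[OF zL(2)]] z(2)[of m] z(2)[of n] by (simp add: nrm_abs)
        then show ?thesis using B0 by (subst (asm) nrm_le_iff) (auto simp: X_def)
      qed
      have "nrm (z m - z n) powr p = (LINT t|M. \<bar>z m t - z n t\<bar> powr p)" by (simp add: nrm_powr)
      also have "\<dots> \<le> (LINT t|M. e powr p / (4 * X) * (\<bar>z m t\<bar> + \<bar>z n t\<bar>) powr p + C * ((phi p (z m t) - phi p (z n t)) * (z m t - z n t)))"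
      proof (rule integral_mono)
        show "integrable M (\<lambda>t. \<bar>z m t - z n t\<bar> powr p)" using Lp_D(2)[OF Lp_diff[OF zL]] .
        show "integrable M (\<lambda>t. e powr p / (4 * X) * (\<bar>z m t\<bar> + \<bar>z n t\<bar>) powr p + C * ((phi p (z m t) - phi p (z n t)) * (z m t - z n t)))"
          using Lp_D(2)[OF sL] A_int[of m n] by (intro Bochner_Integration.integrable_add integrable_mult_right) auto
      qed (rule co)
      also have "\<dots> = e powr p / (4 * X) * (LINT t|M. (\<bar>z m t\<bar> + \<bar>z n t\<bar>) powr p) + C * A m n"
        using Lp_D(2)[OF sL] A_int[of m n] by (simp add: A_def)
      also have "\<dots> \<le> e powr p / (4 * X) * X + (C + 1) * q"
      proof (rule add_mono)
        show "e powr p / (4 * X) * (LINT t|M. (\<bar>z m t\<bar> + \<bar>z n t\<bar>) powr p) \<le> e powr p / (4 * X) * X"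
          using sX X by (intro mult_left_mono) auto
        have "C * A m n \<le> C * q" using A C by (rule mult_left_mono)
        also have "\<dots> \<le> (C + 1) * q" using q by (simp add: distrib_right)
        finally show "C * A m n \<le> (C + 1) * q" .
      qed
      also have "\<dots> = e powr p / 2" unfolding q(2) using X by simp
      also have "\<dots> < e powr p" using ep by simp
      finally have "nrm (z m - z n) powr p < e powr p" .
      then show "nrm (z m - z n) < e" using e p by (metis less_le_not_le linorder_not_less nrm_nonneg powr_mono2 zero_le_one less_imp_le order_trans)
    qed
  qed
  then obtain g where g: "g \<in> G" "(\<lambda>n. nrm (z n - g)) \<longlonglongrightarrow> 0"
    using G_complete[of z] z(1) by blast
  show thesis by (rule that[OF g(1) r]) (use g(2) in \<open>simp add: z_def\<close>)
qed

end

section \<open>Mountain pass geometry\<close>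

locale ambrosetti_rabinowitz = kirchhoff +
  fixes \<mu> R :: real
  assumes \<mu>: "\<mu> > p\<^sup>2" and R: "R > 0"
    and AR: "\<And>t x. t \<in> {0..T} \<Longrightarrow> \<bar>x\<bar> \<ge> R \<Longrightarrow>
           0 < \<mu> * primitive f t x \<and> \<mu> * primitive f t x \<le> x * f t x"
    and f_small: "uniform_limit {0..T} (\<lambda>x t. f t x / \<bar>x\<bar> powr (p - 1)) (\<lambda>_. 0) (at 0)"
begin

lemma \<mu>_pos: "\<mu> > 0"
  using \<mu> by (meson le_less_trans zero_le_power2)

section \<open>Growth of the nonlinearity\<close>

lemma primitive_bounded:
  obtains K where "K \<ge> 0" "\<And>t x. t \<in> {0..T} \<Longrightarrow> \<bar>x\<bar> \<le> B \<Longrightarrow> \<bar>primitive f t x\<bar> \<le> K"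
proof -
  obtain K where K: "K \<ge> 0" "\<And>t x. t \<in> {0..T} \<Longrightarrow> \<bar>x\<bar> \<le> B \<Longrightarrow> \<bar>f t x\<bar> \<le> K" using f_bounded by blast
  show thesis
  proof (rule that)
    show "\<bar>B\<bar> * K \<ge> 0" using K by simp
    fix t x assume t: "t \<in> {0..T}" and x: "\<bar>x\<bar> \<le> B"
    obtain z where z: "z \<in> closed_segment 0 x" "primitive f t x - primitive f t 0 = (x - 0) * f t z"
      using primitive_mvt[OF t] by blast
    have "\<bar>z\<bar> \<le> \<bar>x\<bar>" using z(1) by (auto simp: closed_segment_eq_real_ivl split: if_splits)
    then have "\<bar>f t z\<bar> \<le> K" using K(2)[OF t] x by simp
    then show "\<bar>primitive f t x\<bar> \<le> \<bar>B\<bar> * K" using z(2) x by (simp add: abs_mult mult_mono)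
  qed
qed

text \<open>\<open>f_small\<close> controls \<open>f\<close> only for x \<noteq> 0, but the
  intermediate point of the mean value theorem may be 0; there \<open>f\<close> vanishes by
  continuity.\<close>

lemma primitive_small:
  assumes e: "\<epsilon> > 0"
  obtains \<delta> where "\<delta> > 0" "\<And>t x. t \<in> {0..T} \<Longrightarrow> \<bar>x\<bar> < \<delta> \<Longrightarrow> \<bar>primitive f t x\<bar> \<le> \<epsilon> * \<bar>x\<bar> powr p"
proof -
  have "\<forall>\<^sub>F x in at 0. \<forall>t\<in>{0..T}. dist (f t x / \<bar>x\<bar> powr (p - 1)) 0 < \<epsilon>"
    using f_small e unfolding uniform_limit_iff by blast
  then obtain \<delta> where \<delta>: "\<delta> > 0" "\<And>x t. x \<noteq> 0 \<Longrightarrow> \<bar>x\<bar> < \<delta> \<Longrightarrow> t \<in> {0..T} \<Longrightarrow> \<bar>f t x / \<bar>x\<bar> powr (p - 1)\<bar> < \<epsilon>"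
    unfolding eventually_at by (auto simp: dist_real_def)
  have nz: "\<bar>f t x\<bar> \<le> \<epsilon> * \<bar>x\<bar> powr (p - 1)" if "x \<noteq> 0" "\<bar>x\<bar> < \<delta>" "t \<in> {0..T}" for x t
  proof -
    have "\<bar>f t x\<bar> / \<bar>x\<bar> powr (p - 1) < \<epsilon>" using \<delta>(2)[OF that] by (simp add: abs_divide)
    then show ?thesis using that by (simp add: divide_less_eq)
  qed
  have f0: "f t 0 = 0" if t: "t \<in> {0..T}" for t
  proof -
    have "isCont (f t) 0" using f_cont_slice[OF t, of UNIV] by (simp add: continuous_on_eq_continuous_at)
    then have "(f t \<longlongrightarrow> f t 0) (at 0)" by (simp add: isCont_def)
    moreover have "(f t \<longlongrightarrow> 0) (at 0)"
    proof (rule Lim_null_comparison)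
      show "\<forall>\<^sub>F x in at 0. norm (f t x) \<le> \<epsilon> * \<bar>x\<bar> powr (p - 1)"
        unfolding eventually_at using nz t \<delta>(1) by (auto simp: dist_real_def)
      have "((\<lambda>x::real. \<epsilon> * \<bar>x\<bar> powr (p - 1)) \<longlongrightarrow> \<epsilon> * \<bar>0\<bar> powr (p - 1)) (at 0)"
        using p by (intro tendsto_mult tendsto_const tendsto_powr' tendsto_rabs tendsto_ident_at) auto
      then show "((\<lambda>x::real. \<epsilon> * \<bar>x\<bar> powr (p - 1)) \<longlongrightarrow> 0) (at 0)" by simp
    qed
    ultimately show ?thesis using LIM_unique by blast
  qed
  show thesis
  proof (rule that[OF \<delta>(1)])
    fix t x assume t: "t \<in> {0..T}" and x: "\<bar>x\<bar> < \<delta>"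
    obtain z where z: "z \<in> closed_segment 0 x" "primitive f t x - primitive f t 0 = (x - 0) * f t z"
      using primitive_mvt[OF t] by blast
    have zx: "\<bar>z\<bar> \<le> \<bar>x\<bar>" using z(1) by (auto simp: closed_segment_eq_real_ivl split: if_splits)
    have "\<bar>f t z\<bar> \<le> \<epsilon> * \<bar>z\<bar> powr (p - 1)" using nz[of z t] f0[OF t] zx x t by (cases "z = 0") auto
    also have "\<dots> \<le> \<epsilon> * \<bar>x\<bar> powr (p - 1)" using zx e p by (intro mult_left_mono powr_mono2) auto
    finally have "\<bar>x\<bar> * \<bar>f t z\<bar> \<le> \<bar>x\<bar> * (\<epsilon> * \<bar>x\<bar> powr (p - 1))" by (intro mult_left_mono) auto
    also have "\<dots> = \<epsilon> * \<bar>x\<bar> powr p" using powr_mult_base[of "\<bar>x\<bar>" "p - 1"] by (simp add: mult.left_commute)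
    finally show "\<bar>primitive f t x\<bar> \<le> \<epsilon> * \<bar>x\<bar> powr p" using z(2) by (simp add: abs_mult)
  qed
qed

text \<open>By the Ambrosetti-Rabinowitz condition, \<open>s powr (- \<mu>)\<close> times the
  primitive at \<open>\<sigma> * s\<close> is nondecreasing for s \<ge> R. Growth of order \<mu>
  therefore starts from the values at R and -R, which have a positive minimum over the compact
  interval of t.\<close>

lemma primitive_growth:
  obtains c1 c2 where "c1 > 0" "c2 \<ge> 0" "\<And>t x. t \<in> {0..T} \<Longrightarrow> c1 * \<bar>x\<bar> powr \<mu> - c2 \<le> primitive f t x"
proof -
  have ray: "primitive f t (\<sigma> * R) * (x / R) powr \<mu> \<le> primitive f t (\<sigma> * x)"
    if t: "t \<in> {0..T}" and x: "x \<ge> R" and \<sigma>: "\<bar>\<sigma>\<bar> = 1" for t x \<sigma>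
  proof -
    define \<psi> where "\<psi> s = primitive f t (\<sigma> * s) * s powr (- \<mu>)" for s
    have "\<psi> R \<le> \<psi> x"
    proof (rule DERIV_nonneg_imp_nondecreasing[OF x])
      fix s assume s: "R \<le> s" "s \<le> x"
      then have s0: "s > 0" using R by simp
      have d: "(\<psi> has_real_derivative (f t (\<sigma> * s) * \<sigma>) * s powr (- \<mu>) + (- \<mu> * s powr (- \<mu> - 1)) * primitive f t (\<sigma> * s)) (at s)"
        unfolding \<psi>_def[abs_def]
      proof (rule DERIV_mult)
        show "((\<lambda>s. primitive f t (\<sigma> * s)) has_real_derivative f t (\<sigma> * s) * \<sigma>) (at s)"
          by (rule DERIV_chain2[OF primitive_derivative[OF t]]) (auto intro!: derivative_eq_intros)
        show "((\<lambda>s. s powr (- \<mu>)) has_real_derivative - \<mu> * s powr (- \<mu> - 1)) (at s)"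
          by (rule has_real_derivative_powr[OF s0])
      qed
      have sp: "s powr (- \<mu>) = s * s powr (- \<mu> - 1)" using powr_mult_base[of s "- \<mu> - 1"] s0 by simp
      have "(f t (\<sigma> * s) * \<sigma>) * s powr (- \<mu>) + (- \<mu> * s powr (- \<mu> - 1)) * primitive f t (\<sigma> * s)
          = s powr (- \<mu> - 1) * (\<sigma> * s * f t (\<sigma> * s) - \<mu> * primitive f t (\<sigma> * s))"
        unfolding sp by (simp add: algebra_simps)
      moreover have "\<mu> * primitive f t (\<sigma> * s) \<le> \<sigma> * s * f t (\<sigma> * s)"
        using AR[OF t, of "\<sigma> * s"] \<sigma> s s0 by (simp add: abs_mult)
      ultimately show "\<exists>y. (\<psi> has_real_derivative y) (at s) \<and> 0 \<le> y" using d by (intro exI conjI) auto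
    qed
    then have "primitive f t (\<sigma> * R) * R powr (- \<mu>) * x powr \<mu> \<le> primitive f t (\<sigma> * x) * x powr (- \<mu>) * x powr \<mu>"
      unfolding \<psi>_def by (intro mult_right_mono) auto
    moreover have "x powr (- \<mu>) * x powr \<mu> = 1" using x R by (simp add: powr_add[symmetric])
    ultimately show ?thesis using x R by (simp add: powr_divide powr_minus field_simps)
  qed
  have low: "\<exists>m>0. \<forall>t\<in>{0..T}. m \<le> primitive f t (\<sigma> * R)" if \<sigma>: "\<bar>\<sigma>\<bar> = 1" for \<sigma>
  proof -
    have "continuous_on {0..T} (\<lambda>t. primitive f t (\<sigma> * R))" by (intro primitive_continuous continuous_intros)
    then obtain t0 where t0: "t0 \<in> {0..T}" "\<And>t. t \<in> {0..T} \<Longrightarrow> primitive f t0 (\<sigma> * R) \<le> primitive f t (\<sigma> * R)"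
      using continuous_attains_inf[of "{0..T}"] T by (metis atLeastatMost_empty_iff2 compact_Icc less_imp_le not_less)
    have "primitive f t0 (\<sigma> * R) > 0"
      using AR[OF t0(1), of "\<sigma> * R"] \<sigma> R \<mu>_pos by (simp add: abs_mult zero_less_mult_iff)
    then show ?thesis using t0(2) by blast
  qed
  obtain m1 where m1: "m1 > 0" "\<And>t. t \<in> {0..T} \<Longrightarrow> m1 \<le> primitive f t (1 * R)" using low[of 1] by auto
  obtain m2 where m2: "m2 > 0" "\<And>t. t \<in> {0..T} \<Longrightarrow> m2 \<le> primitive f t (- 1 * R)" using low[of "- 1"] by auto
  define m where "m = min m1 m2"
  have m: "m > 0" using m1 m2 by (simp add: m_def)
  obtain K where K: "K \<ge> 0" "\<And>t x. t \<in> {0..T} \<Longrightarrow> \<bar>x\<bar> \<le> R \<Longrightarrow> \<bar>primitive f t x\<bar> \<le> K" using primitive_bounded by blast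
  show thesis
  proof (rule that)
    show "m / R powr \<mu> > 0" using m R by simp
    \<comment> \<open>For \<open>\<bar>x\<bar> < R\<close> the power term is at most
      \<open>m\<close> and the primitive at least \<open>- K\<close>, whence this constant.\<close>
    show "m + K \<ge> 0" using m K by simp
    fix t x assume t: "t \<in> {0..T}"
    have eq: "m / R powr \<mu> * \<bar>x\<bar> powr \<mu> = m * (\<bar>x\<bar> / R) powr \<mu>" using R by (simp add: powr_divide)
    show "m / R powr \<mu> * \<bar>x\<bar> powr \<mu> - (m + K) \<le> primitive f t x"
    proof (cases "\<bar>x\<bar> \<ge> R")
      case True
      define \<sigma> :: real where "\<sigma> = (if x \<ge> 0 then 1 else - 1)"
      have \<sigma>: "\<bar>\<sigma>\<bar> = 1" "\<sigma> * \<bar>x\<bar> = x" by (auto simp: \<sigma>_def)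
      have "m \<le> primitive f t (\<sigma> * R)" using m1(2)[OF t] m2(2)[OF t] by (auto simp: \<sigma>_def m_def)
      then have "m * (\<bar>x\<bar> / R) powr \<mu> \<le> primitive f t (\<sigma> * R) * (\<bar>x\<bar> / R) powr \<mu>" by (intro mult_right_mono) auto
      also have "\<dots> \<le> primitive f t x" using ray[OF t True \<sigma>(1)] \<sigma>(2) by simp
      finally show ?thesis unfolding eq using m K by linarith
    next
      case False
      have "(\<bar>x\<bar> / R) powr \<mu> \<le> 1 powr \<mu>" using False R \<mu>_pos by (intro powr_mono2) auto
      then have "m * (\<bar>x\<bar> / R) powr \<mu> \<le> m" using m by simp
      moreover have "- K \<le> primitive f t x" using abs_le_D2[OF K(2)[OF t, of x]] False by simp
      ultimately show ?thesis unfolding eq by linarith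
    qed
  qed
qed

text \<open>The condition is assumed for \<open>\<bar>x\<bar> \<ge> R\<close>; on the remaining
  compact range both sides are bounded, and the constant absorbs them.\<close>

lemma AR_global:
  obtains C where "C \<ge> 0" "\<And>t x. t \<in> {0..T} \<Longrightarrow> \<mu> * primitive f t x - C \<le> f t x * x"
proof -
  obtain K1 where K1: "K1 \<ge> 0" "\<And>t x. t \<in> {0..T} \<Longrightarrow> \<bar>x\<bar> \<le> R \<Longrightarrow> \<bar>primitive f t x\<bar> \<le> K1" using primitive_bounded by blast
  obtain K2 where K2: "K2 \<ge> 0" "\<And>t x. t \<in> {0..T} \<Longrightarrow> \<bar>x\<bar> \<le> R \<Longrightarrow> \<bar>f t x\<bar> \<le> K2" using f_bounded by blast
  show thesis
  proof (rule that)
    show "\<mu> * K1 + K2 * R \<ge> 0" using K1 K2 \<mu>_pos R by simp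
    fix t x assume t: "t \<in> {0..T}"
    show "\<mu> * primitive f t x - (\<mu> * K1 + K2 * R) \<le> f t x * x"
    proof (cases "\<bar>x\<bar> \<ge> R")
      case True
      then show ?thesis using AR[OF t True] K1 K2 \<mu>_pos R
        by (smt (verit) mult.commute mult_nonneg_nonneg)
    next
      case False
      have "\<mu> * primitive f t x \<le> \<mu> * K1" using abs_le_D1[OF K1(2)[OF t, of x]] False \<mu>_pos by simp
      moreover have "\<bar>f t x * x\<bar> \<le> K2 * R" unfolding abs_mult using K2 t False by (intro mult_mono) auto
      then have "- (K2 * R) \<le> f t x * x" by (simp add: abs_le_iff)
      ultimately show ?thesis by linarith
    qed
  qed
qed

section \<open>The geometry of the energy\<close>

lemma J_0: "J 0 = 0"
proof -
  have "U 0 t = 0" for t by (simp add: RL_def zero_fun_def)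
  then show ?thesis using p by (simp add: J_def \<F>_def \<theta>_def \<Psi>_def)
qed

text \<open>The Kirchhoff term has slope at least \<open>a powr (p - 1) / p\<close> in
  \<open>\<Psi>\<close>, hence grows at least like \<open>nrm g powr p\<close>, to which the
  nonlinear term is negligible on small spheres. The bound \<open>B\<close> lets the sphere fit
  inside the ball of the mountain pass.\<close>

lemma local_minimum:
  assumes "B > 0"
  obtains \<rho> \<beta> where "0 < \<rho>" "\<rho> \<le> B" "0 < \<beta>" "\<And>g. g \<in> G \<Longrightarrow> nrm g = \<rho> \<Longrightarrow> \<beta> \<le> J g"
proof -
  define k where "k = a powr (p - 1) / p"
  have k: "k > 0" using a p by (simp add: k_def)
  \<comment> \<open>Chosen so that the bound for the nonlinear term is exactly half of
    \<open>k * \<rho> powr p\<close>.\<close>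
  define \<epsilon> where "\<epsilon> = k / (2 * (T * sup_const powr p))"
  have e: "\<epsilon> > 0" "T * (\<epsilon> * sup_const powr p) = k / 2" using k T sup_const_pos by (simp_all add: \<epsilon>_def)
  obtain \<delta> where \<delta>: "\<delta> > 0" "\<And>t x. t \<in> {0..T} \<Longrightarrow> \<bar>x\<bar> < \<delta> \<Longrightarrow> \<bar>primitive f t x\<bar> \<le> \<epsilon> * \<bar>x\<bar> powr p"
    using primitive_small[OF e(1)] by blast
  define \<rho> where "\<rho> = min B (\<delta> / (2 * sup_const))"
  have \<rho>: "\<rho> > 0" "\<rho> \<le> B" "sup_const * \<rho> < \<delta>"
  proof -
    show "\<rho> > 0" "\<rho> \<le> B" using assms \<delta> sup_const_pos by (auto simp: \<rho>_def)
    have "sup_const * \<rho> \<le> sup_const * (\<delta> / (2 * sup_const))" using sup_const_pos by (intro mult_left_mono) (auto simp: \<rho>_def)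
    also have "\<dots> < \<delta>" using sup_const_pos \<delta> by simp
    finally show "sup_const * \<rho> < \<delta>" .
  qed
  show thesis
  proof (rule that[OF \<rho>(1,2)])
    show "k / 2 * \<rho> powr p > 0" using k \<rho> by simp
    fix g assume g: "g \<in> G" "nrm g = \<rho>"
    have F: "\<bar>\<F> g\<bar> \<le> T * (\<epsilon> * (sup_const * \<rho>) powr p)"
      unfolding \<F>_def
    proof (rule integral_abs_le[OF F_U_integrable[OF g(1)]])
      fix t assume t: "t \<in> {0..T}"
      have Ug: "\<bar>U g t\<bar> \<le> sup_const * \<rho>" using U_bound[OF G_Lp[OF g(1)] t] g(2) by simp
      then have "\<bar>primitive f t (U g t)\<bar> \<le> \<epsilon> * \<bar>U g t\<bar> powr p" using \<delta>(2)[OF t] \<rho>(3) by simp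
      also have "\<dots> \<le> \<epsilon> * (sup_const * \<rho>) powr p" using Ug e p by (intro mult_left_mono powr_mono2) auto
      finally show "\<bar>primitive f t (U g t)\<bar> \<le> \<epsilon> * (sup_const * \<rho>) powr p" .
    qed
    have F': "T * (\<epsilon> * (sup_const * \<rho>) powr p) = k / 2 * \<rho> powr p"
      unfolding e(2)[symmetric] by (simp only: powr_mult mult.assoc)
    obtain z where z: "z \<in> closed_segment 0 (\<Psi> g)" "\<theta> (\<Psi> g) - \<theta> 0 = (\<Psi> g - 0) * \<theta>' z"
      using mvt_segment[of 0 "\<Psi> g" \<theta> \<theta>'] \<theta>_derivative \<Psi>_nonneg[of g] by (fastforce simp: closed_segment_eq_real_ivl)
    have "z \<ge> 0" using z(1) \<Psi>_nonneg[of g] by (auto simp: closed_segment_eq_real_ivl)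
    then have "k \<le> \<theta>' z" unfolding k_def \<theta>'_def using a b p by (intro divide_right_mono powr_mono2) auto
    then have "\<Psi> g * k \<le> \<Psi> g * \<theta>' z" using \<Psi>_nonneg by (intro mult_left_mono) auto
    then have "\<rho> powr p * k \<le> \<theta> (\<Psi> g) - \<theta> 0" using z(2) g(2) by (simp add: \<Psi>_nrm)
    moreover have "J g = \<theta> (\<Psi> g) - \<theta> 0 - \<F> g" by (simp add: J_def \<theta>_def)
    ultimately show "k / 2 * \<rho> powr p \<le> J g"
      using abs_le_D1[OF F] unfolding F' by (simp add: mult.commute)
  qed
qed

text \<open>Along a ray the Kirchhoff term grows at most like \<open>s powr p\<^sup>2\<close>, the
  nonlinear term at least like \<open>s powr \<mu>\<close>. An upper bound for \<open>J\<close>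
  suffices, because paths are asked to reach a large radius and not a point of low energy.\<close>

lemma ray_bounded:
  obtains g C where "g \<in> G" "nrm g > 0" "\<And>s. s \<ge> 0 \<Longrightarrow> J (s *\<^sub>R g) \<le> C"
proof -
  obtain g where g: "g \<in> G" "\<And>t. t \<in> {0..T} \<Longrightarrow> U g t = t * (T - t)" using G_nontrivial by blast
  have mid: "T / 2 \<in> {0..T}" "U g (T / 2) \<noteq> 0" using g(2)[of "T / 2"] T by auto
  have "nrm g \<noteq> 0" using U_bound[OF G_Lp[OF g(1)] mid(1)] mid(2) by auto
  then have ng: "nrm g > 0" using nrm_nonneg[of g] by linarith
  obtain c1 c2 where c: "c1 > 0" "c2 \<ge> 0" "\<And>t x. t \<in> {0..T} \<Longrightarrow> c1 * \<bar>x\<bar> powr \<mu> - c2 \<le> primitive f t x"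
    using primitive_growth by blast
  define I where "I = (LINT t|M. \<bar>U g t\<bar> powr \<mu>)"
  have Uc: "continuous_on {0..T} (\<lambda>t. \<bar>U g t\<bar> powr \<mu>)"
    using \<mu>_pos U_continuous[OF G_Lp[OF g(1)]] by (intro continuous_on_powr' continuous_intros) auto
  have Ui: "integrable M (\<lambda>t. \<bar>U g t\<bar> powr \<mu>)" by (rule continuous_integrable[OF Uc])
  have I: "I > 0"
  proof -
    have "I \<ge> 0" unfolding I_def by (intro integral_nonneg_AE) auto
    moreover have "I \<noteq> 0"
    proof
      assume "I = 0"
      then have "AE t in M. \<bar>U g t\<bar> powr \<mu> = 0"
        using Ui unfolding I_def by (subst (asm) integral_nonneg_eq_0_iff_AE) auto
      then have "AE t in M. \<bar>U g t\<bar> powr p = 0" by eventually_elim simp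
      then have "nrm (U g) = 0" unfolding Lp_norm_def by (simp add: integral_eq_zero_AE)
      then show False using continuous_zero[OF U_continuous[OF G_Lp[OF g(1)]] _ mid(1)] mid(2) by simp
    qed
    ultimately show ?thesis by simp
  qed
  define A where "A = (a + b * \<Psi> g) powr p / (b * p\<^sup>2)"
  have "a + b * \<Psi> g > 0" "b * p\<^sup>2 > 0" using a b p \<Psi>_nonneg[of g] by (simp_all add: add_pos_nonneg)
  then have A: "A > 0" by (simp add: A_def)
  define B where "B = c1 * I"
  have B: "B > 0" using c I by (simp add: B_def)
  \<comment> \<open>The point where \<open>A * s powr p\<^sup>2\<close> and
    \<open>B * s powr \<mu>\<close> balance; beyond it the second dominates.\<close>
  define S where "S = (A / B) powr (1 / (\<mu> - p\<^sup>2))"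
  have S: "S > 0" "S powr (\<mu> - p\<^sup>2) = A / B" using A B \<mu> by (simp_all add: S_def powr_powr)
  have J_le: "J (s *\<^sub>R g) \<le> 1 / (b * p\<^sup>2) * (a + b * (s powr p * \<Psi> g)) powr p - B * s powr \<mu> + c2 * T" if s: "s \<ge> 0" for s
  proof -
    have sg: "s *\<^sub>R g \<in> G" using g by auto
    have Us: "U (s *\<^sub>R g) t = s * U g t" if "t \<in> {0..T}" for t
      using U_scale[OF G_Lp[OF g(1)] that, of s] by (simp add: scaleR_fun_def)
    have "B * s powr \<mu> - c2 * T = (LINT t|M. c1 * (s powr \<mu> * \<bar>U g t\<bar> powr \<mu>) - c2)"
      using Ui by (simp add: B_def I_def measure_M mult_ac)
    also have "\<dots> \<le> \<F> (s *\<^sub>R g)"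
      unfolding \<F>_def
    proof (rule integral_mono[OF _ F_U_integrable[OF sg]])
      show "integrable M (\<lambda>t. c1 * (s powr \<mu> * \<bar>U g t\<bar> powr \<mu>) - c2)" using Ui by simp
      fix t assume "t \<in> space M"
      then have t: "t \<in> {0..T}" by simp
      show "c1 * (s powr \<mu> * \<bar>U g t\<bar> powr \<mu>) - c2 \<le> primitive f t (U (s *\<^sub>R g) t)"
        using c(3)[OF t, of "s * U g t"] s unfolding Us[OF t] by (simp add: abs_mult powr_mult)
    qed
    finally have F: "B * s powr \<mu> - c2 * T \<le> \<F> (s *\<^sub>R g)" .
    have "nrm (s *\<^sub>R g) = s * nrm g" using G.N_scale[OF g(1), of s] s by simp
    then have "\<Psi> (s *\<^sub>R g) = s powr p * \<Psi> g" by (simp add: \<Psi>_nrm powr_mult)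
    moreover have "a powr p / (b * p\<^sup>2) \<ge> 0" using b by simp
    ultimately show ?thesis using F by (simp add: J_def \<theta>_def)
  qed
  have ASp: "A * S powr p\<^sup>2 \<ge> 0" using A by simp
  have poly: "A * s powr p\<^sup>2 - B * s powr \<mu> \<le> A * S powr p\<^sup>2" if s: "s \<ge> 0" for s
  proof (cases "s \<le> S")
    case True
    then have "s powr p\<^sup>2 \<le> S powr p\<^sup>2" using s by (intro powr_mono2) auto
    then have "A * s powr p\<^sup>2 \<le> A * S powr p\<^sup>2" using A by simp
    moreover have "B * s powr \<mu> \<ge> 0" using B by simp
    ultimately show ?thesis by linarith
  next
    case False
    then have sS: "s > 0" "S \<le> s" using S by auto
    have "A / B \<le> s powr (\<mu> - p\<^sup>2)" unfolding S(2)[symmetric] using sS S \<mu> by (intro powr_mono2) auto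
    then have "A \<le> B * s powr (\<mu> - p\<^sup>2)" using B by (simp add: divide_le_eq mult.commute)
    then have "A * s powr p\<^sup>2 \<le> B * s powr (\<mu> - p\<^sup>2) * s powr p\<^sup>2" by (intro mult_right_mono) auto
    also have "\<dots> = B * s powr \<mu>" by (simp add: mult.assoc powr_add[symmetric])
    finally show ?thesis using ASp by linarith
  qed
  show thesis
  proof (rule that[OF g(1) ng])
    fix s :: real assume s: "s \<ge> 0"
    \<comment> \<open>For s \<le> 1 the left side is at most \<open>A\<close> by monotonicity. For s
      > 1 the constant \<open>a\<close> is absorbed into \<open>a * s powr p\<close>, and a second
      power \<open>p\<close> gives the exponent p^2.\<close>
    have "1 / (b * p\<^sup>2) * (a + b * (s powr p * \<Psi> g)) powr p \<le> A + A * s powr p\<^sup>2"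
    proof (cases "s \<le> 1")
      case True
      then have "s powr p \<le> 1 powr p" using s p by (intro powr_mono2) auto
      then have "s powr p * \<Psi> g \<le> 1 * \<Psi> g" using \<Psi>_nonneg by (intro mult_right_mono) auto
      then have "a + b * (s powr p * \<Psi> g) \<le> a + b * \<Psi> g" using b by simp
      then have "(a + b * (s powr p * \<Psi> g)) powr p \<le> (a + b * \<Psi> g) powr p"
        using a b p \<Psi>_nonneg[of g] by (intro powr_mono2) auto
      then have "1 / (b * p\<^sup>2) * (a + b * (s powr p * \<Psi> g)) powr p \<le> A"
        unfolding A_def using b p by (simp add: divide_right_mono)
      moreover have "A * s powr p\<^sup>2 \<ge> 0" using A by simp
      ultimately show ?thesis by linarith
    next
      case False
      then have "1 powr p \<le> s powr p" using p by (intro powr_mono2) auto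
      then have "a * 1 \<le> a * s powr p" using a by (intro mult_left_mono) auto
      then have "a + b * (s powr p * \<Psi> g) \<le> s powr p * (a + b * \<Psi> g)" by (simp add: algebra_simps)
      then have "(a + b * (s powr p * \<Psi> g)) powr p \<le> (s powr p * (a + b * \<Psi> g)) powr p"
        using a b p \<Psi>_nonneg[of g] by (intro powr_mono2) auto
      also have "\<dots> = s powr p\<^sup>2 * (a + b * \<Psi> g) powr p"
        by (simp add: powr_mult powr_powr power2_eq_square)
      finally have "1 / (b * p\<^sup>2) * (a + b * (s powr p * \<Psi> g)) powr p \<le> 1 / (b * p\<^sup>2) * (s powr p\<^sup>2 * (a + b * \<Psi> g) powr p)"
        using b by (intro mult_left_mono) auto
      also have "\<dots> = A * s powr p\<^sup>2" by (simp add: A_def)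
      finally show ?thesis using A by linarith
    qed
    then show "J (s *\<^sub>R g) \<le> A + A * S powr p\<^sup>2 + c2 * T"
      using J_le[OF s] poly[OF s] by linarith
  qed
qed

text \<open>Replacing the nonlinear pairing in \<open>DJ g g\<close> by \<mu> times
  \<open>\<F> g\<close>, and this by the energy, leaves a negative multiple of
  \<open>(a + b * \<Psi> g) powr p\<close>, as \<mu> / p^2 > 1, up to a constant. For large norm
  this outweighs \<open>nrm g\<close>. The same computation usually serves to bound Palais-Smale
  sequences.\<close>

lemma descent_at_infinity:
  obtains B where "B \<ge> 1" "\<And>g. g \<in> G \<Longrightarrow> nrm g \<ge> B \<Longrightarrow> J g \<le> C \<Longrightarrow> DJ g g \<le> - nrm g"
proof -
  obtain C3 where C3: "C3 \<ge> 0" "\<And>t x. t \<in> {0..T} \<Longrightarrow> \<mu> * primitive f t x - C3 \<le> f t x * x" using AR_global by blast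
  define k where "k = (\<mu> / p\<^sup>2 - 1) / b"
  have p2: "p\<^sup>2 > 1" using p by (simp add: one_less_power)
  have "1 < \<mu> / p\<^sup>2" using \<mu> p2 by (subst less_divide_eq_1_pos) auto
  then have k: "k > 0" using b by (simp add: k_def)
  define C4 where "C4 = \<bar>\<mu> * (a powr p / (b * p\<^sup>2)) + \<mu> * C + C3 * T\<bar>"
  \<comment> \<open>Chosen so that n \<ge> B gives
    \<open>1 + C4 \<le> n powr (p\<^sup>2 - 1) * (k * b powr p)\<close>; multiplied by n \<ge> 1,
    this pays for \<open>C4\<close> and for the required decrease \<open>n\<close>.\<close>
  define B where "B = max 1 (((1 + C4) / (k * b powr p)) powr (1 / (p\<^sup>2 - 1)))"
  have C4: "C4 \<ge> 0" by (simp add: C4_def)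
  show thesis
  proof (rule that)
    show "B \<ge> 1" by (simp add: B_def)
    fix g assume g: "g \<in> G" "nrm g \<ge> B" "J g \<le> C"
    define n where "n = nrm g"
    have n: "n \<ge> 1" using g(2) by (simp add: n_def B_def)
    define X where "X = (a + b * \<Psi> g) powr p"
    have base: "a + b * \<Psi> g > 0" using a b \<Psi>_nonneg[of g] by (simp add: add_pos_nonneg)
    have pairing: "(LINT t|M. phi p (g t) * g t) = \<Psi> g" unfolding \<Psi>_def by (simp add: phi_mult_self)
    have "(a + b * \<Psi> g) powr (p - 1) * (b * \<Psi> g) \<le> (a + b * \<Psi> g) powr (p - 1) * (a + b * \<Psi> g)"
      using a by (intro mult_left_mono) auto
    also have "\<dots> = X" unfolding X_def using powr_mult_base[of "a + b * \<Psi> g" "p - 1"] base by (simp add: mult.commute)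
    finally have 1: "(a + b * \<Psi> g) powr (p - 1) * \<Psi> g \<le> X / b" using b by (simp add: le_divide_eq mult_ac)
    have "\<mu> * \<F> g - C3 * T = (LINT t|M. \<mu> * primitive f t (U g t) - C3)"
      using F_U_integrable[OF g(1)] by (simp add: \<F>_def measure_M mult.commute)
    also have "\<dots> \<le> d\<F> g g"
      unfolding d\<F>_def using F_U_integrable[OF g(1)] f_U_integrable[OF g(1) g(1)] C3
      by (intro integral_mono) auto
    finally have 2: "\<mu> * \<F> g - C3 * T \<le> d\<F> g g" .
    have "\<F> g = X / (b * p\<^sup>2) - J g - a powr p / (b * p\<^sup>2)" by (simp add: J_def \<theta>_def X_def)
    then have "X / (b * p\<^sup>2) - C - a powr p / (b * p\<^sup>2) \<le> \<F> g" using g(3) by simp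
    then have "\<mu> * (X / (b * p\<^sup>2) - C - a powr p / (b * p\<^sup>2)) \<le> \<mu> * \<F> g" using \<mu>_pos by (intro mult_left_mono) auto
    then have "\<mu> * (X / (b * p\<^sup>2)) - \<mu> * C - \<mu> * (a powr p / (b * p\<^sup>2)) \<le> \<mu> * \<F> g" by (simp only: right_diff_distrib)
    moreover have "DJ g g \<le> X / b - d\<F> g g" using 1 by (simp add: DJ_eq pairing)
    moreover have "\<mu> * (a powr p / (b * p\<^sup>2)) + \<mu> * C + C3 * T \<le> C4" by (simp add: C4_def)
    ultimately have "DJ g g \<le> X / b - \<mu> * (X / (b * p\<^sup>2)) + C4" using 2 by linarith
    also have "X / b - \<mu> * (X / (b * p\<^sup>2)) = - (k * X)" using b p by (simp add: k_def field_simps)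
    finally have 3: "DJ g g \<le> - (k * X) + C4" .
    have "b powr p * n powr p\<^sup>2 = (b * n powr p) powr p" using b by (simp add: powr_mult powr_powr power2_eq_square)
    also have "\<dots> \<le> X" unfolding X_def \<Psi>_nrm n_def using a b p by (intro powr_mono2) auto
    finally have X: "k * (b powr p * n powr p\<^sup>2) \<le> k * X" using k by simp
    have "((1 + C4) / (k * b powr p)) = (((1 + C4) / (k * b powr p)) powr (1 / (p\<^sup>2 - 1))) powr (p\<^sup>2 - 1)"
      using C4 k b p2 by (simp add: powr_powr)
    also have "\<dots> \<le> n powr (p\<^sup>2 - 1)" using g(2) p2 by (intro powr_mono2) (auto simp: n_def B_def)
    finally have "1 + C4 \<le> n powr (p\<^sup>2 - 1) * (k * b powr p)" using k b by (simp add: divide_le_eq)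
    then have "n * (1 + C4) \<le> n * (n powr (p\<^sup>2 - 1) * (k * b powr p))" using n by (intro mult_left_mono) auto
    also have "\<dots> = k * (b powr p * n powr p\<^sup>2)" using powr_mult_base[of n "p\<^sup>2 - 1"] n by (simp add: mult_ac)
    finally have "n * (1 + C4) \<le> k * X" using X by linarith
    moreover have "1 * C4 \<le> n * C4" using n C4 by (intro mult_right_mono) auto
    ultimately have "n + C4 \<le> k * X" by (simp add: distrib_left)
    then show "DJ g g \<le> - nrm g" using 3 by (simp add: n_def)
  qed
qed

lemma critical_point_exists:
  obtains g where "g \<in> G" "J g > 0" "\<And>h. h \<in> G \<Longrightarrow> DJ g h = 0"
proof -
  obtain g0 C where g0: "g0 \<in> G" "nrm g0 > 0" "\<And>s. s \<ge> 0 \<Longrightarrow> J (s *\<^sub>R g0) \<le> C" using ray_bounded by blast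
  \<comment> \<open>\<open>C + 1\<close> matches the slack in \<open>mountain_pass\<close>, which is
    applied with radius \<open>B + 1\<close> and so asks for descent from radius \<open>B\<close>
    on.\<close>
  obtain B where B: "B \<ge> 1" "\<And>g. g \<in> G \<Longrightarrow> nrm g \<ge> B \<Longrightarrow> J g \<le> C + 1 \<Longrightarrow> DJ g g \<le> - nrm g"
    using descent_at_infinity by blast
  have "B + 1 > 0" using B by simp
  then obtain \<rho> \<beta> where \<rho>: "0 < \<rho>" "\<rho> \<le> B + 1" "0 < \<beta>" "\<And>g. g \<in> G \<Longrightarrow> nrm g = \<rho> \<Longrightarrow> \<beta> \<le> J g"
    using local_minimum by blast
  have "\<exists>c\<ge>\<beta>. \<forall>\<kappa>>0. \<exists>x\<in>G. nrm x \<le> B + 1 \<and> \<bar>J x - c\<bar> \<le> \<kappa> \<and> (\<forall>v\<in>G. \<bar>DJ x v\<bar> \<le> \<kappa> * nrm v)"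
    by (rule J.mountain_pass[OF \<rho>(1,2) _ \<rho>(4) g0]) (use J_0 \<rho>(3) B in auto)
  then obtain c where c: "c \<ge> \<beta>" "\<And>\<kappa>. \<kappa> > 0 \<Longrightarrow> \<exists>x\<in>G. nrm x \<le> B + 1 \<and> \<bar>J x - c\<bar> \<le> \<kappa> \<and> (\<forall>v\<in>G. \<bar>DJ x v\<bar> \<le> \<kappa> * nrm v)"
    by blast
  have "\<exists>x. x \<in> G \<and> nrm x \<le> B + 1 \<and> \<bar>J x - c\<bar> \<le> inverse (real (Suc n)) \<and> (\<forall>v\<in>G. \<bar>DJ x v\<bar> \<le> inverse (real (Suc n)) * nrm v)" for n
    using c(2)[of "inverse (real (Suc n))"] by auto
  then obtain x where x: "\<And>n. x n \<in> G" "\<And>n. nrm (x n) \<le> B + 1" "\<And>n. \<bar>J (x n) - c\<bar> \<le> inverse (real (Suc n))"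
    "\<And>n v. v \<in> G \<Longrightarrow> \<bar>DJ (x n) v\<bar> \<le> inverse (real (Suc n)) * nrm v"
    by metis
  obtain g r where g: "g \<in> G" "strict_mono r" "(\<lambda>n. nrm (x (r n) - g)) \<longlonglongrightarrow> 0"
    using palais_smale[OF x(1,2) LIMSEQ_inverse_real_of_nat x(4)] by blast
  have \<kappa>: "(\<lambda>n. inverse (real (Suc (r n)))) \<longlonglongrightarrow> 0"
    using LIMSEQ_subseq_LIMSEQ[OF LIMSEQ_inverse_real_of_nat g(2)] by (simp add: comp_def)
  note lim = J.critical_limit[OF x(1,2) g(1,3) \<kappa> x(4,3)]
  show thesis by (rule that[OF g(1)]) (use lim c(1) \<rho>(3) in auto)
qed

section \<open>Return to the original space\<close>

lemma energy_eq:
  assumes g: "g \<in> G" and u: "\<And>t. t \<in> {0..T} \<Longrightarrow> u t = U g t"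
  shows "energy T a b p \<alpha> f u = J g"
proof -
  have "(LINT t|M. primitive f t (u t)) = \<F> g"
    unfolding \<F>_def by (rule Bochner_Integration.integral_cong) (auto simp: u)
  then show ?thesis
    unfolding energy_def J_def \<theta>_def using E_norm_eq[OF g u] by (simp add: \<Psi>_nrm)
qed

lemma weak_solution_exists:
  "\<exists>u. weak_solution T a b p \<alpha> f u \<and> u 0 = 0 \<and> u T = 0 \<and> (\<exists>t\<in>{0..T}. u t \<noteq> 0)"
proof -
  obtain g where g: "g \<in> G" "J g > 0" "\<And>h. h \<in> G \<Longrightarrow> DJ g h = 0" using critical_point_exists by blast
  have "weak_solution T a b p \<alpha> f (U g)"
    unfolding weak_solution_def critical_point_def
  proof (intro conjI allI impI)
    show "U g \<in> E0 \<alpha> p T" using E0_iff g(1) by blast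
    fix \<epsilon> :: real assume e: "\<epsilon> > 0"
    \<comment> \<open>As \<open>DJ g\<close> vanishes on \<open>G\<close>, the expansion of
      \<open>J\<close> at \<open>g\<close> is already the criticality condition; what remains is to
      pass from \<open>v\<close> to its derivative \<open>h\<close>.\<close>
    obtain \<delta> where \<delta>: "\<delta> > 0" "\<And>x v. x \<in> G \<Longrightarrow> v \<in> G \<Longrightarrow> nrm x \<le> nrm g \<Longrightarrow> nrm v \<le> \<delta> \<Longrightarrow>
        \<bar>J (x + v) - J x - DJ x v\<bar> \<le> \<epsilon> * nrm v"
      by (fact uniformly_differentiableE[OF J.J_diff e, where M = "nrm g"])
    show "\<exists>\<delta>>0. \<forall>v\<in>E0 \<alpha> p T. E_norm \<alpha> p T v < \<delta> \<longrightarrow>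
        \<bar>energy T a b p \<alpha> f (\<lambda>t. U g t + v t) - energy T a b p \<alpha> f (U g)\<bar> \<le> \<epsilon> * E_norm \<alpha> p T v"
    proof (intro exI[of _ \<delta>] conjI ballI impI \<delta>(1))
      fix v assume v: "v \<in> E0 \<alpha> p T" "E_norm \<alpha> p T v < \<delta>"
      obtain h where h: "h \<in> G" "\<And>t. t \<in> {0..T} \<Longrightarrow> v t = U h t" using v(1) E0_iff by blast
      have Nv: "E_norm \<alpha> p T v = nrm h" by (rule E_norm_eq[OF h])
      have gh: "g + h \<in> G" using g h by auto
      have "energy T a b p \<alpha> f (\<lambda>t. U g t + v t) = J (g + h)"
        by (rule energy_eq[OF gh]) (use U_add[OF G_Lp[OF g(1)] G_Lp[OF h(1)]] h(2) in \<open>simp add: plus_fun_def\<close>)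
      moreover have "energy T a b p \<alpha> f (U g) = J g" by (rule energy_eq[OF g(1)]) simp
      moreover have "\<bar>J (g + h) - J g - DJ g h\<bar> \<le> \<epsilon> * nrm h" using \<delta>(2)[OF g(1) h(1)] v(2) Nv by simp
      ultimately show "\<bar>energy T a b p \<alpha> f (\<lambda>t. U g t + v t) - energy T a b p \<alpha> f (U g)\<bar> \<le> \<epsilon> * E_norm \<alpha> p T v"
        using g(3)[OF h(1)] Nv by simp
    qed
  qed
  moreover have "\<exists>t\<in>{0..T}. U g t \<noteq> 0"
  proof (rule ccontr)
    assume "\<not> ?thesis"
    \<comment> \<open>If \<open>U g\<close> were 0 on the interval, the zero function would be
      represented both by \<open>g\<close> and by 0, so its energy would be \<open>J g\<close> and
      \<open>J 0\<close> at once.\<close>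
    then have "energy T a b p \<alpha> f (\<lambda>t. 0) = J g" by (intro energy_eq[OF g(1)]) simp
    moreover have "energy T a b p \<alpha> f (\<lambda>t. 0) = J 0"
      by (rule energy_eq[OF G.X_closed(1)]) (simp add: RL_def)
    ultimately show False using J_0 g(2) by simp
  qed
  ultimately show ?thesis using U_0[of g] U_T[OF g(1)] by blast
qed

end

theorem theorem1p1:
  fixes T a b p \<alpha> \<mu> R :: real and f :: "real \<Rightarrow> real \<Rightarrow> real"
  assumes "T > 0" and "a > 0" and "b > 0" and "p > 1" and "1 / p < \<alpha>" and "\<alpha> \<le> 1"
    and "continuous_on ({0..T} \<times> UNIV) (\<lambda>(t, x). f t x)"
    and "\<mu> > p\<^sup>2" and "R > 0"
    and "\<And>t x. t \<in> {0..T} \<Longrightarrow> \<bar>x\<bar> \<ge> R \<Longrightarrow>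
           0 < \<mu> * primitive f t x \<and> \<mu> * primitive f t x \<le> x * f t x"
    and "uniform_limit {0..T} (\<lambda>x t. f t x / \<bar>x\<bar> powr (p - 1)) (\<lambda>_. 0) (at 0)"
  shows "\<exists>u. weak_solution T a b p \<alpha> f u \<and> u 0 = 0 \<and> u T = 0 \<and> (\<exists>t\<in>{0..T}. u t \<noteq> 0)"
proof -
  interpret ambrosetti_rabinowitz p T \<alpha> a b f \<mu> R
    by unfold_locales (use assms in auto)
  show ?thesis by (rule weak_solution_exists)
qed

end
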